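(* Let $M^n$ be a closed connected smooth triangulable $n$-manifold and let $X$ be a cpx on $M$ all of whose $2$-cells are even sided. Then the holonomy $\mathrm{Hol}_{X^{(1)}}:\pi_1(X^{(1)})\to S_{n+1}$ extends uniquely to a homomorphism $\mathrm{Hol}_X:\pi_1(M)\to S_{n+1}$, i.e. there is a unique homomorphism $\mathrm{Hol}_X:\pi_1(M)\to S_{n+1}$ whose composition with the map $\pi_1(X^{(1)})\to\pi_1(M)$ induced by inclusion is $\mathrm{Hol}_{X^{(1)}}$.
   Context: A cpx $X$ on a closed connected smooth triangulable manifold $M^n$ (without boundary) is a cell complex structure on $M$ with embedded cells that is dual to a simplicial triangulation of $M$ (it is not required that two regions meet in at most one cell). It has regular degree: for $1\le k\le n$, exactly $n-k+2$ $k$-cells meet at each $(k-1)$-cell. $X^{(i)}$ is the $i$-skeleton; $n$-cells are called regions. A $2$-cell is even sided if it has an even number of edges. Holonomy on the $1$-skeleton: exactly $n+1$ regions meet at each vertex and $n$ regions at each edge. Fix a base vertex $v_0$ and a coloring of the $n+1$ regions at $v_0$ by the $n+1$ distinct colors $1,\dots,n+1$. Along an edge path in $X^{(1)}$ the coloring is transported: along an edge the $n$ regions adjacent to the edge keep their colors, and the one new region at the end vertex is assigned the unused color. Along a closed edge path based at $v_0$ the final coloring at $v_0$ differs from the initial one by a permutation in $S_{n+1}$, with composition of cycles corresponding to composition of permutations; this defines $\mathrm{Hol}_{X^{(1)}}:\pi_1(X^{(1)})\to S_{n+1}$. *)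

theory Defs
  imports "HOL-Analysis.Analysis" "HOL-Algebra.Sym_Groups"
begin

section \<open>Closed smooth manifolds\<close>

text \<open>\<open>k\<close>-fold continuous differentiability, for functions on an open set \<open>S\<close>.\<close>

primrec Ck_on :: "nat \<Rightarrow> 'b::real_normed_vector set \<Rightarrow> ('b \<Rightarrow> 'c::real_normed_vector) \<Rightarrow> bool" where
  "Ck_on 0 S f \<longleftrightarrow> continuous_on S f"
| "Ck_on (Suc k) S f \<longleftrightarrow>
     f differentiable_on S \<and> (\<forall>v. Ck_on k S (\<lambda>x. frechet_derivative f (at x) v))"

definition smooth_map_on :: "'b::real_normed_vector set \<Rightarrow> ('b \<Rightarrow> 'c::real_normed_vector) \<Rightarrow> bool" where
  "smooth_map_on S f \<longleftrightarrow> (\<forall>k. Ck_on k S f)"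

definition smooth_atlas ::
  "'a::topological_space set \<Rightarrow> ('a set \<times> ('a \<Rightarrow> real ^ 'n)) set \<Rightarrow> bool" where
  "smooth_atlas M A \<longleftrightarrow>
     (\<forall>(U, \<phi>) \<in> A. openin (top_of_set M) U \<and> open (\<phi> ` U) \<and> (\<exists>\<psi>. homeomorphism U (\<phi> ` U) \<phi> \<psi>)) \<and>
     (\<Union>(U, \<phi>) \<in> A. U) = M \<and>
     (\<forall>(U, \<phi>) \<in> A. \<forall>(V, \<psi>) \<in> A. smooth_map_on (\<phi> ` (U \<inter> V)) (\<psi> \<circ> inv_into U \<phi>))"

definition closed_smooth_manifold ::
  "'a::topological_space set \<Rightarrow> ('a set \<times> ('a \<Rightarrow> real ^ 'n)) set \<Rightarrow> bool" where
  "closed_smooth_manifold M A \<longleftrightarrow>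
     Hausdorff_space (top_of_set M) \<and> second_countable (top_of_set M) \<and> compact M \<and>
     smooth_atlas M A"


section \<open>Cell complexes dual to triangulations\<close>

text \<open>
  A complex on \<open>M\<close> is given by its sets \<open>X k\<close> of closed \<open>k\<close>-cells.  The dimension of the ambient
  manifold enters through the index type \<open>'n\<close>; model balls and model simplices of dimension
  \<open>k \<le> CARD('n)\<close> are taken inside \<open>real ^ 'n\<close>, so there are no cells of higher dimension.
\<close>

definition cell_boundary :: "(nat \<Rightarrow> 'a set set) \<Rightarrow> nat \<Rightarrow> 'a set \<Rightarrow> 'a set" where
  "cell_boundary X k c = \<Union>{d. \<exists>j<k. d \<in> X j \<and> d \<subseteq> c}"

text \<open>
  Embedded cells: each closed \<open>k\<close>-cell is the homeomorphic image of the closed unit ball of a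
  \<open>k\<close>-dimensional Euclidean space, the unit sphere going onto a union of cells of lower dimension.
\<close>

definition embedded_cell_complex ::
  "'n::finite itself \<Rightarrow> 'a::topological_space set \<Rightarrow> (nat \<Rightarrow> 'a set set) \<Rightarrow> bool" where
  "embedded_cell_complex _ M X \<longleftrightarrow>
     finite (\<Union>k. X k) \<and>
     (\<forall>k. \<forall>c \<in> X k. c \<subseteq> M \<and>
        (\<exists>(V :: (real ^ 'n) set) h g. subspace V \<and> dim V = k \<and>
           homeomorphism (V \<inter> cball 0 1) c h g \<and> h ` (V \<inter> sphere 0 1) = cell_boundary X k c)) \<and>
     (\<forall>x \<in> M. \<exists>!c. \<exists>k. c \<in> X k \<and> x \<in> c - cell_boundary X k c)"

text \<open>
  Triangulations by embedded simplices, where several simplices may share the same vertex set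
  (dually, two regions may meet in several cells): \<open>\<kappa> s\<close> is the characteristic map of \<open>s\<close>, its
  restriction to a face is, up to an affine change of coordinates, the characteristic map of a
  simplex, and the open simplices partition \<open>M\<close>.
\<close>

definition simplicial_triangulation ::
  "'n::finite itself \<Rightarrow> 'a::topological_space set \<Rightarrow> (nat \<Rightarrow> 'a set set) \<Rightarrow> bool" where
  "simplicial_triangulation _ M T \<longleftrightarrow>
     finite (\<Union>k. T k) \<and>
     (\<exists>(\<Delta> :: 'a set \<Rightarrow> (real ^ 'n) set) \<kappa>.
        (\<forall>k. \<forall>s \<in> T k. s \<subseteq> M \<and> int k simplex \<Delta> s \<and> (\<exists>g. homeomorphism (\<Delta> s) s (\<kappa> s) g) \<and>
           (\<forall>F. F face_of \<Delta> s \<and> F \<noteq> {} \<longrightarrow>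
              \<kappa> s ` F \<in> T (nat (aff_dim F)) \<and>
              (\<exists>a L. linear L \<and> (\<lambda>y. a + L y) ` \<Delta> (\<kappa> s ` F) = F \<and>
                 (\<forall>y \<in> \<Delta> (\<kappa> s ` F). \<kappa> (\<kappa> s ` F) y = \<kappa> s (a + L y))))) \<and>
        (\<forall>x \<in> M. \<exists>!s. s \<in> (\<Union>k. T k) \<and> x \<in> \<kappa> s ` rel_interior (\<Delta> s)))"

definition dual_complex ::
  "nat \<Rightarrow> (nat \<Rightarrow> 'a set set) \<Rightarrow> (nat \<Rightarrow> 'a set set) \<Rightarrow> bool" where
  "dual_complex n X T \<longleftrightarrow>
     (\<exists>D. (\<forall>k\<le>n. bij_betw D (T k) (X (n - k))) \<and>
          (\<forall>s \<in> (\<Union>k. T k). \<forall>t \<in> (\<Union>k. T k). s \<subseteq> t \<longleftrightarrow> D t \<subseteq> D s))"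

definition cpx ::
  "'n::finite itself \<Rightarrow> 'a::topological_space set \<Rightarrow> (nat \<Rightarrow> 'a set set) \<Rightarrow> bool" where
  "cpx N M X \<longleftrightarrow>
     embedded_cell_complex N M X \<and>
     (\<exists>T. simplicial_triangulation N M T \<and> dual_complex CARD('n) X T)"

definition skeleton :: "(nat \<Rightarrow> 'a set set) \<Rightarrow> nat \<Rightarrow> 'a set" where
  "skeleton X i = (\<Union>j\<le>i. \<Union>(X j))"

definition even_sided :: "(nat \<Rightarrow> 'a set set) \<Rightarrow> 'a set \<Rightarrow> bool" where
  "even_sided X c \<longleftrightarrow> even (card {e \<in> X 1. e \<subseteq> c})"


section \<open>The fundamental group\<close>

definition loop_class :: "'a::topological_space set \<Rightarrow> (real \<Rightarrow> 'a) \<Rightarrow> (real \<Rightarrow> 'a) set" where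
  "loop_class S p = {q. homotopic_paths S p q}"

definition fundamental_group ::
  "'a::topological_space set \<Rightarrow> 'a \<Rightarrow> (real \<Rightarrow> 'a) set monoid" where
  "fundamental_group S x =
     \<lparr> carrier = loop_class S ` {p. path p \<and> path_image p \<subseteq> S \<and> pathstart p = x \<and> pathfinish p = x},
       mult = (\<lambda>\<gamma> \<delta>. \<Union>p\<in>\<gamma>. \<Union>q\<in>\<delta>. loop_class S (p +++ q)),
       one = loop_class S (\<lambda>_. x) \<rparr>"

text \<open>The map induced by the inclusion of a subspace into \<open>S\<close>.\<close>

definition inclusion_map ::
  "'a::topological_space set \<Rightarrow> (real \<Rightarrow> 'a) set \<Rightarrow> (real \<Rightarrow> 'a) set" where
  "inclusion_map S \<gamma> = (\<Union>p\<in>\<gamma>. loop_class S p)"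


section \<open>Holonomy on the 1-skeleton\<close>

text \<open>
  An edge path starting at \<open>v\<close> is the list of its steps \<open>(e, u)\<close>: traverse the edge \<open>e\<close>, arriving
  at the vertex \<open>u\<close>.  The edges are recorded because several of them may join the same vertices.
\<close>

fun edge_path :: "(nat \<Rightarrow> 'a set set) \<Rightarrow> 'a \<Rightarrow> ('a set \<times> 'a) list \<Rightarrow> 'a \<Rightarrow> bool" where
  "edge_path X v [] w \<longleftrightarrow> {v} \<in> X 0 \<and> v = w"
| "edge_path X v ((e, u) # es) w \<longleftrightarrow>
     {v} \<in> X 0 \<and> e \<in> X 1 \<and> v \<in> e \<and> u \<in> e \<and> u \<noteq> v \<and> edge_path X u es w"

definition edge_arc :: "'a::topological_space set \<Rightarrow> 'a \<Rightarrow> 'a \<Rightarrow> real \<Rightarrow> 'a" where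
  "edge_arc e v u = (SOME p. arc p \<and> path_image p = e \<and> pathstart p = v \<and> pathfinish p = u)"

fun realization :: "'a::topological_space \<Rightarrow> ('a set \<times> 'a) list \<Rightarrow> real \<Rightarrow> 'a" where
  "realization v [] = (\<lambda>_. v)"
| "realization v ((e, u) # es) = edge_arc e v u +++ realization u es"

definition regions_at :: "nat \<Rightarrow> (nat \<Rightarrow> 'a set set) \<Rightarrow> 'a set \<Rightarrow> 'a set set" where
  "regions_at n X c = {R \<in> X n. c \<subseteq> R}"

definition edge_transport ::
  "nat \<Rightarrow> (nat \<Rightarrow> 'a set set) \<Rightarrow> 'a set \<times> 'a \<Rightarrow> ('a set \<Rightarrow> nat) \<Rightarrow> 'a set \<Rightarrow> nat" where
  "edge_transport n X = (\<lambda>(e, u) col. \<lambda>R \<in> regions_at n X {u}.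
     if e \<subseteq> R then col R else (THE i. i \<in> {1..n+1} \<and> i \<notin> col ` regions_at n X e))"

definition transport ::
  "nat \<Rightarrow> (nat \<Rightarrow> 'a set set) \<Rightarrow> ('a set \<times> 'a) list \<Rightarrow> ('a set \<Rightarrow> nat) \<Rightarrow> 'a set \<Rightarrow> nat" where
  "transport n X es col = fold (edge_transport n X) es col"

text \<open>
  \<open>Hol1 n X v0 col \<gamma>\<close> is the permutation taking the coloring \<open>col\<close> at \<open>v0\<close> to its transport along
  a closed edge path representing \<open>\<gamma>\<close>.  Transport commutes with permutations of the colors, so
  running through \<open>\<gamma>\<close> and then \<open>\<delta>\<close> gives \<open>Hol1 \<gamma> \<circ> Hol1 \<delta>\<close>.
\<close>

definition Hol1 ::
  "nat \<Rightarrow> (nat \<Rightarrow> 'a::topological_space set set) \<Rightarrow> 'a \<Rightarrow> ('a set \<Rightarrow> nat) \<Rightarrow>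
   (real \<Rightarrow> 'a) set \<Rightarrow> nat \<Rightarrow> nat" where
  "Hol1 n X v0 col \<gamma> =
     (THE \<sigma>. \<sigma> permutes {1..n+1} \<and>
        (\<exists>es. edge_path X v0 es v0 \<and> realization v0 es \<in> \<gamma> \<and>
           (\<forall>R \<in> regions_at n X {v0}. transport n X es col R = \<sigma> (col R))))"

end

theory Submission
  imports Defs
begin

text \<open>
  Let the carrier of a point be the closed cell whose interior contains it.  Since closed cells are
  closed, every point has a neighbourhood on which carriers only grow, so \<open>x \<mapsto> carrier x\<close> is
  continuous for the Alexandrov topology on the face poset, and locally constant data on the poset
  can be transported along paths and homotopies in \<open>M\<close>.

  The data used are the coherent colorings of a cell: colorings at all its vertices that match along
  its edges.  They form a covering of the poset provided every coloring at a vertex of a cell \<open>c\<close>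
  extends to a coherent coloring of \<open>c\<close>.  For a polygon this says that its edges can be colored
  alternately with two colors, i.e. that it is even sided; for a cell of dimension at least 3 it
  follows by transport along paths in the boundary sphere, which is simply connected.  Hence edge
  paths that are homotopic in \<open>M\<close> have the same transport.

  Conversely every loop of \<open>M\<close>, and every loop of the 1-skeleton within the 1-skeleton, is homotopic
  to an edge path: near a point \<open>x\<close> a path starting at \<open>x\<close> can be pushed into a single closed cell, and
  vertices of a cell are joined by edge paths in it because boundary spheres are connected.
\<close>

section \<open>Homotopies of paths\<close>

text \<open>Neither cellular approximation nor van Kampen's theorem is applied: global statements
  come from local ones by compactness of the interval (paths become edge paths) or of the unit
  square (transport survives homotopies). Both arguments are made for a subset \<open>S\<close> of
  \<open>M\<close>. Invariance of transport is needed first in the boundary of a cell of dimension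
  at least 3, where all carriers have smaller dimension, and at the end in \<open>M\<close>; this
  lets the induction on dimension close. Edge paths are needed in \<open>M\<close>, where they give
  uniqueness, and in the 1-skeleton, because \<open>Hol1\<close> asks for an edge path in a class of
  loops of the skeleton.

  Parity enters at a 2-cell as follows. At each of its vertices n - 1 regions contain the cell and
  two do not, one over each of the two edges there. Along an edge, the region that is left hands its
  color to the region that is entered. Thus the extra regions over consecutive edges take two colors
  in turn, which closes up exactly when the number of edges is even. The incidence numbers come from
  the face lattice of the simplex dual to a vertex.\<close>

lemma homotopic_paths_convex_image:
  fixes K :: "'b::real_normed_vector set"
  assumes "convex K" "path f" "path_image f \<subseteq> K" "path g" "path_image g \<subseteq> K"
    and "pathstart f = pathstart g" "pathfinish f = pathfinish g"
    and "continuous_on K h" "h ` K \<subseteq> S"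
  shows "homotopic_paths S (h \<circ> f) (h \<circ> g)"
proof (rule homotopic_paths_continuous_image)
  show "homotopic_paths K f g"
  proof (rule homotopic_paths_linear[of f g K])
    fix t :: real assume "t \<in> {0..1}"
    then have "f t \<in> K" "g t \<in> K"
      using assms by (auto simp: path_image_def)
    then show "closed_segment (f t) (g t) \<subseteq> K"
      using \<open>convex K\<close> by (simp add: closed_segment_subset)
  qed (use assms in auto)
  show "continuous_on K h" "h \<in> K \<rightarrow> S" using assms by auto
qed

lemma homotopic_paths_homeomorphic_convex:
  fixes K :: "'b::real_normed_vector set"
  assumes "convex K" "homeomorphism K U h k"
    and "path p" "path_image p \<subseteq> U" "path q" "path_image q \<subseteq> U"
    and "pathstart p = pathstart q" "pathfinish p = pathfinish q"
  shows "homotopic_paths U p q"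
proof -
  have k: "continuous_on U k" "k ` U = K" and h: "continuous_on K h" "h ` K = U"
    and hk: "\<And>y. y \<in> U \<Longrightarrow> h (k y) = y"
    using assms(2) by (auto simp: homeomorphism_def)
  have *: "homotopic_paths U (h \<circ> (k \<circ> p)) (h \<circ> (k \<circ> q))"
  proof (rule homotopic_paths_convex_image[OF \<open>convex K\<close>])
    show "path (k \<circ> p)" "path (k \<circ> q)"
      using assms k by (auto intro!: path_continuous_image intro: continuous_on_subset)
    show "path_image (k \<circ> p) \<subseteq> K" "path_image (k \<circ> q) \<subseteq> K"
      using assms k by (auto simp: path_image_compose)
  qed (use assms h in \<open>auto simp: pathstart_compose pathfinish_compose\<close>)
  have "homotopic_paths U p (h \<circ> (k \<circ> p))"
    using assms hk by (intro homotopic_paths_eq) (auto simp: path_image_def image_subset_iff)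
  moreover have "homotopic_paths U q (h \<circ> (k \<circ> q))"
    using assms hk by (intro homotopic_paths_eq) (auto simp: path_image_def image_subset_iff)
  ultimately show ?thesis
    using * homotopic_paths_sym homotopic_paths_trans by blast
qed

text \<open>Only the parametrization of \<open>p\<close> changes, and parametrizations with equal
  ends are homotopic in the interval. Subdivision, the unit laws and cancellation of a path against
  its reverse are instances with piecewise linear parametrizations.\<close>

lemma homotopic_paths_interval_image:
  assumes "path p" "path_image p \<subseteq> S" "path f" "path_image f \<subseteq> {0..1}" "path g" "path_image g \<subseteq> {0..1}"
    and "pathstart f = pathstart g" "pathfinish f = pathfinish g"
  shows "homotopic_paths S (p \<circ> f) (p \<circ> g)"
  using assms by (intro homotopic_paths_convex_image[of "{0..1}"]) (auto simp: path_def path_image_def)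

lemma path_const: "path (\<lambda>_. x)" and path_image_const: "path_image (\<lambda>_. x) = {x}"
  and pathstart_const: "pathstart (\<lambda>_. x) = x" and pathfinish_const: "pathfinish (\<lambda>_. x) = x"
  by (auto simp: path_def path_image_def pathstart_def pathfinish_def)

lemma segment_path:
  assumes "path p" "a \<in> {0..1}" "b \<in> {0..1}"
  shows "path (p \<circ> linepath a b)" "path_image (p \<circ> linepath a b) = p ` closed_segment a b"
    "path_image (p \<circ> linepath a b) \<subseteq> path_image p"
    "pathstart (p \<circ> linepath a b) = p a" "pathfinish (p \<circ> linepath a b) = p b"
    "reversepath (p \<circ> linepath a b) = p \<circ> linepath b a"
proof -
  have seg: "closed_segment a b \<subseteq> {0..1}" using assms by (intro closed_segment_subset) auto
  then show "path (p \<circ> linepath a b)"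
    using assms by (intro path_continuous_image) (auto simp: path_def intro: continuous_on_subset)
  show "path_image (p \<circ> linepath a b) = p ` closed_segment a b" by (simp add: path_image_compose)
  then show "path_image (p \<circ> linepath a b) \<subseteq> path_image p" using seg by (auto simp: path_image_def)
qed (auto simp: pathstart_compose pathfinish_compose path_compose_reversepath[symmetric])

lemma homotopic_paths_segment_join:
  assumes "path p" "path_image p \<subseteq> S" "a \<in> {0..1}" "b \<in> {0..1}" "c \<in> {0..1}"
  shows "homotopic_paths S ((p \<circ> linepath a b) +++ (p \<circ> linepath b c)) (p \<circ> linepath a c)"
proof -
  have seg: "closed_segment u v \<subseteq> {0..1}" if "u \<in> {0..1}" "v \<in> {0..1}" for u v :: real
    using that by (intro closed_segment_subset) auto
  show ?thesis
    unfolding path_compose_join[symmetric]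
    using assms seg by (intro homotopic_paths_interval_image) (auto simp: path_image_join)
qed

text \<open>The neutral path is a constant function, as in \<open>realization\<close> and
  \<open>fundamental_group\<close>: \<open>linepath\<close> would require a vector space of
  points.\<close>

lemma homotopic_paths_join_const:
  assumes "path p" "path_image p \<subseteq> S"
  shows "homotopic_paths S (p +++ (\<lambda>_. pathfinish p)) p"
proof -
  have "homotopic_paths S (p \<circ> (linepath 0 1 +++ linepath 1 1)) (p \<circ> linepath 0 1)"
    using assms by (intro homotopic_paths_interval_image) (auto simp: path_image_join closed_segment_eq_real_ivl)
  moreover have "p \<circ> linepath 0 1 = p" "p \<circ> linepath 1 1 = (\<lambda>_. pathfinish p)"
    by (auto simp: linepath_def fun_eq_iff pathfinish_def algebra_simps)
  ultimately show ?thesis by (simp add: path_compose_join)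
qed

lemma homotopic_paths_const_join:
  assumes "path p" "path_image p \<subseteq> S"
  shows "homotopic_paths S ((\<lambda>_. pathstart p) +++ p) p"
proof -
  have "homotopic_paths S (p \<circ> (linepath 0 0 +++ linepath 0 1)) (p \<circ> linepath 0 1)"
    using assms by (intro homotopic_paths_interval_image) (auto simp: path_image_join closed_segment_eq_real_ivl)
  moreover have "p \<circ> linepath 0 1 = p" "p \<circ> linepath 0 0 = (\<lambda>_. pathstart p)"
    by (auto simp: linepath_def fun_eq_iff pathstart_def algebra_simps)
  ultimately show ?thesis by (simp add: path_compose_join)
qed

lemma homotopic_paths_reversepath_join:
  assumes "path p" "path_image p \<subseteq> S"
  shows "homotopic_paths S (reversepath p +++ p) (\<lambda>_. pathfinish p)"
proof -
  have "homotopic_paths S (p \<circ> (linepath 1 0 +++ linepath 0 1)) (p \<circ> linepath 1 1)"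
    using assms by (intro homotopic_paths_interval_image) (auto simp: path_image_join closed_segment_eq_real_ivl)
  moreover have "p \<circ> linepath 0 1 = p" "p \<circ> linepath 1 1 = (\<lambda>_. pathfinish p)" "p \<circ> linepath 1 0 = reversepath p"
    by (auto simp: linepath_def fun_eq_iff pathfinish_def reversepath_def algebra_simps)
  ultimately show ?thesis by (simp add: path_compose_join)
qed

section \<open>Embedded cell complexes\<close>

lemma openin_top_of_set_Int:
  assumes "openin (top_of_set M) W" "B \<subseteq> M"
  shows "openin (top_of_set B) (W \<inter> B)"
proof -
  obtain G where "open G" "W = M \<inter> G" using assms(1) by (auto simp: openin_open)
  then have "W \<inter> B = B \<inter> G" using assms(2) by blast
  then show ?thesis using \<open>open G\<close> by (auto simp: openin_open)
qed

locale cell_complex =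
  fixes N :: "'n::finite itself" and M :: "'a::topological_space set" and X :: "nat \<Rightarrow> 'a set set"
  assumes hausdorff: "Hausdorff_space (top_of_set M)"
    and embedded: "embedded_cell_complex N M X"
begin

definition vertices :: "'a set \<Rightarrow> 'a set" where
  "vertices c = {v. {v} \<in> X 0 \<and> v \<in> c}"

definition carrier_cell :: "'a \<Rightarrow> 'a set" where
  "carrier_cell x = (THE c. \<exists>k. c \<in> X k \<and> x \<in> c - cell_boundary X k c)"

lemma finite_cells: "finite (\<Union>k. X k)"
  using embedded by (simp add: embedded_cell_complex_def)

lemma cell_subset: "c \<in> X k \<Longrightarrow> c \<subseteq> M"
  using embedded by (simp add: embedded_cell_complex_def)

lemma cell_ball:
  assumes "c \<in> X k"
  obtains V :: "(real ^ 'n) set" and h g where "subspace V" "dim V = k"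
    "homeomorphism (V \<inter> cball 0 1) c h g" "h ` (V \<inter> sphere 0 1) = cell_boundary X k c"
proof -
  have "\<exists>(V :: (real ^ 'n) set) h g. subspace V \<and> dim V = k \<and>
      homeomorphism (V \<inter> cball 0 1) c h g \<and> h ` (V \<inter> sphere 0 1) = cell_boundary X k c"
    using embedded assms unfolding embedded_cell_complex_def by blast
  then show thesis using that by blast
qed

lemma cell_homeomorphic_convex:
  assumes "c \<in> X k"
  obtains K :: "(real ^ 'n) set" and h g where "convex K" "compact K" "K \<noteq> {}" "homeomorphism K c h g"
proof -
  obtain V :: "(real ^ 'n) set" and h g where V: "subspace V" "homeomorphism (V \<inter> cball 0 1) c h g"
    using cell_ball[OF assms] by metis
  have "0 \<in> V \<inter> cball 0 1" using V by (simp add: subspace_0)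
  then show thesis
    using V that[of "V \<inter> cball 0 1" h g]
    by (metis convex_Int convex_cball subspace_imp_convex closed_subspace closed_Int_compact compact_cball empty_iff)
qed

lemma cell_boundary_subset: "cell_boundary X k c \<subseteq> c"
  by (auto simp: cell_boundary_def)

lemma carrier_cell_eq:
  assumes "c \<in> X k" "x \<in> c - cell_boundary X k c"
  shows "carrier_cell x = c"
proof -
  have "x \<in> M" using assms cell_subset by auto
  then have "\<exists>!c. \<exists>k. c \<in> X k \<and> x \<in> c - cell_boundary X k c"
    using embedded by (simp add: embedded_cell_complex_def)
  then show ?thesis
    unfolding carrier_cell_def using assms by (intro the1_equality) auto
qed

text \<open>Descent on dimension: a boundary point of c lies in a smaller cell inside c, and the
  descent can only end at the unique cell that has x in its interior.\<close>

lemma carrier_cell_least: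
  assumes "c \<in> X k" "x \<in> c"
  shows "carrier_cell x \<subseteq> c" and "\<exists>j\<le>k. carrier_cell x \<in> X j"
proof -
  have "carrier_cell x \<subseteq> c \<and> (\<exists>j\<le>k. carrier_cell x \<in> X j)"
    using assms
  proof (induction k arbitrary: c rule: less_induct)
    case (less k)
    show ?case
    proof (cases "x \<in> cell_boundary X k c")
      case False
      then have "carrier_cell x = c" using less.prems carrier_cell_eq by blast
      then show ?thesis using less.prems by auto
    next
      case True
      then obtain d j where "j < k" "d \<in> X j" "d \<subseteq> c" "x \<in> d"
        by (auto simp: cell_boundary_def)
      then show ?thesis using less.IH[of j d] by (meson less_imp_le_nat order_trans)
    qed
  qed
  then show "carrier_cell x \<subseteq> c" "\<exists>j\<le>k. carrier_cell x \<in> X j" by auto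
qed

lemma carrier_cell_boundary:
  assumes "x \<in> cell_boundary X k c"
  shows "\<exists>j<k. carrier_cell x \<in> X j" and "carrier_cell x \<subseteq> c"
proof -
  obtain d j where *: "j < k" "d \<in> X j" "d \<subseteq> c" "x \<in> d"
    using assms by (auto simp: cell_boundary_def)
  show "\<exists>j<k. carrier_cell x \<in> X j" "carrier_cell x \<subseteq> c"
    using carrier_cell_least[OF *(2,4)] * by (auto dest: order_le_less_trans)
qed

lemma carrier_cell_obtain:
  assumes "x \<in> M"
  obtains k where "carrier_cell x \<in> X k" "x \<in> carrier_cell x"
proof -
  have "\<exists>!c. \<exists>k. c \<in> X k \<and> x \<in> c - cell_boundary X k c"
    using embedded assms by (simp add: embedded_cell_complex_def)
  then obtain c k where c: "c \<in> X k" "x \<in> c - cell_boundary X k c" by blast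
  then have "carrier_cell x = c" using carrier_cell_eq by blast
  then show thesis using that c by auto
qed

lemma closedin_cell:
  assumes "c \<in> X k"
  shows "closedin (top_of_set M) c"
proof -
  obtain K :: "(real ^ 'n) set" and h g where K: "compact K" "homeomorphism K c h g"
    using cell_homeomorphic_convex[OF assms] by metis
  then have "compact c"
    by (metis compact_continuous_image homeomorphism_def)
  then have "compactin (top_of_set M) c"
    using cell_subset[OF assms] by (simp add: compactin_subtopology)
  then show ?thesis using hausdorff compactin_imp_closedin by blast
qed

text \<open>Remove the finitely many closed cells that miss x. Every cell through a remaining point
  contains x, hence contains the carrier of x.\<close>

lemma carrier_cell_nbhd:
  assumes "x \<in> M"
  obtains W where "openin (top_of_set M) W" "x \<in> W" "\<And>y. y \<in> W \<Longrightarrow> carrier_cell x \<subseteq> carrier_cell y"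
proof -
  define B where "B = {c \<in> (\<Union>k. X k). x \<notin> c}"
  have "finite B" unfolding B_def using finite_cells by (rule rev_finite_subset) blast
  then have "closedin (top_of_set M) (\<Union>B)"
    by (rule closedin_Union) (auto simp: B_def closedin_cell)
  then have "openin (top_of_set M) (M - \<Union>B)"
    by (intro openin_diff) auto
  moreover have "x \<in> M - \<Union>B" using assms by (auto simp: B_def)
  moreover have "carrier_cell x \<subseteq> carrier_cell y" if y: "y \<in> M - \<Union>B" for y
  proof -
    obtain k where k: "carrier_cell y \<in> X k" "y \<in> carrier_cell y"
      using y carrier_cell_obtain by blast
    then have "x \<in> carrier_cell y" using y by (auto simp: B_def)
    then show ?thesis using k carrier_cell_least by blast
  qed
  ultimately show thesis using that by blast
qed

lemma zero_cell_singleton: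
  assumes "c \<in> X 0"
  obtains v where "c = {v}"
proof -
  obtain V :: "(real ^ 'n) set" and h g where V: "subspace V" "dim V = 0" "homeomorphism (V \<inter> cball 0 1) c h g"
    using cell_ball[OF assms] by metis
  then have "V = {0}" using dim_eq_0 subspace_0 by blast
  then have "c = h ` ({0} \<inter> cball 0 1)" using V by (simp add: homeomorphism_def)
  then show thesis using that by auto
qed

lemma carrier_cell_vertex:
  assumes "{v} \<in> X 0"
  shows "carrier_cell v = {v}"
  using assms by (intro carrier_cell_eq[of _ 0]) (auto simp: cell_boundary_def)

lemma vertices_vertex: "{v} \<in> X 0 \<Longrightarrow> vertices {v} = {v}"
  by (auto simp: vertices_def)

lemma vertices_mono: "c \<subseteq> d \<Longrightarrow> vertices c \<subseteq> vertices d"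
  by (auto simp: vertices_def)

text \<open>As relative frontier of a bounded convex set, the model sphere is connected from
  dimension 2 on and simply connected from dimension 3 on.\<close>

lemma sphere_rel_frontier:
  fixes V :: "(real ^ 'n) set"
  assumes "subspace V"
  shows "V \<inter> sphere 0 1 = rel_frontier (cball 0 1 \<inter> V)" "aff_dim (cball 0 1 \<inter> V) = dim V"
proof -
  have "interior (cball 0 1) \<inter> V \<noteq> {}" using subspace_0[OF assms] by (force simp: interior_cball)
  then show "V \<inter> sphere 0 1 = rel_frontier (cball 0 1 \<inter> V)"
    by (subst convex_affine_rel_frontier_Int) (use assms in \<open>auto simp: subspace_imp_affine\<close>)
  show "aff_dim (cball 0 1 \<inter> V) = dim V"
    using assms \<open>interior (cball 0 1) \<inter> V \<noteq> {}\<close>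
    by (metis Int_commute aff_dim_convex_Int_nonempty_interior aff_dim_subspace subspace_imp_convex)
qed

lemma vertices_subset_cell_boundary: "0 < k \<Longrightarrow> vertices c \<subseteq> cell_boundary X k c"
  by (force simp: vertices_def cell_boundary_def)

lemma connected_cell_boundary:
  assumes "c \<in> X k" "2 \<le> k"
  shows "connected (cell_boundary X k c)"
proof -
  obtain V :: "(real ^ 'n) set" and h g where V: "subspace V" "dim V = k"
    "homeomorphism (V \<inter> cball 0 1) c h g" "h ` (V \<inter> sphere 0 1) = cell_boundary X k c"
    using cell_ball[OF assms(1)] by metis
  have "connected (V \<inter> sphere 0 1)"
    using V assms sphere_rel_frontier[OF V(1)]
    by (auto intro!: connected_sphere_gen convex_Int simp: bounded_Int subspace_imp_convex)
  moreover have "continuous_on (V \<inter> sphere 0 1) h"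
    using V(3) by (auto simp: homeomorphism_def intro: continuous_on_subset)
  ultimately show ?thesis using V(4) connected_continuous_image by metis
qed

lemma cell_boundary_homotopic_paths:
  assumes "c \<in> X k" "3 \<le> k"
    and "path p" "path_image p \<subseteq> cell_boundary X k c" "path q" "path_image q \<subseteq> cell_boundary X k c"
    and "pathstart p = pathstart q" "pathfinish p = pathfinish q"
  shows "homotopic_paths (cell_boundary X k c) p q"
proof -
  obtain V :: "(real ^ 'n) set" and h g where V: "subspace V" "dim V = k"
    "homeomorphism (V \<inter> cball 0 1) c h g" "h ` (V \<inter> sphere 0 1) = cell_boundary X k c"
    using cell_ball[OF assms(1)] by metis
  let ?S = "V \<inter> sphere 0 1" and ?B = "cell_boundary X k c"
  have sc: "simply_connected ?S"
    using V assms sphere_rel_frontier[OF V(1)]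
    by (auto intro!: simply_connected_sphere_gen convex_Int simp: bounded_Int subspace_imp_convex)
  have "homeomorphism ?S ?B h g"
    by (rule homeomorphism_of_subsets[OF V(3) _ empty_subsetI V(4)]) auto
  then have h: "continuous_on ?S h" "h ` ?S = ?B" and g: "continuous_on ?B g" "g ` ?B = ?S"
    and hg: "\<And>y. y \<in> ?B \<Longrightarrow> h (g y) = y"
    by (auto simp: homeomorphism_def)
  have "homotopic_paths ?S (g \<circ> p) (g \<circ> q)"
  proof -
    have "path (g \<circ> p)" "path (g \<circ> q)"
      using assms g by (auto intro!: path_continuous_image intro: continuous_on_subset)
    moreover have "path_image (g \<circ> p) \<subseteq> ?S" "path_image (g \<circ> q) \<subseteq> ?S"
      using assms g by (auto simp: path_image_compose)
    ultimately show ?thesis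
      using sc assms unfolding simply_connected_eq_homotopic_paths
      by (simp add: pathstart_compose pathfinish_compose)
  qed
  then have *: "homotopic_paths ?B (h \<circ> (g \<circ> p)) (h \<circ> (g \<circ> q))"
    using h by (intro homotopic_paths_continuous_image[of ?S]) auto
  have "homotopic_paths ?B p (h \<circ> (g \<circ> p))"
    using assms hg by (intro homotopic_paths_eq) (auto simp: path_image_def image_subset_iff)
  moreover have "homotopic_paths ?B q (h \<circ> (g \<circ> q))"
    using assms hg by (intro homotopic_paths_eq) (auto simp: path_image_def image_subset_iff)
  ultimately show ?thesis
    using * homotopic_paths_sym homotopic_paths_trans by blast
qed

lemma cell_boundary_nonempty:
  assumes "c \<in> X k" "0 < k"
  shows "cell_boundary X k c \<noteq> {}"
proof -
  obtain V :: "(real ^ 'n) set" and h g where V: "subspace V" "dim V = k"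
    "h ` (V \<inter> sphere 0 1) = cell_boundary X k c"
    using cell_ball[OF assms(1)] by metis
  then obtain a where "a \<in> V" "a \<noteq> 0" using assms(2) by (metis dim_eq_0 gr_implies_not0 singletonI subsetI singleton_iff)
  then have "a /\<^sub>R norm a \<in> V \<inter> sphere 0 1" using V by (auto simp: subspace_mul)
  then show ?thesis using V(3) by blast
qed

lemma vertices_nonempty: "c \<in> X k \<Longrightarrow> vertices c \<noteq> {}"
proof (induction k arbitrary: c rule: less_induct)
  case (less k)
  show ?case
  proof (cases "k = 0")
    case True
    with less.prems zero_cell_singleton show ?thesis by (auto simp: vertices_def)
  next
    case False
    then obtain d j where "j < k" "d \<in> X j" "d \<subseteq> c"
      using cell_boundary_nonempty[of c k] less.prems by (auto simp: cell_boundary_def)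
    then show ?thesis using less.IH[of j d] vertices_mono by blast
  qed
qed

text \<open>A one-dimensional subspace is a line spanned by a unit vector b; its unit ball is the
  segment from b to -b, and its unit sphere consists of these two ends.\<close>

lemma edge_obtain_arc:
  assumes "e \<in> X 1"
  obtains p where "arc p" "path_image p = e" "vertices e = {pathstart p, pathfinish p}"
    "pathstart p \<noteq> pathfinish p"
proof -
  obtain V :: "(real ^ 'n) set" and h g where V: "subspace V" "dim V = 1"
    "homeomorphism (V \<inter> cball 0 1) e h g" "h ` (V \<inter> sphere 0 1) = cell_boundary X 1 e"
    using cell_ball[OF assms] by metis
  obtain B where B: "B \<subseteq> V" "independent B" "V \<subseteq> span B" "card B = dim V"
    using basis_exists[of V] by metis
  then obtain a where a: "B = {a}" using V by (metis card_1_singletonE)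
  then have "a \<noteq> 0" using B dependent_zero by blast
  define b where "b = a /\<^sub>R norm a"
  have b: "norm b = 1" "b \<in> V" using \<open>a \<noteq> 0\<close> a B V by (auto simp: b_def subspace_mul)
  have V_eq: "V = range (\<lambda>t. t *\<^sub>R b)"
  proof
    have "x \<in> range (\<lambda>t. t *\<^sub>R b)" if x: "x \<in> V" for x
    proof -
      obtain t where "x = t *\<^sub>R a" using subsetD[OF B(3) x] a by (auto simp: span_singleton)
      then have "x = (t * norm a) *\<^sub>R b" using \<open>a \<noteq> 0\<close> by (simp add: b_def)
      then show ?thesis by blast
    qed
    then show "V \<subseteq> range (\<lambda>t. t *\<^sub>R b)" by blast
  qed (use b V in \<open>auto simp: subspace_mul\<close>)
  have ball: "V \<inter> cball 0 1 = (\<lambda>t. t *\<^sub>R b) ` {-1..1}"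
  proof
    show "V \<inter> cball 0 1 \<subseteq> (\<lambda>t. t *\<^sub>R b) ` {-1..1}"
    proof
      fix x assume x: "x \<in> V \<inter> cball 0 1"
      then obtain t where t: "x = t *\<^sub>R b" using V_eq by auto
      then have "\<bar>t\<bar> \<le> 1" using x b by auto
      then show "x \<in> (\<lambda>t. t *\<^sub>R b) ` {-1..1}" using t by (intro image_eqI[of _ _ t]) (auto simp: abs_le_iff)
    qed
  qed (use b V in \<open>auto simp: subspace_mul abs_le_iff\<close>)
  have sph: "V \<inter> sphere 0 1 = {b, - b}"
  proof
    show "V \<inter> sphere 0 1 \<subseteq> {b, - b}"
    proof
      fix x assume x: "x \<in> V \<inter> sphere 0 1"
      then obtain t where t: "x = t *\<^sub>R b" using V_eq by auto
      then have "\<bar>t\<bar> = 1" using x b by auto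
      then show "x \<in> {b, - b}" using t by (auto simp: abs_if split: if_splits)
    qed
  qed (use b V in \<open>auto simp: subspace_neg\<close>)
  \<comment> \<open>The affine map 1 - 2 t carries [0,1] onto [-1,1] and starts at b.\<close>
  define p where "p = (\<lambda>t. h ((1 - 2 * t) *\<^sub>R b))"
  have h: "continuous_on (V \<inter> cball 0 1) h" "h ` (V \<inter> cball 0 1) = e" "inj_on h (V \<inter> cball 0 1)"
    using V(3) by (auto simp: homeomorphism_def intro: inj_on_inverseI)
  have im: "(\<lambda>t::real. 1 - 2 * t) ` {0..1} = {-1..1}"
  proof -
    have "x \<in> (\<lambda>t::real. 1 - 2 * t) ` {0..1}" if "x \<in> {-1..1}" for x
      using that by (intro image_eqI[of _ _ "(1 - x) / 2"]) (auto simp: field_simps)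
    then show ?thesis by auto
  qed
  have "path p" unfolding path_def p_def
    by (rule continuous_on_compose2[OF h(1)]) (auto intro!: continuous_intros simp: ball)
  moreover have "inj_on p {0..1}"
  proof (rule inj_onI)
    fix s t :: real assume st: "s \<in> {0..1}" "t \<in> {0..1}" "p s = p t"
    then have "(1 - 2 * s) *\<^sub>R b = (1 - 2 * t) *\<^sub>R b"
      unfolding p_def by (intro inj_onD[OF h(3)]) (auto simp: ball)
    then show "s = t" using b by (auto simp: scaleR_cancel_right)
  qed
  ultimately have "arc p" by (simp add: arc_def)
  moreover have "path_image p = e"
  proof -
    have "path_image p = h ` ((\<lambda>t. t *\<^sub>R b) ` ((\<lambda>t. 1 - 2 * t) ` {0..1}))"
      by (auto simp: path_image_def p_def image_image)
    then show ?thesis using im ball h(2) by simp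
  qed
  moreover have "vertices e = {pathstart p, pathfinish p}"
  proof -
    have "cell_boundary X 1 e \<subseteq> vertices e"
    proof
      fix x assume "x \<in> cell_boundary X 1 e"
      then obtain d where d: "d \<in> X 0" "d \<subseteq> e" "x \<in> d" by (auto simp: cell_boundary_def)
      then have "d = {x}" by (metis singletonD zero_cell_singleton)
      then show "x \<in> vertices e" using d by (simp add: vertices_def)
    qed
    then have "vertices e = cell_boundary X 1 e"
      using vertices_subset_cell_boundary[of 1 e] by auto
    also have "\<dots> = {h b, h (- b)}" using V(4) sph by auto
    also have "\<dots> = {pathstart p, pathfinish p}" by (simp add: p_def pathstart_def pathfinish_def)
    finally show ?thesis .
  qed
  moreover have "pathstart p \<noteq> pathfinish p" using arc_distinct_ends[OF \<open>arc p\<close>] by simp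
  ultimately show thesis using that by blast
qed

text \<open>Supplies the witness for the \<open>SOME\<close> in \<open>edge_arc\<close>: either the
  arc found above or its reverse runs from v to u.\<close>

lemma edge_arc:
  assumes "e \<in> X 1" "v \<in> vertices e" "u \<in> vertices e" "u \<noteq> v"
  shows "arc (edge_arc e v u)" "path_image (edge_arc e v u) = e"
    "pathstart (edge_arc e v u) = v" "pathfinish (edge_arc e v u) = u" "vertices e = {v, u}"
proof -
  obtain p where p: "arc p" "path_image p = e" "vertices e = {pathstart p, pathfinish p}"
    using edge_obtain_arc[OF assms(1)] by metis
  have "\<exists>p. arc p \<and> path_image p = e \<and> pathstart p = v \<and> pathfinish p = u"
  proof (cases "pathstart p = v")
    case True
    then show ?thesis using p assms by auto
  next
    case False
    then show ?thesis using p assms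
      by (intro exI[of _ "reversepath p"]) (auto simp: arc_reversepath)
  qed
  then have "arc (edge_arc e v u) \<and> path_image (edge_arc e v u) = e \<and>
      pathstart (edge_arc e v u) = v \<and> pathfinish (edge_arc e v u) = u"
    unfolding edge_arc_def by (rule someI_ex)
  then show "arc (edge_arc e v u)" "path_image (edge_arc e v u) = e"
    "pathstart (edge_arc e v u) = v" "pathfinish (edge_arc e v u) = u" by auto
  show "vertices e = {v, u}" using p assms by auto
qed

lemma cell_homotopic_paths:
  assumes "c \<in> X k" "path p" "path_image p \<subseteq> c" "path q" "path_image q \<subseteq> c"
    and "pathstart p = pathstart q" "pathfinish p = pathfinish q"
  shows "homotopic_paths c p q"
  using cell_homeomorphic_convex[OF assms(1)] homotopic_paths_homeomorphic_convex assms(2-) by metis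

lemma path_connected_cell:
  assumes "c \<in> X k"
  shows "path_connected c"
  using cell_homeomorphic_convex[OF assms]
  by (metis convex_imp_path_connected homeomorphism_def path_connected_continuous_image)

section \<open>Edge paths and their realizations\<close>

lemma edge_path_vertices:
  "edge_path X v es w \<Longrightarrow> {v} \<in> X 0 \<and> {w} \<in> X 0"
  by (induction X v es w rule: edge_path.induct) auto

lemma edge_path_append:
  "edge_path X u es v \<Longrightarrow> edge_path X v es' w \<Longrightarrow> edge_path X u (es @ es') w"
  by (induction X u es v rule: edge_path.induct) auto

lemma edge_path_Cons_D:
  assumes "edge_path X v ((e, u) # es) w"
  shows "e \<in> X 1" "v \<in> vertices e" "u \<in> vertices e" "u \<noteq> v" "edge_path X u es w"
  using assms edge_path_vertices by (auto simp: vertices_def)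

lemma realization_path:
  assumes "edge_path X v es w"
  shows "path (realization v es) \<and> pathstart (realization v es) = v \<and>
    pathfinish (realization v es) = w \<and> path_image (realization v es) \<subseteq> insert v (\<Union>(fst ` set es))"
  using assms
proof (induction es arbitrary: v)
  case Nil
  then show ?case by (simp add: path_const path_image_const pathstart_const pathfinish_const)
next
  case (Cons s es)
  obtain e u where s: "s = (e, u)" by (cases s)
  note * = edge_path_Cons_D[OF Cons.prems[unfolded s]]
  note a = edge_arc[OF *(1-4)]
  have "u \<in> e" using * by (simp add: vertices_def)
  then show ?case using Cons.IH[OF *(5)] a s by (auto simp: arc_imp_path path_image_join)
qed

text \<open>Only a homotopy, not an equality: \<open>realization\<close> brackets to the right, so
  each edge costs one reassociation.\<close>

lemma realization_append:
  assumes "edge_path X u es v" "edge_path X v es' w"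
    and "insert u (\<Union>(fst ` set es)) \<subseteq> S" "insert v (\<Union>(fst ` set es')) \<subseteq> S"
  shows "homotopic_paths S (realization u es +++ realization v es') (realization u (es @ es'))"
  using assms
proof (induction es arbitrary: u)
  case Nil
  note r = realization_path[OF Nil(2)]
  have "homotopic_paths S ((\<lambda>_. pathstart (realization v es')) +++ realization v es') (realization v es')"
    using r Nil.prems(4) by (intro homotopic_paths_const_join) blast+
  then show ?case using Nil r by simp
next
  case (Cons s es)
  obtain e x where s: "s = (e, x)" by (cases s)
  note * = edge_path_Cons_D[OF Cons.prems(1)[unfolded s]]
  note a = edge_arc[OF *(1-4)]
  have x: "x \<in> e" using * by (simp add: vertices_def)
  note r1 = realization_path[OF *(5)] and r2 = realization_path[OF Cons.prems(2)]
  have eS: "e \<subseteq> S" and esS: "insert x (\<Union>(fst ` set es)) \<subseteq> S"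
    using Cons.prems(3) x unfolding s by auto
  have sub: "path_image (realization x es) \<subseteq> S" "path_image (realization v es') \<subseteq> S"
    using r1 r2 esS(1) Cons.prems(4) by (meson order_trans)+
  have "homotopic_paths S ((edge_arc e u x +++ realization x es) +++ realization v es')
      (edge_arc e u x +++ (realization x es +++ realization v es'))"
    using r1 r2 a sub eS by (intro homotopic_paths_sym[OF homotopic_paths_assoc]) (auto simp: arc_imp_path)
  also have "homotopic_paths S \<dots> (edge_arc e u x +++ realization x (es @ es'))"
  proof (rule homotopic_paths_join)
    show "homotopic_paths S (realization x es +++ realization v es') (realization x (es @ es'))"
      by (rule Cons.IH[OF *(5) Cons.prems(2) esS(1) Cons.prems(4)])
  qed (use a r1 eS in \<open>auto simp: arc_imp_path\<close>)
  finally show ?case using s by simp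
qed

text \<open>Induction on dimension. From dimension 2 on, walk along the connected boundary: near a
  boundary point x every carrier is a smaller cell containing the carrier of x, and its vertices are
  joined by induction. Hence being joined is a locally constant matter.\<close>

lemma cell_edge_connected:
  assumes "c \<in> X k" "u \<in> vertices c" "w \<in> vertices c"
  shows "\<exists>es. edge_path X u es w \<and> \<Union>(fst ` set es) \<subseteq> c"
  using assms
proof (induction k arbitrary: c u w rule: less_induct)
  case (less k)
  consider "k = 0" | "k = 1" | "2 \<le> k" by linarith
  then show ?case
  proof cases
    case 1
    then obtain v where "c = {v}" using less.prems zero_cell_singleton by metis
    then show ?thesis using less.prems by (intro exI[of _ "[]"]) (auto simp: vertices_def)
  next
    case 2
    show ?thesis
    proof (cases "u = w")
      case True
      then show ?thesis using less.prems by (intro exI[of _ "[]"]) (auto simp: vertices_def)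
    next
      case False
      then show ?thesis using less.prems 2 by (intro exI[of _ "[(c, w)]"]) (auto simp: vertices_def)
    qed
  next
    case 3
    define J where "J p q \<longleftrightarrow> (\<exists>es. edge_path X p es q \<and> \<Union>(fst ` set es) \<subseteq> c)" for p q
    have J_trans: "J p r" if pq: "J p q" and qr: "J q r" for p q r
    proof -
      obtain es where es: "edge_path X p es q" "\<Union>(fst ` set es) \<subseteq> c" using pq J_def by blast
      obtain es' where es': "edge_path X q es' r" "\<Union>(fst ` set es') \<subseteq> c" using qr J_def by blast
      have "edge_path X p (es @ es') r" using es es' edge_path_append by blast
      moreover have "\<Union>(fst ` set (es @ es')) \<subseteq> c" using es es' by auto
      ultimately show ?thesis using J_def by blast
    qed
    \<comment> \<open>All vertices of both carriers are compared, so transitivity may pass through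
      any vertex of the middle carrier. Asking for \<open>J\<close> both ways makes the relation
      symmetric without reversing edge paths.\<close>
    define R where "R x y \<longleftrightarrow> (\<forall>a\<in>vertices (carrier_cell x). \<forall>b\<in>vertices (carrier_cell y). J a b \<and> J b a)" for x y
    let ?B = "cell_boundary X k c"
    have BM: "?B \<subseteq> M" using cell_subset[OF less.prems(1)] cell_boundary_subset by blast
    have "R u w"
    proof (rule connected_equivalence_relation[OF connected_cell_boundary[OF less.prems(1) 3]])
      show "u \<in> ?B" "w \<in> ?B" using less.prems(2,3) 3 vertices_subset_cell_boundary[of k c] by auto
    next
      fix x y z assume xy: "R x y" and yz: "R y z" and yB: "y \<in> ?B"
      then obtain b where b: "b \<in> vertices (carrier_cell y)"
        using carrier_cell_boundary(1)[OF yB] vertices_nonempty by blast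
      show "R x z" unfolding R_def
        using xy yz b J_trans[of _ b] by (simp add: R_def)
    next
      fix x assume xB: "x \<in> ?B"
      then have "x \<in> M" using BM by blast
      obtain W where W: "openin (top_of_set M) W" "x \<in> W" "\<And>y. y \<in> W \<Longrightarrow> carrier_cell x \<subseteq> carrier_cell y"
        using carrier_cell_nbhd[OF \<open>x \<in> M\<close>] by metis
      have "R x y" if y: "y \<in> W \<inter> ?B" for y
      proof -
        obtain j where j: "j < k" "carrier_cell y \<in> X j" "carrier_cell y \<subseteq> c"
          using y carrier_cell_boundary[of y k c] by blast
        have "J a b" if "a \<in> vertices (carrier_cell y)" "b \<in> vertices (carrier_cell y)" for a b
          unfolding J_def using less.IH[OF j(1,2) that] j(3) by (meson order_trans)
        moreover have "vertices (carrier_cell x) \<subseteq> vertices (carrier_cell y)"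
          using W(3) y vertices_mono by blast
        ultimately show ?thesis unfolding R_def by blast
      qed
      moreover have "openin (top_of_set ?B) (W \<inter> ?B)"
        using openin_top_of_set_Int W(1) BM by blast
      ultimately show "\<exists>T. openin (top_of_set ?B) T \<and> x \<in> T \<and> (\<forall>y\<in>T. R x y)"
        using W(2) xB by blast
    qed (auto simp: R_def)
    moreover have "carrier_cell u = {u}" "carrier_cell w = {w}"
      using less.prems carrier_cell_vertex by (auto simp: vertices_def)
    ultimately show ?thesis
      using less.prems(2,3) vertices_vertex by (simp add: R_def J_def vertices_def)
  qed
qed

end

section \<open>Paths and edge paths\<close>

text \<open>Allows a detour along \<open>G\<close> and back to be inserted where two paths meet; it
  serves to lead a joint to a vertex.\<close>

lemma homotopic_paths_join_cancel:
  assumes "path A" "path_image A \<subseteq> S" "path B" "path_image B \<subseteq> S" "path G" "path_image G \<subseteq> S"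
    and "pathfinish A = pathfinish G" "pathstart B = pathfinish G"
  shows "homotopic_paths S ((A +++ reversepath G) +++ (G +++ B)) (A +++ B)"
proof -
  have "homotopic_paths S ((A +++ reversepath G) +++ (G +++ B)) (((A +++ reversepath G) +++ G) +++ B)"
    using assms by (intro homotopic_paths_assoc) (auto simp: path_image_join)
  also have "homotopic_paths S \<dots> (A +++ B)"
  proof (rule homotopic_paths_join)
    have "homotopic_paths S ((A +++ reversepath G) +++ G) (A +++ (reversepath G +++ G))"
      using assms by (intro homotopic_paths_sym[OF homotopic_paths_assoc]) auto
    also have "homotopic_paths S \<dots> (A +++ (\<lambda>_. pathfinish G))"
      using assms by (intro homotopic_paths_join homotopic_paths_reversepath_join) auto
    also have "homotopic_paths S \<dots> A"
      using homotopic_paths_join_const[OF assms(1,2)] assms by simp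
    finally show "homotopic_paths S ((A +++ reversepath G) +++ G) A" .
  qed (use assms in auto)
  finally show ?thesis .
qed

lemma path_nbhd:
  assumes "path p" "path_image p \<subseteq> S" "t \<in> {0..1}" "openin (top_of_set S) U" "p t \<in> U"
  obtains d where "d > 0" "\<And>s. s \<in> {0..1} \<Longrightarrow> \<bar>s - t\<bar> < d \<Longrightarrow> p s \<in> U"
proof -
  obtain G where G: "open G" "U = S \<inter> G" using assms(4) by (auto simp: openin_open)
  have "continuous_on {0..1} p" using assms(1) by (simp add: path_def)
  then obtain H where H: "open H" "t \<in> H" "\<forall>s\<in>{0..1}. s \<in> H \<longrightarrow> p s \<in> G"
    using assms(3,5) G unfolding continuous_on_topological by blast
  then obtain d where d: "d > 0" "ball t d \<subseteq> H" using open_contains_ball by blast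
  have "p s \<in> U" if "s \<in> {0..1}" "\<bar>s - t\<bar> < d" for s
  proof -
    have "s \<in> H" using d that by (auto simp: dist_real_def abs_minus_commute)
    then show ?thesis using H that G assms(2) by (auto simp: path_image_def)
  qed
  then show thesis using that d by blast
qed

context cell_complex begin

text \<open>Connecting both ends of \<open>q\<close> to vertices inside their carriers yields an edge path, whatever the
  connecting paths; quantifying over all of them makes the notion stable under concatenation.\<close>

definition edge_homotopic :: "'a set \<Rightarrow> (real \<Rightarrow> 'a) \<Rightarrow> bool" where
  "edge_homotopic S q \<longleftrightarrow> (\<forall>\<alpha> \<beta>.
     path \<alpha> \<and> path_image \<alpha> \<subseteq> carrier_cell (pathstart q) \<and> {pathstart \<alpha>} \<in> X 0 \<and> pathfinish \<alpha> = pathstart q \<and>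
     path \<beta> \<and> path_image \<beta> \<subseteq> carrier_cell (pathfinish q) \<and> {pathstart \<beta>} \<in> X 0 \<and> pathfinish \<beta> = pathfinish q \<longrightarrow>
     (\<exists>es. edge_path X (pathstart \<alpha>) es (pathstart \<beta>) \<and> \<Union>(fst ` set es) \<subseteq> S \<and>
        homotopic_paths S ((\<alpha> +++ q) +++ reversepath \<beta>) (realization (pathstart \<alpha>) es)))"

lemma edge_homotopic_cong:
  assumes "edge_homotopic S q'" "homotopic_paths S q q'"
    and S: "\<And>x. x \<in> S \<Longrightarrow> carrier_cell x \<subseteq> S"
  shows "edge_homotopic S q"
  unfolding edge_homotopic_def
proof (intro allI impI, elim conjE)
  fix \<alpha> \<beta>
  assume \<alpha>: "path \<alpha>" "path_image \<alpha> \<subseteq> carrier_cell (pathstart q)" "{pathstart \<alpha>} \<in> X 0" "pathfinish \<alpha> = pathstart q"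
    and \<beta>: "path \<beta>" "path_image \<beta> \<subseteq> carrier_cell (pathfinish q)" "{pathstart \<beta>} \<in> X 0" "pathfinish \<beta> = pathfinish q"
  have ends: "pathstart q' = pathstart q" "pathfinish q' = pathfinish q"
    using assms(2) homotopic_paths_imp_pathstart homotopic_paths_imp_pathfinish by metis+
  have q: "path q" "path_image q \<subseteq> S"
    using assms(2) homotopic_paths_imp_path homotopic_paths_imp_subset by blast+
  have sub: "path_image \<alpha> \<subseteq> S" "path_image \<beta> \<subseteq> S"
    using \<alpha>(2) \<beta>(2) S q(2) pathstart_in_path_image pathfinish_in_path_image by blast+
  obtain es where es: "edge_path X (pathstart \<alpha>) es (pathstart \<beta>)" "\<Union>(fst ` set es) \<subseteq> S"
    "homotopic_paths S ((\<alpha> +++ q') +++ reversepath \<beta>) (realization (pathstart \<alpha>) es)"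
    using assms(1) \<alpha> \<beta> unfolding edge_homotopic_def ends by blast
  have "homotopic_paths S ((\<alpha> +++ q) +++ reversepath \<beta>) ((\<alpha> +++ q') +++ reversepath \<beta>)"
    using \<alpha> \<beta> sub assms(2) by (intro homotopic_paths_join) auto
  then show "\<exists>es. edge_path X (pathstart \<alpha>) es (pathstart \<beta>) \<and> \<Union>(fst ` set es) \<subseteq> S \<and>
        homotopic_paths S ((\<alpha> +++ q) +++ reversepath \<beta>) (realization (pathstart \<alpha>) es)"
    using es homotopic_paths_trans by blast
qed

text \<open>A closed cell is a convex set up to homeomorphism, so any edge path in c between the two
  chosen vertices will do.\<close>

lemma edge_homotopic_cell:
  assumes "c \<in> X k" "c \<subseteq> S" "path q" "path_image q \<subseteq> c"
  shows "edge_homotopic S q"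
  unfolding edge_homotopic_def
proof (intro allI impI, elim conjE)
  fix \<alpha> \<beta>
  assume \<alpha>: "path \<alpha>" "path_image \<alpha> \<subseteq> carrier_cell (pathstart q)" "{pathstart \<alpha>} \<in> X 0" "pathfinish \<alpha> = pathstart q"
    and \<beta>: "path \<beta>" "path_image \<beta> \<subseteq> carrier_cell (pathfinish q)" "{pathstart \<beta>} \<in> X 0" "pathfinish \<beta> = pathfinish q"
  have "pathstart q \<in> c" "pathfinish q \<in> c" using assms(4) by auto
  then have sub: "path_image \<alpha> \<subseteq> c" "path_image \<beta> \<subseteq> c"
    using \<alpha>(2) \<beta>(2) carrier_cell_least(1)[OF assms(1)] by blast+
  then have "pathstart \<alpha> \<in> c" "pathstart \<beta> \<in> c" by auto
  then have "pathstart \<alpha> \<in> vertices c" "pathstart \<beta> \<in> vertices c"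
    using \<alpha>(3) \<beta>(3) by (auto simp: vertices_def)
  then obtain es where es: "edge_path X (pathstart \<alpha>) es (pathstart \<beta>)" "\<Union>(fst ` set es) \<subseteq> c"
    using cell_edge_connected[OF assms(1)] by blast
  note r = realization_path[OF es(1)]
  have "homotopic_paths c ((\<alpha> +++ q) +++ reversepath \<beta>) (realization (pathstart \<alpha>) es)"
  proof (rule cell_homotopic_paths[OF assms(1)])
    show "path_image (realization (pathstart \<alpha>) es) \<subseteq> c"
      using r es(2) \<open>pathstart \<alpha> \<in> c\<close> by (meson insert_subset order_trans)
  qed (use \<alpha> \<beta> sub assms(3,4) r in \<open>auto simp: path_image_join\<close>)
  then have "homotopic_paths S ((\<alpha> +++ q) +++ reversepath \<beta>) (realization (pathstart \<alpha>) es)"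
    using assms(2) homotopic_paths_subset by blast
  then show "\<exists>es. edge_path X (pathstart \<alpha>) es (pathstart \<beta>) \<and> \<Union>(fst ` set es) \<subseteq> S \<and>
        homotopic_paths S ((\<alpha> +++ q) +++ reversepath \<beta>) (realization (pathstart \<alpha>) es)"
    using es assms(2) by (meson order_trans)
qed

text \<open>Lead the joint to a vertex b of its carrier and back along \<gamma>. Both halves accept
  this same \<gamma>, as \<open>edge_homotopic\<close> quantifies over all connecting paths, and the
  two edge paths meet at b.\<close>

lemma edge_homotopic_join:
  assumes q: "edge_homotopic S q" "path q" "path_image q \<subseteq> S"
    and r: "edge_homotopic S r" "path r" "path_image r \<subseteq> S"
    and qr: "pathfinish q = pathstart r" and SM: "S \<subseteq> M"
    and S: "\<And>x. x \<in> S \<Longrightarrow> carrier_cell x \<subseteq> S"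
  shows "edge_homotopic S (q +++ r)"
  unfolding edge_homotopic_def
proof (intro allI impI, elim conjE)
  fix \<alpha> \<beta>
  assume "path \<alpha>" "path_image \<alpha> \<subseteq> carrier_cell (pathstart (q +++ r))" "{pathstart \<alpha>} \<in> X 0" "pathfinish \<alpha> = pathstart (q +++ r)"
    and "path \<beta>" "path_image \<beta> \<subseteq> carrier_cell (pathfinish (q +++ r))" "{pathstart \<beta>} \<in> X 0" "pathfinish \<beta> = pathfinish (q +++ r)"
  then have \<alpha>: "path \<alpha>" "path_image \<alpha> \<subseteq> carrier_cell (pathstart q)" "{pathstart \<alpha>} \<in> X 0" "pathfinish \<alpha> = pathstart q"
    and \<beta>: "path \<beta>" "path_image \<beta> \<subseteq> carrier_cell (pathfinish r)" "{pathstart \<beta>} \<in> X 0" "pathfinish \<beta> = pathfinish r"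
    by simp_all
  have mid: "pathstart r \<in> S" using r(3) by auto
  then obtain k where k: "carrier_cell (pathstart r) \<in> X k" "pathstart r \<in> carrier_cell (pathstart r)"
    using SM carrier_cell_obtain by blast
  obtain b where b: "{b} \<in> X 0" "b \<in> carrier_cell (pathstart r)"
    using vertices_nonempty[OF k(1)] by (auto simp: vertices_def)
  obtain \<gamma> where \<gamma>: "path \<gamma>" "path_image \<gamma> \<subseteq> carrier_cell (pathstart r)" "pathstart \<gamma> = b" "pathfinish \<gamma> = pathstart r"
    using path_connected_cell[OF k(1)] b k(2) unfolding path_connected_def by blast
  have sub: "path_image \<alpha> \<subseteq> S" "path_image \<beta> \<subseteq> S" "path_image \<gamma> \<subseteq> S"
    using \<alpha>(2) \<beta>(2) \<gamma>(2) S mid q(3) r(3) pathstart_in_path_image pathfinish_in_path_image by blast+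
  obtain es where es: "edge_path X (pathstart \<alpha>) es b" "\<Union>(fst ` set es) \<subseteq> S"
    "homotopic_paths S ((\<alpha> +++ q) +++ reversepath \<gamma>) (realization (pathstart \<alpha>) es)"
    using q(1)[unfolded edge_homotopic_def, rule_format, of \<alpha> \<gamma>] \<alpha> \<gamma> b qr by auto
  obtain es' where es': "edge_path X b es' (pathstart \<beta>)" "\<Union>(fst ` set es') \<subseteq> S"
    "homotopic_paths S ((\<gamma> +++ r) +++ reversepath \<beta>) (realization b es')"
    using r(1)[unfolded edge_homotopic_def, rule_format, of \<gamma> \<beta>] \<beta> \<gamma> b by auto
  have "homotopic_paths S ((\<alpha> +++ (q +++ r)) +++ reversepath \<beta>) ((\<alpha> +++ q) +++ (r +++ reversepath \<beta>))"
  proof -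
    have "homotopic_paths S ((\<alpha> +++ (q +++ r)) +++ reversepath \<beta>) (((\<alpha> +++ q) +++ r) +++ reversepath \<beta>)"
      using \<alpha> \<beta> sub q r qr by (intro homotopic_paths_join homotopic_paths_assoc) auto
    also have "homotopic_paths S \<dots> ((\<alpha> +++ q) +++ (r +++ reversepath \<beta>))"
      using \<alpha> \<beta> sub q r qr by (intro homotopic_paths_sym[OF homotopic_paths_assoc]) (auto simp: path_image_join)
    finally show ?thesis .
  qed
  also have "homotopic_paths S \<dots> (((\<alpha> +++ q) +++ reversepath \<gamma>) +++ (\<gamma> +++ (r +++ reversepath \<beta>)))"
    using \<alpha> \<beta> \<gamma> sub q r qr by (intro homotopic_paths_sym[OF homotopic_paths_join_cancel]) (auto simp: path_image_join)
  also have "homotopic_paths S \<dots> (((\<alpha> +++ q) +++ reversepath \<gamma>) +++ ((\<gamma> +++ r) +++ reversepath \<beta>))"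
    using \<alpha> \<beta> \<gamma> sub q r qr by (intro homotopic_paths_join homotopic_paths_assoc) (auto simp: path_image_join)
  also have "homotopic_paths S \<dots> (realization (pathstart \<alpha>) es +++ realization b es')"
    using es es' \<gamma> by (intro homotopic_paths_join) auto
  also have "homotopic_paths S \<dots> (realization (pathstart \<alpha>) (es @ es'))"
  proof (rule realization_append[OF es(1) es'(1)])
    show "insert (pathstart \<alpha>) (\<Union>(fst ` set es)) \<subseteq> S" "insert b (\<Union>(fst ` set es')) \<subseteq> S"
      using es(2) es'(2) sub \<gamma>(3) pathstart_in_path_image[of \<alpha>] pathstart_in_path_image[of \<gamma>] by auto
  qed
  finally have "homotopic_paths S ((\<alpha> +++ (q +++ r)) +++ reversepath \<beta>) (realization (pathstart \<alpha>) (es @ es'))" .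
  moreover have "edge_path X (pathstart \<alpha>) (es @ es') (pathstart \<beta>)" "\<Union>(fst ` set (es @ es')) \<subseteq> S"
    using edge_path_append[OF es(1) es'(1)] es(2) es'(2) by auto
  ultimately show "\<exists>es. edge_path X (pathstart \<alpha>) es (pathstart \<beta>) \<and> \<Union>(fst ` set es) \<subseteq> S \<and>
        homotopic_paths S ((\<alpha> +++ (q +++ r)) +++ reversepath \<beta>) (realization (pathstart \<alpha>) es)"
    by blast
qed

text \<open>The local form of cellular approximation: a path that stays close to its start x
  deforms, with fixed ends, into one closed cell of \<open>S\<close>. Only the start is prescribed,
  because it is the carriers of points near x that contain the carrier of x.\<close>

definition locally_cellular :: "'a set \<Rightarrow> bool" where
  "locally_cellular S \<longleftrightarrow> (\<forall>x\<in>S. \<exists>U. openin (top_of_set S) U \<and> x \<in> U \<and>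
     (\<forall>q. path q \<and> path_image q \<subseteq> U \<and> pathstart q = x \<longrightarrow>
        (\<exists>k. \<exists>c\<in>X k. \<exists>q'. c \<subseteq> S \<and> path_image q' \<subseteq> c \<and> homotopic_paths S q q')))"

text \<open>Bisect the parameter interval: short pieces are handled by
  \<open>locally_cellular\<close>, and \<open>edge_homotopic\<close> is stable under
  concatenation.\<close>

lemma path_homotopic_realization:
  assumes SM: "S \<subseteq> M" and S: "\<And>x. x \<in> S \<Longrightarrow> carrier_cell x \<subseteq> S"
    and loc: "locally_cellular S"
    and p: "path p" "path_image p \<subseteq> S" "{pathstart p} \<in> X 0" "{pathfinish p} \<in> X 0"
  shows "\<exists>es. edge_path X (pathstart p) es (pathfinish p) \<and> homotopic_paths S p (realization (pathstart p) es)"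
proof -
  have sub: "path (p \<circ> linepath a b)" "path_image (p \<circ> linepath a b) \<subseteq> S" if "a \<in> {0..1}" "b \<in> {0..1}" for a b
    using that p segment_path[of p a b] by auto
  have join: "edge_homotopic S (p \<circ> linepath a c)"
    if "edge_homotopic S (p \<circ> linepath a b)" "edge_homotopic S (p \<circ> linepath b c)" "a \<in> {0..1}" "b \<in> {0..1}" "c \<in> {0..1}" for a b c
  proof (rule edge_homotopic_cong[OF _ _ S])
    show "edge_homotopic S ((p \<circ> linepath a b) +++ (p \<circ> linepath b c))"
      using that sub by (intro edge_homotopic_join[OF _ _ _ _ _ _ _ SM S]) (auto simp: pathstart_compose pathfinish_compose)
    show "homotopic_paths S (p \<circ> linepath a c) ((p \<circ> linepath a b) +++ (p \<circ> linepath b c))"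
      using that p by (intro homotopic_paths_sym[OF homotopic_paths_segment_join])
  qed
  have "0 \<le> (0::real) \<longrightarrow> 1 \<le> (1::real) \<longrightarrow> edge_homotopic S (p \<circ> linepath 0 1)"
  \<comment> \<open>The guards are needed because the local condition of Bolzano ranges over all
    short intervals around t, including those that leave [0,1].\<close>
  proof (rule Bolzano[of 0 1 "\<lambda>a b. 0 \<le> a \<longrightarrow> b \<le> 1 \<longrightarrow> edge_homotopic S (p \<circ> linepath a b)"])
    fix a b c :: real
    assume "0 \<le> a \<longrightarrow> b \<le> 1 \<longrightarrow> edge_homotopic S (p \<circ> linepath a b)" "0 \<le> b \<longrightarrow> c \<le> 1 \<longrightarrow> edge_homotopic S (p \<circ> linepath b c)" "a \<le> b" "b \<le> c"
    then show "0 \<le> a \<longrightarrow> c \<le> 1 \<longrightarrow> edge_homotopic S (p \<circ> linepath a c)"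
      using join[of a b c] by auto
  next
    fix t :: real assume t: "0 \<le> t" "t \<le> 1"
    then have "p t \<in> S" using p by (auto simp: path_image_def)
    then obtain U where U: "openin (top_of_set S) U" "p t \<in> U"
      "\<And>q. path q \<Longrightarrow> path_image q \<subseteq> U \<Longrightarrow> pathstart q = p t \<Longrightarrow>
        (\<exists>k. \<exists>c\<in>X k. \<exists>q'. c \<subseteq> S \<and> path_image q' \<subseteq> c \<and> homotopic_paths S q q')"
      using loc unfolding locally_cellular_def by meson
    obtain d where d: "d > 0" "\<And>s. s \<in> {0..1} \<Longrightarrow> \<bar>s - t\<bar> < d \<Longrightarrow> p s \<in> U"
      using path_nbhd[OF p(1,2) _ U(1,2)] t by auto
    have near: "\<exists>k. \<exists>c\<in>X k. \<exists>q'. c \<subseteq> S \<and> path_image q' \<subseteq> c \<and> homotopic_paths S (p \<circ> linepath t s) q'"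
      if s: "s \<in> {0..1}" "\<bar>s - t\<bar> < d" for s
    proof (rule U(3))
      show "path (p \<circ> linepath t s)" using sub s t by auto
      show "path_image (p \<circ> linepath t s) \<subseteq> U"
      proof
        fix y assume "y \<in> path_image (p \<circ> linepath t s)"
        then obtain r where r: "r \<in> closed_segment t s" "y = p r" using segment_path(2)[OF p(1), of t s] s t by auto
        then have "r \<in> {0..1}" "\<bar>r - t\<bar> < d"
          using s t by (auto simp: closed_segment_eq_real_ivl split: if_splits)
        then show "y \<in> U" using d r by blast
      qed
    qed (simp add: pathstart_compose)
    \<comment> \<open>Local cellularity speaks of paths that start at \<open>p t\<close>, so the
      interval is cut at t and its left part is run backwards.\<close>
    have "edge_homotopic S (p \<circ> linepath a b)" if ab: "a \<le> t \<and> t \<le> b \<and> b - a < d" "0 \<le> a" "b \<le> 1" for a b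
    proof (rule join)
      obtain k c q' where c: "c \<in> X k" "c \<subseteq> S" "path_image q' \<subseteq> c" "homotopic_paths S (p \<circ> linepath t b) q'"
        using near[of b] ab t by auto
      then show "edge_homotopic S (p \<circ> linepath t b)"
        using edge_homotopic_cell[OF c(1,2) _ c(3)] homotopic_paths_imp_path edge_homotopic_cong[OF _ c(4) S] by blast
      obtain k c q' where c: "c \<in> X k" "c \<subseteq> S" "path_image q' \<subseteq> c" "homotopic_paths S (p \<circ> linepath t a) q'"
        using near[of a] ab t by auto
      then have "homotopic_paths S (p \<circ> linepath a t) (reversepath q')"
        using homotopic_paths_reversepath_D[OF c(4)] by (simp add: path_compose_reversepath[symmetric])
      then show "edge_homotopic S (p \<circ> linepath a t)"
        using edge_homotopic_cell[OF c(1,2), of "reversepath q'"] c(3,4) homotopic_paths_imp_path edge_homotopic_cong[OF _ _ S]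
        by (metis path_image_reversepath)
    qed (use ab t in auto)
    then show "\<exists>d>0. \<forall>a b. a \<le> t \<and> t \<le> b \<and> b - a < d \<longrightarrow> 0 \<le> a \<longrightarrow> b \<le> 1 \<longrightarrow> edge_homotopic S (p \<circ> linepath a b)"
      using d(1) by blast
  qed simp
  moreover have "p \<circ> linepath 0 1 = p" by (auto simp: linepath_def)
  ultimately have "edge_homotopic S p" by simp
  let ?v = "pathstart p" and ?w = "pathfinish p"
  have rev: "reversepath (\<lambda>_. ?w) = (\<lambda>_. ?w)" by (simp add: reversepath_def)
  \<comment> \<open>Vertices are their own carriers, so constant connecting paths are admissible at
    both ends.\<close>
  obtain es where es: "edge_path X ?v es ?w" "homotopic_paths S (((\<lambda>_. ?v) +++ p) +++ (\<lambda>_. ?w)) (realization ?v es)"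
    using \<open>edge_homotopic S p\<close>[unfolded edge_homotopic_def, rule_format, of "\<lambda>_. ?v" "\<lambda>_. ?w"] p
    unfolding rev by (auto simp: path_const path_image_const pathstart_const pathfinish_const carrier_cell_vertex)
  have "homotopic_paths S (((\<lambda>_. ?v) +++ p) +++ (\<lambda>_. ?w)) (p +++ (\<lambda>_. ?w))"
    using p by (intro homotopic_paths_join homotopic_paths_const_join)
      (auto simp: path_const path_image_const pathstart_const pathfinish_const)
  also have "homotopic_paths S \<dots> p" using p by (intro homotopic_paths_join_const)
  finally show ?thesis using es homotopic_paths_sym homotopic_paths_trans by blast
qed

end

section \<open>Local cellularity of the manifold and of its 1-skeleton\<close>

context cell_complex begin

text \<open>In the convex model of c a small ball around \<open>g x\<close> is mapped into
  \<open>U\<close>; segments from \<open>g x\<close> stay in that ball and in the model.\<close>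

lemma cell_locally_path_connected:
  assumes c: "c \<in> X k" "x \<in> c" and U: "openin (top_of_set M) U" "x \<in> U"
  obtains W where "openin (top_of_set M) W" "x \<in> W"
    "\<And>y. y \<in> W \<inter> c \<Longrightarrow> \<exists>q. path q \<and> path_image q \<subseteq> c \<inter> U \<and> pathstart q = x \<and> pathfinish q = y"
proof -
  obtain K :: "(real ^ 'n) set" and h g where K: "convex K" "homeomorphism K c h g"
    using cell_homeomorphic_convex[OF c(1)] by metis
  have h: "continuous_on K h" "h ` K = c" and g: "continuous_on c g" "g ` c = K"
    and hg: "\<And>y. y \<in> c \<Longrightarrow> h (g y) = y"
    using K(2) by (auto simp: homeomorphism_def)
  obtain G where G: "open G" "U = M \<inter> G" using U by (auto simp: openin_open)
  have gx: "g x \<in> K" "h (g x) \<in> G" using g c hg U G by auto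
  then obtain H where H: "open H" "g x \<in> H" "\<forall>z\<in>K. z \<in> H \<longrightarrow> h z \<in> G"
    using h(1) G(1) unfolding continuous_on_topological by blast
  then obtain s where s: "s > 0" "ball (g x) s \<subseteq> H" using open_contains_ball by blast
  obtain O' where O': "open O'" "x \<in> O'" "\<forall>y\<in>c. y \<in> O' \<longrightarrow> g y \<in> ball (g x) s"
    using g(1) c(2) s(1) open_ball centre_in_ball unfolding continuous_on_topological by metis
  have "\<exists>q. path q \<and> path_image q \<subseteq> c \<inter> U \<and> pathstart q = x \<and> pathfinish q = y" if y: "y \<in> M \<inter> O' \<inter> c" for y
  proof (intro exI conjI)
    let ?q = "h \<circ> linepath (g x) (g y)"
    have "g y \<in> ball (g x) s \<inter> K" using y O' g(2) by auto
    then have seg: "closed_segment (g x) (g y) \<subseteq> ball (g x) s \<inter> K"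
      using K(1) gx s by (intro closed_segment_subset convex_Int) auto
    then show "path ?q" using h(1) by (intro path_continuous_image) (auto intro: continuous_on_subset)
    show "path_image ?q \<subseteq> c \<inter> U"
    proof -
      have "h z \<in> c \<inter> U" if "z \<in> closed_segment (g x) (g y)" for z
        using that seg H s h(2) G cell_subset[OF c(1)] by blast
      then show ?thesis by (auto simp: path_image_compose)
    qed
    show "pathstart ?q = x" "pathfinish ?q = y" using hg c y by (auto simp: pathstart_compose pathfinish_compose)
  qed
  moreover have "openin (top_of_set M) (M \<inter> O')" using O' by (auto simp: openin_open)
  moreover have "x \<in> M \<inter> O'" using O' c cell_subset by blast
  ultimately show thesis using that by blast
qed

text \<open>Choose a coordinate ball \<open>B\<close> around x and shrink it so that x can be joined
  to each remaining y within both \<open>B\<close> and the carrier of y. In a ball that connecting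
  path is homotopic to any other path from x to y.\<close>

lemma locally_cellular_manifold:
  fixes A :: "('a set \<times> ('a \<Rightarrow> real ^ 'n)) set"
  assumes "smooth_atlas M A"
  shows "locally_cellular M"
  unfolding locally_cellular_def
proof
  fix x assume x: "x \<in> M"
  have "x \<in> (\<Union>(U, \<phi>) \<in> A. U)" using assms x unfolding smooth_atlas_def by blast
  then obtain U \<phi> where U: "(U, \<phi>) \<in> A" "x \<in> U" by auto
  then obtain \<psi> where \<psi>: "openin (top_of_set M) U" "open (\<phi> ` U)" "homeomorphism U (\<phi> ` U) \<phi> \<psi>"
    using assms unfolding smooth_atlas_def by fast
  then obtain r where r: "r > 0" "ball (\<phi> x) r \<subseteq> \<phi> ` U"
    using U(2) open_contains_ball by blast
  define B where "B = \<psi> ` ball (\<phi> x) r"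
  have homB: "homeomorphism (ball (\<phi> x) r) B \<psi> \<phi>"
    unfolding B_def using homeomorphism_symD[OF \<psi>(3)] r(2)
    by (rule homeomorphism_of_subsets) auto
  have "openin (top_of_set U) B"
    unfolding B_def using r(2)
    by (intro homeomorphism_imp_open_map[OF homeomorphism_symD[OF \<psi>(3)]]) (simp add: openin_open_eq \<psi>(2))
  then have B: "openin (top_of_set M) B" "x \<in> B"
    using \<psi>(1) openin_trans apply blast
    using r(1) U(2) \<psi>(3) by (metis B_def centre_in_ball homeomorphism_apply1 image_eqI)
  define C where "C = {c \<in> (\<Union>k. X k). x \<in> c}"
  have "\<forall>c\<in>C. \<exists>W. openin (top_of_set M) W \<and> x \<in> W \<and>
      (\<forall>y\<in>W \<inter> c. \<exists>q. path q \<and> path_image q \<subseteq> c \<inter> B \<and> pathstart q = x \<and> pathfinish q = y)"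
  proof
    fix c assume "c \<in> C"
    then obtain k where "c \<in> X k" "x \<in> c" by (auto simp: C_def)
    then show "\<exists>W. openin (top_of_set M) W \<and> x \<in> W \<and>
      (\<forall>y\<in>W \<inter> c. \<exists>q. path q \<and> path_image q \<subseteq> c \<inter> B \<and> pathstart q = x \<and> pathfinish q = y)"
      using cell_locally_path_connected[OF _ _ B, of c k] by metis
  qed
  then obtain W where W: "\<And>c. c \<in> C \<Longrightarrow> openin (top_of_set M) (W c) \<and> x \<in> W c \<and>
      (\<forall>y\<in>W c \<inter> c. \<exists>q. path q \<and> path_image q \<subseteq> c \<inter> B \<and> pathstart q = x \<and> pathfinish q = y)"
    by metis
  obtain W0 where W0: "openin (top_of_set M) W0" "x \<in> W0" "\<And>y. y \<in> W0 \<Longrightarrow> carrier_cell x \<subseteq> carrier_cell y"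
    using carrier_cell_nbhd[OF x] by metis
  have "finite C" unfolding C_def using finite_cells by (rule rev_finite_subset) blast
  \<comment> \<open>So \<open>C\<close> is nonempty, as required for a finite intersection of sets
    open in \<open>M\<close>.\<close>
  have "carrier_cell x \<in> C" using carrier_cell_obtain[OF x] by (metis (mono_tags, lifting) C_def UN_I UNIV_I mem_Collect_eq)
  then have "openin (top_of_set M) (\<Inter>(W ` C))"
    using \<open>finite C\<close> W by (intro openin_Inter) auto
  define U' where "U' = B \<inter> W0 \<inter> \<Inter>(W ` C)"
  have "openin (top_of_set M) U'"
    unfolding U'_def using B W0 \<open>openin (top_of_set M) (\<Inter>(W ` C))\<close> by (intro openin_Int)
  moreover have "x \<in> U'" using B W0 W by (auto simp: U'_def)
  moreover have "\<exists>k. \<exists>c\<in>X k. \<exists>q'. c \<subseteq> M \<and> path_image q' \<subseteq> c \<and> homotopic_paths M q q'"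
    if q: "path q" "path_image q \<subseteq> U'" "pathstart q = x" for q
  proof -
    let ?y = "pathfinish q"
    have y: "?y \<in> U'" using q by auto
    then have "?y \<in> M" using openin_imp_subset[OF \<open>openin (top_of_set M) U'\<close>] by blast
    then obtain k where k: "carrier_cell ?y \<in> X k" "?y \<in> carrier_cell ?y" using carrier_cell_obtain by blast
    have "x \<in> carrier_cell x" using carrier_cell_obtain[OF x] by metis
    then have "carrier_cell ?y \<in> C" using k W0(3) y by (auto simp: C_def U'_def)
    then obtain q' where q': "path q'" "path_image q' \<subseteq> carrier_cell ?y \<inter> B" "pathstart q' = x" "pathfinish q' = ?y"
      using W[of "carrier_cell ?y"] y k(2) by (auto simp: U'_def)
    have "homotopic_paths B q q'"
      using q q' by (intro homotopic_paths_homeomorphic_convex[OF convex_ball homB]) (auto simp: U'_def)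
    then have "homotopic_paths M q q'"
      using homotopic_paths_subset openin_imp_subset[OF B(1)] by blast
    then show ?thesis using k(1) q'(2) cell_subset[OF k(1)] by blast
  qed
  ultimately show "\<exists>U. openin (top_of_set M) U \<and> x \<in> U \<and>
     (\<forall>q. path q \<and> path_image q \<subseteq> U \<and> pathstart q = x \<longrightarrow>
        (\<exists>k. \<exists>c\<in>X k. \<exists>q'. c \<subseteq> M \<and> path_image q' \<subseteq> c \<and> homotopic_paths M q q'))"
    by blast
qed

lemma skeleton_1: "skeleton X 1 = \<Union>(X 0) \<union> \<Union>(X 1)"
  by (auto simp: skeleton_def le_Suc_eq)

lemma edge_not_singleton: "e \<in> X 1 \<Longrightarrow> e \<noteq> {v}"
  by (metis edge_obtain_arc pathfinish_in_path_image pathstart_in_path_image singletonD)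

lemma skeleton_subset: "skeleton X i \<subseteq> M"
  using cell_subset by (auto simp: skeleton_def)

lemma carrier_cell_skeleton:
  assumes "x \<in> skeleton X i"
  shows "carrier_cell x \<subseteq> skeleton X i" "\<exists>j\<le>i. carrier_cell x \<in> X j"
proof -
  obtain j c where j: "j \<le> i" "c \<in> X j" "x \<in> c" using assms by (auto simp: skeleton_def)
  then show "\<exists>j\<le>i. carrier_cell x \<in> X j" using carrier_cell_least(2)[OF j(2,3)] by (meson le_trans)
  show "carrier_cell x \<subseteq> skeleton X i"
    using j carrier_cell_least(1)[OF j(2,3)] by (auto simp: skeleton_def)
qed

lemma carrier_cell_edge:
  assumes "e \<in> X 1" "x \<in> e"
  shows "carrier_cell x = e \<or> {x} \<in> X 0"
proof (cases "x \<in> cell_boundary X 1 e")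
  case True
  then have 0: "carrier_cell x \<in> X 0" using carrier_cell_boundary(1)[OF True] by simp
  have "x \<in> carrier_cell x" using carrier_cell_obtain assms cell_subset by blast
  then show ?thesis using 0 by (metis singletonD zero_cell_singleton)
next
  case False
  then show ?thesis using carrier_cell_eq[OF assms(1)] assms(2) by blast
qed

text \<open>Several edges may meet at a vertex, so the skeleton has no interval chart there; instead
  its star is a cone. Contracting every edge linearly to v, each in its own coordinates, sweeps q
  across a square, and the other three sides of the square give the path in one cell.\<close>

lemma star_path_homotopic:
  assumes v: "{v} \<in> X 0"
    and q: "path q" "path_image q \<subseteq> skeleton X 1" "pathstart q = v"
    and star: "\<And>y. y \<in> path_image q \<Longrightarrow> v \<in> carrier_cell y"
  shows "\<exists>q'. path_image q' \<subseteq> carrier_cell (pathfinish q) \<and> homotopic_paths (skeleton X 1) q q'"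
proof -
  have "\<exists>K h g. convex (K :: (real ^ 'n) set) \<and> homeomorphism K c h g" if "c \<in> (\<Union>k. X k)" for c
    using that cell_homeomorphic_convex by (metis UN_E)
  then obtain K :: "'a set \<Rightarrow> (real ^ 'n) set" and h g
    where Khg: "\<And>c. c \<in> (\<Union>k. X k) \<Longrightarrow> convex (K c) \<and> homeomorphism (K c) c (h c) (g c)"
    by metis
  define r where "r c s y = h c ((1 - s) *\<^sub>R g c v + s *\<^sub>R g c y)" for c s y
  define H where "H = (\<lambda>z. r (carrier_cell (q (snd z))) (fst z) (q (snd z)))"
  define C where "C = {c \<in> X 0 \<union> X 1. v \<in> c}"
  have C: "continuous_on (K c) (h c)" "h c ` K c = c" "continuous_on c (g c)" "g c ` c = K c" "convex (K c)"
    "\<And>y. y \<in> c \<Longrightarrow> h c (g c y) = y" "v \<in> c" if "c \<in> C" for c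
    using that Khg[of c] by (auto simp: C_def homeomorphism_def)
  have inK: "(1 - s) *\<^sub>R g c v + s *\<^sub>R g c y \<in> K c" if "c \<in> C" "s \<in> {0..1}" "y \<in> c" for c s y
    by (rule convexD_alt[OF C(5)[OF that(1)]]) (use C(4,7)[OF that(1)] that in auto)
  have r: "r c 1 y = y" "r c 0 y = v" "\<And>s. r c s v = v" if "c \<in> C" "y \<in> c" for c y
    using C(6,7)[OF that(1)] that by (auto simp: r_def scaleR_left_distrib[symmetric])
  have r_in: "r c s y \<in> c" if "c \<in> C" "s \<in> {0..1}" "y \<in> c" for c s y
    unfolding r_def using inK[OF that] C(2)[OF that(1)] by blast
  have carC: "carrier_cell (q t) \<in> C" "q t \<in> carrier_cell (q t)" if "t \<in> {0..1}" for t
  proof -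
    have "q t \<in> path_image q" using that by (auto simp: path_image_def)
    then have "q t \<in> skeleton X 1" "v \<in> carrier_cell (q t)" using q star by auto
    then show "carrier_cell (q t) \<in> C" "q t \<in> carrier_cell (q t)"
      using carrier_cell_skeleton(2)[of "q t" 1] carrier_cell_obtain[of "q t"] skeleton_subset
      by (auto simp: C_def le_Suc_eq)
  qed
  \<comment> \<open>\<open>H\<close> uses the carrier of \<open>q t\<close>, which jumps. The
    formula of any cell c containing \<open>q t\<close> gives the same value: away from v that cell
    is the carrier, and at v every contraction rests. This makes \<open>H\<close> continuous on each
    closed piece \<open>I c\<close>.\<close>
  have H_eq: "H (s, t) = r c s (q t)" if "c \<in> C" "t \<in> {0..1}" "q t \<in> c" for c s t
  proof (cases "q t = v")
    case True
    have "r (carrier_cell (q t)) s v = v" "r c s v = v"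
      using r(3)[OF carC[OF that(2)]] r(3)[OF that(1,3)] by auto
    then show ?thesis using True by (simp add: H_def)
  next
    case False
    have "carrier_cell (q t) = c"
    proof -
      have "{q t} \<notin> X 0"
        using carrier_cell_vertex star[of "q t"] that(2) False by (auto simp: path_image_def)
      moreover have "c \<notin> X 0" using that(1,3) C(7)[OF that(1)] False zero_cell_singleton by (metis singletonD)
      then have "c \<in> X 1" using that(1) by (auto simp: C_def)
      ultimately show ?thesis using carrier_cell_edge that(3) by blast
    qed
    then show ?thesis by (simp add: H_def)
  qed
  define I where "I c = {0..1::real} \<times> {t \<in> {0..1}. q t \<in> c}" for c
  have cont: "continuous_on {0..1} q" using q(1) by (simp add: path_def)
  have cover: "{0..1} \<times> {0..1} = (\<Union>c\<in>C. I c)"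
    using carC unfolding I_def by blast
  have "continuous_on (\<Union>c\<in>C. I c) H"
  proof (rule continuous_on_closed_Union)
    show "finite C" unfolding C_def using finite_cells by (rule rev_finite_subset) blast
    fix c assume c: "c \<in> C"
    then obtain k where "c \<in> X k" by (auto simp: C_def)
    then have "closedin (top_of_set {0..1}) ({0..1} \<inter> q -` c)"
      using cont q(2) skeleton_subset[of 1] closedin_cell
      by (intro continuous_closedin_preimage_gen[of _ _ M]) (auto simp: path_image_def)
    then have "closed ({0..1} \<inter> q -` c)" using closedin_closed_trans closed_atLeastAtMost by blast
    moreover have "{t \<in> {0..1}. q t \<in> c} = {0..1} \<inter> q -` c" by auto
    ultimately show "closed (I c)" unfolding I_def by (simp add: closed_Times)
    have "continuous_on (I c) (\<lambda>z. r c (fst z) (q (snd z)))"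
      unfolding r_def
    proof (rule continuous_on_compose2[OF C(1)[OF c]])
      have qc: "continuous_on (I c) (\<lambda>z. q (snd z))"
        by (rule continuous_on_compose2[OF cont]) (auto simp: I_def intro!: continuous_intros)
      have "continuous_on (I c) (\<lambda>z. g c (q (snd z)))"
        by (rule continuous_on_compose2[OF C(3)[OF c] qc]) (auto simp: I_def)
      then show "continuous_on (I c) (\<lambda>z. (1 - fst z) *\<^sub>R g c v + fst z *\<^sub>R g c (q (snd z)))"
        by (intro continuous_intros)
      show "(\<lambda>z. (1 - fst z) *\<^sub>R g c v + fst z *\<^sub>R g c (q (snd z))) ` I c \<subseteq> K c"
        using inK[OF c] by (auto simp: I_def)
    qed
    then show "continuous_on (I c) H"
      using H_eq[OF c] by (subst continuous_on_cong[OF refl]) (auto simp: I_def)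
  qed
  then have contH: "continuous_on ({0..1} \<times> {0..1}) H" using cover by simp
  let ?Q = "{0..1::real} \<times> {0..1::real}"
  let ?f = "linepath (1, 0) (1, 1) :: real \<Rightarrow> real \<times> real"
  \<comment> \<open>The other three sides of the square: the first two are collapsed to v, and the
    third stays in the carrier of the end of q.\<close>
  let ?g = "linepath (1, 0) (0, 0) +++ linepath (0, 0) (0, 1) +++ linepath (0, 1) (1, 1) :: real \<Rightarrow> real \<times> real"
  have cQ: "convex ?Q" by (simp add: convex_Times)
  have seg: "closed_segment a b \<subseteq> ?Q" if "a \<in> ?Q" "b \<in> ?Q" for a b
    using that cQ by (rule closed_segment_subset)
  have HS: "H ` ?Q \<subseteq> skeleton X 1"
  proof -
    have "H (s, t) \<in> skeleton X 1" if "s \<in> {0..1}" "t \<in> {0..1}" for s t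
    proof -
      have "q t \<in> skeleton X 1" using q(2) that by (auto simp: path_image_def)
      then have "carrier_cell (q t) \<subseteq> skeleton X 1" by (rule carrier_cell_skeleton(1))
      moreover have "H (s, t) \<in> carrier_cell (q t)"
        using H_eq[OF carC(1)[OF that(2)] that(2) carC(2)[OF that(2)]]
          r_in[OF carC(1)[OF that(2)] that(1) carC(2)[OF that(2)]] by simp
      ultimately show ?thesis by blast
    qed
    then show ?thesis by auto
  qed
  have "homotopic_paths (skeleton X 1) (H \<circ> ?f) (H \<circ> ?g)"
    by (rule homotopic_paths_convex_image[OF cQ])
      (use seg contH HS in \<open>auto simp: path_image_join\<close>)
  moreover have "homotopic_paths (skeleton X 1) q (H \<circ> ?f)"
  proof (rule homotopic_paths_eq[OF q(1,2)])
    fix t :: real assume t: "t \<in> {0..1}"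
    have "?f t = (1, t)" by (simp add: linepath_def)
    then show "q t = (H \<circ> ?f) t" using r(1) carC[OF t] H_eq[OF carC(1)[OF t] t carC(2)[OF t]] by simp
  qed
  moreover have "path_image (H \<circ> ?g) \<subseteq> carrier_cell (pathfinish q)"
  proof -
    let ?c = "carrier_cell (pathfinish q)"
    have c: "?c \<in> C" "q 1 \<in> ?c" using carC[of 1] by (auto simp: pathfinish_def)
    have 1: "H (s, 0) = v" if "s \<in> {0..1}" for s
      using H_eq[OF carC(1), of 0 0 s] carC[of 0] r(3) q(3) by (simp add: pathstart_def)
    have 2: "H (0, t) = v" if "t \<in> {0..1}" for t
      using H_eq[OF carC(1) that carC(2)] carC[OF that] r(2) that by simp
    have 3: "H (s, 1) \<in> ?c" if "s \<in> {0..1}" for s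
      using H_eq[OF c(1) _ c(2)] r_in[OF c(1) that c(2)] by simp
    have "path_image ?g \<subseteq> {0..1} \<times> {0} \<union> {0} \<times> {0..1} \<union> {0..1} \<times> {1}"
    proof -
      have "closed_segment (1, 0) (0, 0) \<subseteq> {0..1::real} \<times> {0::real}"
        "closed_segment (0, 0) (0, 1) \<subseteq> {0::real} \<times> {0..1::real}"
        "closed_segment (0, 1) (1, 1) \<subseteq> {0..1::real} \<times> {1::real}"
        by (rule closed_segment_subset; auto intro!: convex_Times)+
      then show ?thesis by (auto simp: path_image_join)
    qed
    moreover have "H z \<in> ?c" if "z \<in> {0..1} \<times> {0} \<union> {0} \<times> {0..1} \<union> {0..1} \<times> {1}" for z
      using that 1 2 3 C(7)[OF c(1)] by (cases z) auto
    ultimately show ?thesis unfolding path_image_compose by blast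
  qed
  ultimately show ?thesis using homotopic_paths_trans by blast
qed

text \<open>At a vertex the cone structure of the star is used. Near an interior point x of an edge
  the path stays in that edge, since the only cell of dimension at most 1 containing x is the edge
  itself.\<close>

lemma locally_cellular_skeleton_1: "locally_cellular (skeleton X 1)"
  unfolding locally_cellular_def
proof
  let ?S = "skeleton X 1"
  fix x assume x: "x \<in> ?S"
  then have "x \<in> M" using skeleton_subset by blast
  obtain W where W: "openin (top_of_set M) W" "x \<in> W" "\<And>y. y \<in> W \<Longrightarrow> carrier_cell x \<subseteq> carrier_cell y"
    using carrier_cell_nbhd[OF \<open>x \<in> M\<close>] by metis
  have "x \<in> carrier_cell x" using carrier_cell_obtain \<open>x \<in> M\<close> by blast
  have "\<exists>k. \<exists>c\<in>X k. \<exists>q'. c \<subseteq> ?S \<and> path_image q' \<subseteq> c \<and> homotopic_paths ?S q q'"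
    if q: "path q" "path_image q \<subseteq> W \<inter> ?S" "pathstart q = x" for q
  proof (cases "{x} \<in> X 0")
    case True
    let ?c = "carrier_cell (pathfinish q)"
    have "pathfinish q \<in> ?S" using q by auto
    then obtain j where "?c \<in> X j" "?c \<subseteq> ?S" using carrier_cell_skeleton by blast
    moreover have "\<exists>q'. path_image q' \<subseteq> ?c \<and> homotopic_paths ?S q q'"
    proof (rule star_path_homotopic[OF True q(1) _ q(3)])
      show "x \<in> carrier_cell y" if "y \<in> path_image q" for y
        using that q(2) W(3) \<open>x \<in> carrier_cell x\<close> by blast
    qed (use q in auto)
    ultimately show ?thesis by blast
  next
    case False
    then have "carrier_cell x \<notin> X 0" using \<open>x \<in> carrier_cell x\<close> by (metis singletonD zero_cell_singleton)
    then have e: "carrier_cell x \<in> X 1" using carrier_cell_skeleton(2)[OF x] by (auto simp: le_Suc_eq)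
    have "path_image q \<subseteq> carrier_cell x"
    proof
      fix y assume "y \<in> path_image q"
      then have y: "y \<in> W" "y \<in> ?S" using q by auto
      then have sub: "x \<in> carrier_cell y" using W \<open>x \<in> carrier_cell x\<close> by blast
      have "y \<in> carrier_cell y" using y skeleton_subset carrier_cell_obtain by blast
      obtain j where "j \<le> 1" "carrier_cell y \<in> X j" using carrier_cell_skeleton(2)[OF y(2)] by blast
      then consider "carrier_cell y \<in> X 0" | "carrier_cell y \<in> X 1" by (auto simp: le_Suc_eq)
      then have "carrier_cell x = carrier_cell y"
      proof cases
        case 1
        then show ?thesis using sub False by (metis singletonD zero_cell_singleton)
      next
        case 2
        then show ?thesis using sub False carrier_cell_edge by blast
      qed
      then show "y \<in> carrier_cell x" using \<open>y \<in> carrier_cell y\<close> by simp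
    qed
    then show ?thesis using e carrier_cell_skeleton(1)[OF x] q(1) by (intro exI[of _ 1] bexI[OF _ e] exI[of _ q]) auto
  qed
  moreover have "openin (top_of_set ?S) (W \<inter> ?S)" using openin_top_of_set_Int[OF W(1) skeleton_subset] .
  ultimately show "\<exists>U. openin (top_of_set ?S) U \<and> x \<in> U \<and>
     (\<forall>q. path q \<and> path_image q \<subseteq> U \<and> pathstart q = x \<longrightarrow>
        (\<exists>k. \<exists>c\<in>X k. \<exists>q'. c \<subseteq> ?S \<and> path_image q' \<subseteq> c \<and> homotopic_paths ?S q q'))"
    using W(2) x by blast
qed

end

section \<open>The star of a vertex in a dual complex\<close>

text \<open>A point of A outside B would lie in the affine hull of the other points of C.\<close>

lemma affine_independent_hull_mono_iff:
  assumes "\<not> affine_dependent C" "A \<subseteq> C" "B \<subseteq> C"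
  shows "convex hull A \<subseteq> convex hull B \<longleftrightarrow> A \<subseteq> B"
proof
  assume sub: "convex hull A \<subseteq> convex hull B"
  show "A \<subseteq> B"
  proof (rule ccontr)
    assume "\<not> A \<subseteq> B"
    then obtain a where a: "a \<in> A" "a \<notin> B" by blast
    then have "a \<in> affine hull B"
      using sub hull_inc[of a A convex] convex_hull_subset_affine_hull by blast
    then have "a \<in> affine hull (C - {a})"
      using hull_mono[of B "C - {a}" affine] a assms(3) by blast
    then show False using assms a by (auto simp: affine_dependent_def)
  qed
qed (rule hull_mono)

text \<open>Pass to a facet as long as z lies on the relative boundary.\<close>

lemma simplex_point_rel_interior:
  fixes C :: "'b::euclidean_space set"
  assumes "finite C" "\<not> affine_dependent C" "z \<in> convex hull C"
  obtains A where "A \<subseteq> C" "A \<noteq> {}" "z \<in> rel_interior (convex hull A)"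
proof -
  have "\<exists>A. A \<subseteq> C \<and> A \<noteq> {} \<and> z \<in> rel_interior (convex hull A)"
    using assms
  proof (induction C rule: finite_psubset_induct)
    case (psubset C)
    show ?case
    proof (cases "z \<in> rel_interior (convex hull C)")
      case True
      then show ?thesis by (metis convex_hull_empty empty_iff order_refl rel_interior_empty)
    next
      case False
      then have "z \<in> convex hull C - rel_interior (convex hull C)" using psubset by auto
      then obtain a where a: "a \<in> C" "z \<in> convex hull (C - {a})"
        using rel_boundary_of_convex_hull[OF psubset.prems(1)] by auto
      have "\<not> affine_dependent (C - {a})" using psubset.prems affine_independent_Diff by blast
      then obtain A where "A \<subseteq> C - {a}" "A \<noteq> {}" "z \<in> rel_interior (convex hull A)"
        using psubset.IH[of "C - {a}"] a by blast
      then show ?thesis by blast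
    qed
  qed
  then show thesis using that by blast
qed

section \<open>Simplices contained in a given simplex\<close>

locale triangulation =
  fixes M :: "'a::topological_space set" and T :: "nat \<Rightarrow> 'a set set"
    and \<Delta> :: "'a set \<Rightarrow> (real ^ 'n::finite) set" and \<kappa> :: "'a set \<Rightarrow> (real ^ 'n) \<Rightarrow> 'a"
  assumes simplices: "\<forall>k. \<forall>s \<in> T k. s \<subseteq> M \<and> int k simplex \<Delta> s \<and> (\<exists>g. homeomorphism (\<Delta> s) s (\<kappa> s) g) \<and>
           (\<forall>F. F face_of \<Delta> s \<and> F \<noteq> {} \<longrightarrow>
              \<kappa> s ` F \<in> T (nat (aff_dim F)) \<and>
              (\<exists>a L. linear L \<and> (\<lambda>y. a + L y) ` \<Delta> (\<kappa> s ` F) = F \<and>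
                 (\<forall>y \<in> \<Delta> (\<kappa> s ` F). \<kappa> (\<kappa> s ` F) y = \<kappa> s (a + L y))))"
    and partition: "\<forall>x \<in> M. \<exists>!s. s \<in> (\<Union>k. T k) \<and> x \<in> \<kappa> s ` rel_interior (\<Delta> s)"
begin

lemma simplexD:
  assumes "s \<in> T k"
  shows "s \<subseteq> M" "int k simplex \<Delta> s" "\<exists>g. homeomorphism (\<Delta> s) s (\<kappa> s) g" "\<kappa> s ` \<Delta> s = s" "convex (\<Delta> s)"
proof -
  show s: "s \<subseteq> M" "int k simplex \<Delta> s" "\<exists>g. homeomorphism (\<Delta> s) s (\<kappa> s) g"
    using simplices assms by blast+
  then show "\<kappa> s ` \<Delta> s = s" unfolding homeomorphism_def by blast
  show "convex (\<Delta> s)" using s(2) unfolding simplex by auto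
qed

lemma simplex_dim_unique:
  assumes "s \<in> T i" "s \<in> T j"
  shows "i = j"
proof -
  have "int i simplex \<Delta> s" "int j simplex \<Delta> s" using simplices assms by auto
  then have "aff_dim (\<Delta> s) = int i" "aff_dim (\<Delta> s) = int j" using aff_dim_simplex by blast+
  then show ?thesis by simp
qed

text \<open>A point in the open simplex of s also lies in the relative interior of some face of t.
  The image of that face is a simplex of the triangulation whose open simplex contains the point, so
  by the partition property it is s.\<close>

lemma subsimplex_face:
  assumes s: "s \<in> T j" and t: "t \<in> T k" and st: "s \<subseteq> t"
    and C: "finite C" "\<not> affine_dependent C" "\<Delta> t = convex hull C"
  obtains A where "A \<subseteq> C" "A \<noteq> {}" "s = \<kappa> t ` (convex hull A)"
proof -
  have hs: "\<kappa> s ` \<Delta> s = s" "\<kappa> t ` \<Delta> t = t" and sM: "s \<subseteq> M"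
    using simplexD[OF s] simplexD[OF t] by auto
  have simp_s: "int j simplex \<Delta> s" using simplexD[OF s] by blast
  have ne: "\<Delta> s \<noteq> {}"
    using simp_s by auto
  moreover have "convex (\<Delta> s)" using simplexD[OF s] by blast
  ultimately obtain y where y: "y \<in> rel_interior (\<Delta> s)" using rel_interior_eq_empty by blast
  let ?x = "\<kappa> s y"
  have x: "?x \<in> s" using y rel_interior_subset hs by blast
  then obtain z where z: "z \<in> convex hull C" "?x = \<kappa> t z" using st hs(2) C(3) by (metis imageE subsetD)
  obtain A where A: "A \<subseteq> C" "A \<noteq> {}" "z \<in> rel_interior (convex hull A)"
    using simplex_point_rel_interior[OF C(1,2) z(1)] by metis
  let ?F = "convex hull A"
  have F: "?F face_of \<Delta> t" "?F \<noteq> {}"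
    using A C face_of_convex_hull_affine_independent[OF C(2)] by auto
  then obtain a L where aL: "\<kappa> t ` ?F \<in> T (nat (aff_dim ?F))" "linear L" "(\<lambda>y. a + L y) ` \<Delta> (\<kappa> t ` ?F) = ?F"
     "\<forall>y \<in> \<Delta> (\<kappa> t ` ?F). \<kappa> (\<kappa> t ` ?F) y = \<kappa> t (a + L y)"
    using simplices t by blast
  let ?s = "\<kappa> t ` ?F"
  have "convex (\<Delta> ?s)" using simplexD[OF aL(1)] by blast
  \<comment> \<open>The affine change of coordinates preserves relative interiors, so the open face
    of t is the open simplex of \<open>?s\<close> for its own characteristic map.\<close>
  have "rel_interior ?F = (\<lambda>y. a + y) ` L ` rel_interior (\<Delta> ?s)"
  proof -
    have "rel_interior ?F = rel_interior ((\<lambda>y. a + y) ` L ` \<Delta> ?s)" using aL(3) by (simp add: image_image)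
    also have "\<dots> = (\<lambda>y. a + y) ` L ` rel_interior (\<Delta> ?s)"
      using rel_interior_convex_linear_image[OF aL(2) \<open>convex (\<Delta> ?s)\<close>] by (simp add: rel_interior_translation)
    finally show ?thesis .
  qed
  then obtain w where w: "w \<in> rel_interior (\<Delta> ?s)" "z = a + L w" using A(3) by auto
  then have "?x = \<kappa> ?s w" using z(2) aL(4) rel_interior_subset by fastforce
  then have "?x \<in> \<kappa> ?s ` rel_interior (\<Delta> ?s)" "?x \<in> \<kappa> s ` rel_interior (\<Delta> s)" using w(1) y by (metis imageI)+
  moreover have "?s \<in> (\<Union>k. T k)" "s \<in> (\<Union>k. T k)" using aL(1) s by auto
  moreover have "?x \<in> M" using x sM by blast
  ultimately have "s = ?s" using partition by blast
  then show thesis using that A by blast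
qed

text \<open>This reduces the simplices inside t to the combinatorics of nonempty subsets of a set of
  k + 1 vertices; nothing after it looks at characteristic maps.\<close>

lemma simplex_faces:
  assumes t: "t \<in> T k"
  obtains C :: "(real ^ 'n) set" and \<phi> where "finite C" "card C = k + 1"
    "\<And>A. A \<subseteq> C \<Longrightarrow> A \<noteq> {} \<Longrightarrow> \<phi> A \<in> T (card A - 1)"
    "\<And>A B. A \<subseteq> C \<Longrightarrow> B \<subseteq> C \<Longrightarrow> \<phi> A \<subseteq> \<phi> B \<longleftrightarrow> A \<subseteq> B"
    "\<And>s j. s \<in> T j \<Longrightarrow> s \<subseteq> t \<Longrightarrow> \<exists>A\<subseteq>C. A \<noteq> {} \<and> s = \<phi> A"
    "\<phi> C = t"
proof -
  have "int k simplex \<Delta> t" using simplexD[OF t] by blast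
  then obtain C where C: "finite C" "\<not> affine_dependent C" "int (card C) = int k + 1" "\<Delta> t = convex hull C"
    by (auto simp: simplex)
  define \<phi> where "\<phi> A = \<kappa> t ` (convex hull A)" for A
  obtain g where hom: "homeomorphism (\<Delta> t) t (\<kappa> t) g" using simplexD[OF t] by blast
  then have inj: "inj_on (\<kappa> t) (\<Delta> t)" and im: "\<kappa> t ` \<Delta> t = t"
    by (auto simp: homeomorphism_def intro: inj_on_inverseI)
  show thesis
  proof (rule that[of C \<phi>])
    show "finite C" "card C = k + 1" using C by auto
    show "\<phi> C = t" using im C by (simp add: \<phi>_def)
    show "\<exists>A\<subseteq>C. A \<noteq> {} \<and> s = \<phi> A" if "s \<in> T j" "s \<subseteq> t" for s j
      using subsimplex_face[OF that(1) t that(2) C(1,2,4)] unfolding \<phi>_def by metis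
    show "\<phi> A \<subseteq> \<phi> B \<longleftrightarrow> A \<subseteq> B" if AB: "A \<subseteq> C" "B \<subseteq> C" for A B
    proof -
      have "convex hull A \<subseteq> \<Delta> t" "convex hull B \<subseteq> \<Delta> t" using AB hull_mono C(4) by metis+
      then have "\<phi> A \<subseteq> \<phi> B \<longleftrightarrow> convex hull A \<subseteq> convex hull B"
        unfolding \<phi>_def using inj by (meson inj_on_image_subset_iff)
      then show ?thesis using affine_independent_hull_mono_iff[OF C(2) AB] by simp
    qed
    show "\<phi> A \<in> T (card A - 1)" if A: "A \<subseteq> C" "A \<noteq> {}" for A
    proof -
      have "convex hull A face_of \<Delta> t" "convex hull A \<noteq> {}"
        using A C face_of_convex_hull_affine_independent[OF C(2)] by auto
      then have "\<phi> A \<in> T (nat (aff_dim (convex hull A)))" unfolding \<phi>_def using simplices t by blast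
      moreover have "\<not> affine_dependent A" using A C(2) affine_independent_subset by blast
      then have "aff_dim (convex hull A) = int (card A) - 1" by (simp add: aff_dim_convex_hull aff_dim_affine_independent)
      moreover have "card A > 0" using A C(1) finite_subset card_gt_0_iff by metis
      ultimately show ?thesis by (simp add: nat_diff_distrib)
    qed
  qed
qed

end

text \<open>\<open>C\<close> is the vertex set of the model simplex of the top simplex dual to \<open>v\<close>, and \<open>\<psi> A\<close> is the cell dual
  to its face spanned by \<open>A\<close>.\<close>

lemma cpx_vertex_star:
  fixes M :: "'a::topological_space set"
  assumes cpx: "cpx TYPE('n::finite) M X" and v: "{v} \<in> X 0"
  obtains C :: "(real ^ 'n) set" and \<psi> where "finite C" "card C = CARD('n) + 1"
    "\<And>A. A \<subseteq> C \<Longrightarrow> A \<noteq> {} \<Longrightarrow> \<psi> A \<in> X (CARD('n) + 1 - card A) \<and> v \<in> \<psi> A"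
    "\<And>A B. A \<subseteq> C \<Longrightarrow> B \<subseteq> C \<Longrightarrow> A \<noteq> {} \<Longrightarrow> B \<noteq> {} \<Longrightarrow> \<psi> A \<subseteq> \<psi> B \<longleftrightarrow> B \<subseteq> A"
    "\<And>d j. d \<in> X j \<Longrightarrow> v \<in> d \<Longrightarrow> \<exists>A\<subseteq>C. A \<noteq> {} \<and> card A + j = CARD('n) + 1 \<and> d = \<psi> A"
proof -
  let ?n = "CARD('n)"
  obtain T where T: "simplicial_triangulation TYPE('n) M T" "dual_complex ?n X T"
    and emb: "embedded_cell_complex TYPE('n) M X" using cpx unfolding cpx_def by blast
  have "\<exists>(\<Delta> :: 'a set \<Rightarrow> (real ^ 'n) set) \<kappa>. triangulation M T \<Delta> \<kappa>"
    using T(1) unfolding simplicial_triangulation_def triangulation_def by (rule conjunct2)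
  then obtain \<Delta> :: "'a set \<Rightarrow> (real ^ 'n) set" and \<kappa> where "triangulation M T \<Delta> \<kappa>" by blast
  then interpret triangulation M T \<Delta> \<kappa> .
  obtain D where D0: "(\<forall>k\<le>?n. bij_betw D (T k) (X (?n - k))) \<and>
      (\<forall>s \<in> (\<Union>k. T k). \<forall>t \<in> (\<Union>k. T k). s \<subseteq> t \<longleftrightarrow> D t \<subseteq> D s)"
    using T(2) unfolding dual_complex_def by (rule exE)
  have D: "\<And>k. k \<le> ?n \<Longrightarrow> bij_betw D (T k) (X (?n - k))"
     "\<And>s t i j. s \<in> T i \<Longrightarrow> t \<in> T j \<Longrightarrow> s \<subseteq> t \<longleftrightarrow> D t \<subseteq> D s"
    using conjunct1[OF D0] apply simp
    using conjunct2[OF D0] by (meson UN_I UNIV_I)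
  have "{v} \<in> D ` T ?n" using D(1)[of ?n] v by (auto simp: bij_betw_def)
  then obtain t where t: "t \<in> T ?n" "D t = {v}" by force
  show thesis
  proof (rule simplex_faces[OF t(1)])
    fix C :: "(real ^ 'n) set" and \<phi> assume C: "finite C" "card C = ?n + 1"
      "\<And>A. A \<subseteq> C \<Longrightarrow> A \<noteq> {} \<Longrightarrow> \<phi> A \<in> T (card A - 1)"
      "\<And>A B. A \<subseteq> C \<Longrightarrow> B \<subseteq> C \<Longrightarrow> \<phi> A \<subseteq> \<phi> B \<longleftrightarrow> A \<subseteq> B"
      "\<And>s j. s \<in> T j \<Longrightarrow> s \<subseteq> t \<Longrightarrow> \<exists>A\<subseteq>C. A \<noteq> {} \<and> s = \<phi> A"
      "\<phi> C = t"
    have cardA: "0 < card A" "card A \<le> ?n + 1" if "A \<subseteq> C" "A \<noteq> {}" for A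
      using that C(1,2) card_mono[of C A] finite_subset by (auto simp: card_gt_0_iff)
    show thesis
    proof (rule that[of C "\<lambda>A. D (\<phi> A)"])
      show "finite C" "card C = ?n + 1" using C by auto
      fix A assume A: "A \<subseteq> C" "A \<noteq> {}"
      have "card A - 1 \<le> ?n" using cardA[OF A] by simp
      from D(1)[OF this] have "D (\<phi> A) \<in> X (?n - (card A - 1))" using C(3)[OF A] by (auto simp: bij_betw_def)
      moreover have "?n - (card A - 1) = ?n + 1 - card A" using cardA[OF A] by simp
      moreover have "\<phi> A \<subseteq> t" using C(4)[OF A(1), of C] C(6) A by auto
      then have "D t \<subseteq> D (\<phi> A)" using D(2)[OF C(3)[OF A] t(1)] by blast
      ultimately show "D (\<phi> A) \<in> X (?n + 1 - card A) \<and> v \<in> D (\<phi> A)" using t(2) by auto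
    next
      fix A B assume A: "A \<subseteq> C" "A \<noteq> {}" and B: "B \<subseteq> C" "B \<noteq> {}"
      show "D (\<phi> A) \<subseteq> D (\<phi> B) \<longleftrightarrow> B \<subseteq> A" using D(2)[OF C(3)[OF B] C(3)[OF A]] C(4)[OF B(1) A(1)] by simp
    next
      fix d j assume d: "d \<in> X j" "v \<in> d"
      \<comment> \<open>\<open>D\<close> is controlled only for dimensions up to n. The dimension j
        cannot exceed n, since the model ball of d lies in \<open>real ^ 'n\<close>.\<close>
      then obtain V :: "(real ^ 'n) set" where "dim V = j"
        using emb unfolding embedded_cell_complex_def by blast
      then have j: "j \<le> ?n" using dim_subset_UNIV[of V] by simp
      then have "d \<in> D ` T (?n - j)" using D(1)[of "?n - j"] d by (auto simp: bij_betw_def)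
      then obtain s where s: "s \<in> T (?n - j)" "d = D s" by blast
      have "s \<subseteq> t" using D(2)[OF s(1) t(1)] s(2) t(2) d(2) by simp
      then obtain A where A: "A \<subseteq> C" "A \<noteq> {}" "s = \<phi> A" using C(5)[OF s(1)] by blast
      then have "card A - 1 = ?n - j" using simplex_dim_unique[OF C(3)[OF A(1,2)]] s(1) by blast
      then have "card A + j = ?n + 1" using cardA[OF A(1,2)] j by simp
      then show "\<exists>A\<subseteq>C. A \<noteq> {} \<and> card A + j = ?n + 1 \<and> d = D (\<phi> A)" using A s by blast
    qed
  qed
qed

text \<open>Regions at v are dual to single vertices of the simplex dual to v, and those containing
  \<open>\<psi> A\<close> are the ones whose vertex belongs to \<open>A\<close>. So the number
  sought is the size of \<open>A\<close>.\<close>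

lemma cpx_regions:
  fixes M :: "'a::topological_space set"
  assumes cpx: "cpx TYPE('n::finite) M X" and v: "{v} \<in> X 0" and d: "d \<in> X j" "v \<in> d"
  shows "card (regions_at CARD('n) X d) + j = CARD('n) + 1"
proof -
  let ?n = "CARD('n)"
  show ?thesis
  proof (rule cpx_vertex_star[OF cpx v])
    fix C :: "(real ^ 'n) set" and \<psi> assume C: "finite C" "card C = ?n + 1"
      "\<And>A. A \<subseteq> C \<Longrightarrow> A \<noteq> {} \<Longrightarrow> \<psi> A \<in> X (?n + 1 - card A) \<and> v \<in> \<psi> A"
      "\<And>A B. A \<subseteq> C \<Longrightarrow> B \<subseteq> C \<Longrightarrow> A \<noteq> {} \<Longrightarrow> B \<noteq> {} \<Longrightarrow> \<psi> A \<subseteq> \<psi> B \<longleftrightarrow> B \<subseteq> A"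
      "\<And>d j. d \<in> X j \<Longrightarrow> v \<in> d \<Longrightarrow> \<exists>A\<subseteq>C. A \<noteq> {} \<and> card A + j = ?n + 1 \<and> d = \<psi> A"
    obtain A where A: "A \<subseteq> C" "A \<noteq> {}" "card A + j = ?n + 1" "d = \<psi> A" using C(5) d by blast
    have "regions_at ?n X d = (\<lambda>a. \<psi> {a}) ` A"
    proof
      show "(\<lambda>a. \<psi> {a}) ` A \<subseteq> regions_at ?n X d"
        using A C(3)[of "{_}"] C(4)[of A "{_}"] by (auto simp: regions_at_def)
      show "regions_at ?n X d \<subseteq> (\<lambda>a. \<psi> {a}) ` A"
      proof
        fix R assume "R \<in> regions_at ?n X d"
        then have R: "R \<in> X ?n" "d \<subseteq> R" by (auto simp: regions_at_def)
        then obtain B where B: "B \<subseteq> C" "B \<noteq> {}" "card B + ?n = ?n + 1" "R = \<psi> B" using C(5)[of R ?n] d by blast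
        then obtain b where b: "B = {b}" by (metis add_right_cancel card_1_singletonE add.commute)
        then have "b \<in> A" using C(4)[OF A(1) B(1) A(2) B(2)] R(2) A(4) B(4) by simp
        then show "R \<in> (\<lambda>a. \<psi> {a}) ` A" using B b by blast
      qed
    qed
    moreover have "inj_on (\<lambda>a. \<psi> {a}) A"
      using A C(4)[of "{_}" "{_}"] by (intro inj_onI) blast
    ultimately show ?thesis using A by (simp add: card_image)
  qed
qed

text \<open>The 2-cell is dual to a face \<open>A\<close> that omits just two vertices a and b. Its
  edges at v are dual to the facets obtained by adding a or b, and these facets share exactly the
  vertices of \<open>A\<close>.\<close>

lemma cpx_two_edges:
  fixes M :: "'a::topological_space set"
  assumes cpx: "cpx TYPE('n::finite) M X" and v: "{v} \<in> X 0" and c: "c \<in> X 2" "v \<in> c"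
  obtains e1 e2 where "e1 \<noteq> e2" "{e \<in> X 1. e \<subseteq> c \<and> v \<in> e} = {e1, e2}"
    "regions_at CARD('n) X e1 \<inter> regions_at CARD('n) X e2 = regions_at CARD('n) X c"
proof -
  let ?n = "CARD('n)"
  show thesis
  proof (rule cpx_vertex_star[OF cpx v])
    fix C :: "(real ^ 'n) set" and \<psi> assume C: "finite C" "card C = ?n + 1"
      "\<And>A. A \<subseteq> C \<Longrightarrow> A \<noteq> {} \<Longrightarrow> \<psi> A \<in> X (?n + 1 - card A) \<and> v \<in> \<psi> A"
      "\<And>A B. A \<subseteq> C \<Longrightarrow> B \<subseteq> C \<Longrightarrow> A \<noteq> {} \<Longrightarrow> B \<noteq> {} \<Longrightarrow> \<psi> A \<subseteq> \<psi> B \<longleftrightarrow> B \<subseteq> A"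
      "\<And>d j. d \<in> X j \<Longrightarrow> v \<in> d \<Longrightarrow> \<exists>A\<subseteq>C. A \<noteq> {} \<and> card A + j = ?n + 1 \<and> d = \<psi> A"
    obtain A where A: "A \<subseteq> C" "A \<noteq> {}" "card A + 2 = ?n + 1" "c = \<psi> A" using C(5) c by blast
    have "finite A" using A(1) C(1) finite_subset by blast
    have "card (C - A) = 2" using A C(1,2) by (simp add: card_Diff_subset \<open>finite A\<close>)
    then obtain a b where ab: "C - A = {a, b}" "a \<noteq> b" by (meson card_2_iff)
    then have abC: "a \<in> C" "b \<in> C" "a \<notin> A" "b \<notin> A" "C = insert a (insert b A)" using A(1) by auto
    have ins: "insert x A \<subseteq> C \<and> insert x A \<noteq> {} \<and> card (insert x A) = ?n" if "x \<in> {a, b}" for x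
      using that abC A \<open>finite A\<close> by auto
    have ne: "\<psi> (insert a A) \<noteq> \<psi> (insert b A)"
      using C(4)[of "insert a A" "insert b A"] ins[of a] ins[of b] abC ab(2) by auto
    have edges: "{e \<in> X 1. e \<subseteq> c \<and> v \<in> e} = {\<psi> (insert a A), \<psi> (insert b A)}"
    proof
      show "{\<psi> (insert a A), \<psi> (insert b A)} \<subseteq> {e \<in> X 1. e \<subseteq> c \<and> v \<in> e}"
        using C(3)[of "insert a A"] C(3)[of "insert b A"] C(4)[of "insert _ A" A] ins[of a] ins[of b] A by auto
      show "{e \<in> X 1. e \<subseteq> c \<and> v \<in> e} \<subseteq> {\<psi> (insert a A), \<psi> (insert b A)}"
      proof
        fix e assume "e \<in> {e \<in> X 1. e \<subseteq> c \<and> v \<in> e}"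
        then have e: "e \<in> X 1" "e \<subseteq> c" "v \<in> e" by auto
        then obtain B where B: "B \<subseteq> C" "B \<noteq> {}" "card B + 1 = ?n + 1" "e = \<psi> B" using C(5)[of e 1] by blast
        then have "A \<subseteq> B" using C(4)[OF B(1) A(1) B(2) A(2)] e(2) A(4) by simp
        then have "card (B - A) = 1" using A(3) B(3) \<open>finite A\<close> by (simp add: card_Diff_subset)
        then obtain x where x: "B - A = {x}" by (meson card_1_singletonE)
        then have "x \<in> {a, b}" "B = insert x A" using B(1) ab(1) \<open>A \<subseteq> B\<close> by auto
        then show "e \<in> {\<psi> (insert a A), \<psi> (insert b A)}" using B(4) by auto
      qed
    qed
    have "regions_at ?n X (\<psi> (insert a A)) \<inter> regions_at ?n X (\<psi> (insert b A)) = regions_at ?n X c"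
    proof
      have "\<psi> (insert a A) \<subseteq> c" "\<psi> (insert b A) \<subseteq> c" using edges by auto
      then show "regions_at ?n X c \<subseteq> regions_at ?n X (\<psi> (insert a A)) \<inter> regions_at ?n X (\<psi> (insert b A))"
        by (auto simp: regions_at_def)
      show "regions_at ?n X (\<psi> (insert a A)) \<inter> regions_at ?n X (\<psi> (insert b A)) \<subseteq> regions_at ?n X c"
      proof
        fix R assume "R \<in> regions_at ?n X (\<psi> (insert a A)) \<inter> regions_at ?n X (\<psi> (insert b A))"
        then have R: "R \<in> X ?n" "\<psi> (insert a A) \<subseteq> R" "\<psi> (insert b A) \<subseteq> R" by (auto simp: regions_at_def)
        have "v \<in> R" using R(2) C(3)[of "insert a A"] ins[of a] by auto
        then obtain B where B: "B \<subseteq> C" "B \<noteq> {}" "R = \<psi> B" using C(5)[of R ?n] R(1) by blast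
        then have "B \<subseteq> insert a A" "B \<subseteq> insert b A" using C(4)[OF _ B(1) _ B(2)] R ins[of a] ins[of b] by auto
        then have "B \<subseteq> A" using ab(2) abC by auto
        then show "R \<in> regions_at ?n X c" using C(4)[OF A(1) B(1) A(2) B(2)] R(1) A(4) B(3) by (simp add: regions_at_def)
      qed
    qed
    then show thesis using that[OF ne edges] by blast
  qed
qed

section \<open>Coherent colorings\<close>

locale cpx_complex =
  fixes N :: "'n::finite itself" and M :: "'a::topological_space set" and X :: "nat \<Rightarrow> 'a set set"
    and n :: nat
  assumes n_eq: "n = CARD('n)" and hausdorff_cpx: "Hausdorff_space (top_of_set M)" and cpx: "cpx TYPE('n) M X"

sublocale cpx_complex \<subseteq> cell_complex "TYPE('n)" M X
  using hausdorff_cpx cpx by unfold_locales (auto simp: cpx_def)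

context cpx_complex begin

abbreviation "R \<equiv> regions_at n X"

lemma card_regions: "v \<in> vertices d \<Longrightarrow> d \<in> X j \<Longrightarrow> card (R d) + j = n + 1"
  using cpx_regions[OF cpx] by (auto simp: vertices_def n_eq)

lemma finite_regions: "finite (R d)"
proof -
  have "R d \<subseteq> (\<Union>k. X k)" by (auto simp: regions_at_def)
  then show ?thesis using finite_cells finite_subset by blast
qed

lemma regions_antimono: "c \<subseteq> d \<Longrightarrow> R d \<subseteq> R c"
  by (auto simp: regions_at_def)

text \<open>Counting: n + 1 regions meet at v and n of them along e.\<close>

lemma regions_edge:
  assumes "e \<in> X 1" "v \<in> vertices e"
  obtains r where "r \<notin> R e" "R {v} = insert r (R e)"
proof -
  have v: "{v} \<in> X 0" "v \<in> e" using assms by (auto simp: vertices_def)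
  have "card (R e) + 1 = n + 1" using card_regions assms by blast
  moreover have "card (R {v}) + 0 = n + 1" using card_regions[of v "{v}" 0] v by (simp add: vertices_vertex)
  moreover have sub: "R e \<subseteq> R {v}" using v by (intro regions_antimono) auto
  ultimately have "card (R {v} - R e) = 1" by (simp add: card_Diff_subset finite_regions)
  then obtain r where "R {v} - R e = {r}" by (meson card_1_singletonE)
  then show thesis using that sub by blast
qed

text \<open>Extensional because \<open>edge_transport\<close> returns a function restricted to the
  regions at the new vertex; equality of colorings is then equality of functions.\<close>

definition colorings :: "'a \<Rightarrow> ('a set \<Rightarrow> nat) set" where
  "colorings v = {f \<in> extensional (R {v}). bij_betw f (R {v}) {1..n+1}}"

text \<open>A coloring at u is determined by its values on \<open>R e\<close>: the one remaining
  region must take the one remaining color. Later computations of transport rest on this rule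
  instead of the \<open>THE\<close> in \<open>edge_transport\<close>.\<close>

lemma edge_transport_eqI:
  assumes e: "e \<in> X 1" "u \<in> vertices e" and g: "g \<in> colorings u" and agree: "\<And>r. r \<in> R e \<Longrightarrow> g r = f r"
  shows "edge_transport n X (e, u) f = g"
proof
  fix r
  have u: "u \<in> e" using e by (simp add: vertices_def)
  have g': "g \<in> extensional (R {u})" "inj_on g (R {u})" "g ` R {u} = {1..n+1}"
    using g by (auto simp: colorings_def bij_betw_def)
  show "edge_transport n X (e, u) f r = g r"
  proof (cases "r \<in> R {u}")
    case False
    then show ?thesis using g'(1) by (simp add: edge_transport_def extensional_def)
  next
    case True
    show ?thesis
    proof (cases "e \<subseteq> r")
      case True
      then have "r \<in> R e" using \<open>r \<in> R {u}\<close> by (auto simp: regions_at_def)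
      then show ?thesis using \<open>r \<in> R {u}\<close> \<open>e \<subseteq> r\<close> agree by (simp add: edge_transport_def)
    next
      case False
      then have "r \<notin> R e" by (auto simp: regions_at_def)
      then have ins: "R {u} = insert r (R e)" using regions_edge[OF e] True by (metis insert_iff)
      have im: "f ` R e = g ` R e" using agree by force
      have "(THE i. i \<in> {1..n+1} \<and> i \<notin> f ` R e) = g r"
      proof (rule the_equality)
        show "g r \<in> {1..n+1} \<and> g r \<notin> f ` R e"
          using g'(2,3) ins \<open>r \<notin> R e\<close> unfolding im by auto
        fix i assume i: "i \<in> {1..n+1} \<and> i \<notin> f ` R e"
        then have "i \<in> g ` insert r (R e)" using g'(3) ins by simp
        then show "i = g r" using i im by auto
      qed
      then show ?thesis using True False by (simp add: edge_transport_def)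
    qed
  qed
qed

text \<open>The region r entered at u inherits the color of the region r' left behind at v.\<close>

lemma edge_transport_coloring:
  assumes e: "e \<in> X 1" "u \<in> vertices e" "v \<in> vertices e" and f: "f \<in> colorings v"
  shows "edge_transport n X (e, u) f \<in> colorings u" "\<And>r. r \<in> R e \<Longrightarrow> edge_transport n X (e, u) f r = f r"
proof -
  obtain r where r: "r \<notin> R e" "R {u} = insert r (R e)" using regions_edge[OF e(1,2)] by blast
  obtain r' where r': "r' \<notin> R e" "R {v} = insert r' (R e)" using regions_edge[OF e(1,3)] by blast
  define g where "g = (\<lambda>s\<in>R {u}. if s = r then f r' else f s)"
  have f': "inj_on f (insert r' (R e))" "f ` insert r' (R e) = {1..n+1}"
    using f r' by (auto simp: colorings_def bij_betw_def)
  have agree: "g s = f s" if "s \<in> R e" for s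
    using that r by (auto simp: g_def)
  have gr: "g r = f r'" using r by (simp add: g_def)
  have im: "g ` R e = f ` R e" using agree by (intro image_cong) auto
  have "inj_on g (R e)" using f'(1) agree by (metis (no_types, lifting) inj_on_cong inj_on_insert)
  moreover have "g r \<notin> g ` R e" using f'(1) r'(1) im gr by auto
  ultimately have "inj_on g (R {u})" using r by simp
  moreover have "g ` R {u} = {1..n+1}" using r(2) im gr f'(2) by simp
  moreover have "g \<in> extensional (R {u})" by (simp add: g_def)
  ultimately have "g \<in> colorings u" by (simp add: colorings_def bij_betw_def)
  then have "edge_transport n X (e, u) f = g" using agree by (intro edge_transport_eqI[OF e(1,2)])
  then show "edge_transport n X (e, u) f \<in> colorings u" "\<And>r. r \<in> R e \<Longrightarrow> edge_transport n X (e, u) f r = f r"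
    using \<open>g \<in> colorings u\<close> agree by auto
qed

lemma transport_Cons: "transport n X (s # es) f = transport n X es (edge_transport n X s f)"
  by (simp add: transport_def)

lemma transport_append: "transport n X (es @ es') f = transport n X es' (transport n X es f)"
  by (simp add: transport_def)

lemma transport_coloring:
  "edge_path X v es w \<Longrightarrow> f \<in> colorings v \<Longrightarrow> transport n X es f \<in> colorings w"
proof (induction es arbitrary: v f)
  case Nil
  then show ?case by (simp add: transport_def)
next
  case (Cons s es)
  obtain e u where s: "s = (e, u)" by (cases s)
  note * = edge_path_Cons_D[OF Cons.prems(1)[unfolded s]]
  show ?case
    unfolding s transport_Cons
    by (rule Cons.IH[OF *(5) edge_transport_coloring(1)[OF *(1,3,2) Cons.prems(2)]])
qed

lemma permuted_coloring:
  assumes "f \<in> colorings v" "\<sigma> permutes {1..n+1}"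
  shows "restrict (\<sigma> \<circ> f) (R {v}) \<in> colorings v"
proof -
  have "bij_betw (\<sigma> \<circ> f) (R {v}) {1..n+1}"
    using assms permutes_imp_bij by (auto simp: colorings_def intro: bij_betw_trans)
  then show ?thesis by (simp add: colorings_def)
qed

text \<open>Agreement along an edge is preserved when both colorings are permuted alike. This fixes
  the order of composition for holonomy.\<close>

lemma transport_permuted:
  "edge_path X v es w \<Longrightarrow> f \<in> colorings v \<Longrightarrow> \<sigma> permutes {1..n+1} \<Longrightarrow>
    transport n X es (restrict (\<sigma> \<circ> f) (R {v})) = restrict (\<sigma> \<circ> transport n X es f) (R {w})"
proof (induction es arbitrary: v f)
  case Nil
  then show ?case by (simp add: transport_def)
next
  case (Cons s es)
  obtain e u where s: "s = (e, u)" by (cases s)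
  note * = edge_path_Cons_D[OF Cons.prems(1)[unfolded s]]
  let ?g = "edge_transport n X (e, u) f"
  note g = edge_transport_coloring[OF *(1,3,2) Cons.prems(2)]
  have "R e \<subseteq> R {u}" "R e \<subseteq> R {v}" using *(2,3) by (auto simp: vertices_def intro!: regions_antimono)
  then have "edge_transport n X (e, u) (restrict (\<sigma> \<circ> f) (R {v})) = restrict (\<sigma> \<circ> ?g) (R {u})"
    using g Cons.prems(3) by (intro edge_transport_eqI[OF *(1,3)] permuted_coloring) auto
  then show ?case
    unfolding s transport_Cons using Cons.IH[OF *(5) g(1) Cons.prems(3)] by (simp only:)
qed

text \<open>Agreement on \<open>R e\<close> amounts to transport along e, by
  \<open>edge_transport_eqI\<close>, but treats both ends of the edge alike. The values of
  \<open>f\<close> away from the vertices of the cell are arbitrary.\<close>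

definition coherent :: "'a set \<Rightarrow> ('a \<Rightarrow> 'a set \<Rightarrow> nat) \<Rightarrow> bool" where
  "coherent c f \<longleftrightarrow> (\<forall>v\<in>vertices c. f v \<in> colorings v) \<and>
     (\<forall>e\<in>X 1. e \<subseteq> c \<longrightarrow> (\<forall>u\<in>vertices e. \<forall>v\<in>vertices e. \<forall>r\<in>R e. f u r = f v r))"

text \<open>The existence half of the covering property; uniqueness is
  \<open>coherent_unique\<close> and holds for every cell.\<close>

definition extendable :: "'a set \<Rightarrow> bool" where
  "extendable c \<longleftrightarrow> (\<forall>v\<in>vertices c. \<forall>w\<in>colorings v. \<exists>f. coherent c f \<and> f v = w)"

lemma coherent_mono: "coherent d f \<Longrightarrow> c \<subseteq> d \<Longrightarrow> coherent c f"
  unfolding coherent_def using vertices_mono[of c d] by blast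

lemma coherent_transport:
  "edge_path X v es w \<Longrightarrow> v \<in> vertices c \<Longrightarrow> \<Union>(fst ` set es) \<subseteq> c \<Longrightarrow> coherent c f \<Longrightarrow>
    transport n X es (f v) = f w"
proof (induction es arbitrary: v)
  case Nil
  then show ?case by (simp add: transport_def)
next
  case (Cons s es)
  obtain e u where s: "s = (e, u)" by (cases s)
  note * = edge_path_Cons_D[OF Cons.prems(1)[unfolded s]]
  have ec: "e \<subseteq> c" "\<Union>(fst ` set es) \<subseteq> c" using Cons.prems(3) s by auto
  have u: "u \<in> vertices c" using *(3) ec vertices_mono by blast
  have "edge_transport n X (e, u) (f v) = f u"
  proof (rule edge_transport_eqI[OF *(1,3)])
    show "f u \<in> colorings u" "\<And>r. r \<in> R e \<Longrightarrow> f u r = f v r"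
      using Cons.prems(4) u *(1-3) ec unfolding coherent_def by blast+
  qed
  then show ?case
    unfolding s transport_Cons using Cons.IH[OF *(5) u ec(2) Cons.prems(4)] by simp
qed

text \<open>Any two vertices of c are joined by an edge path in c, along which a coherent coloring
  is its own transport.\<close>

lemma coherent_unique:
  assumes "c \<in> X k" "coherent c f" "coherent c g" "v \<in> vertices c" "f v = g v" "u \<in> vertices c"
  shows "f u = g u"
proof -
  obtain es where "edge_path X v es u" "\<Union>(fst ` set es) \<subseteq> c"
    using cell_edge_connected[OF assms(1,4,6)] by blast
  then show ?thesis using coherent_transport assms by metis
qed

lemma coherent_vertex: "{v} \<in> X 0 \<Longrightarrow> w \<in> colorings v \<Longrightarrow> coherent {v} (\<lambda>_. w)"
  using edge_not_singleton by (auto simp: coherent_def vertices_vertex subset_singleton_iff vertices_def dest: vertices_nonempty)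

lemma extendable_vertex:
  assumes "c \<in> X 0"
  shows "extendable c"
  using assms coherent_vertex unfolding extendable_def
  by (metis singletonD vertices_vertex zero_cell_singleton)

text \<open>If the edges differed, no point of e could have both as carrier, so every point of e
  would be one of the two vertices of e'; but an arc is infinite.\<close>

lemma edge_subset_edge:
  assumes "e \<in> X 1" "e' \<in> X 1" "e \<subseteq> e'"
  shows "e = e'"
proof (rule ccontr)
  assume "e \<noteq> e'"
  have "e \<subseteq> vertices e'"
  proof
    fix x assume x: "x \<in> e"
    then have "x \<in> e'" using assms by blast
    then have "{x} \<in> X 0" using carrier_cell_edge[OF assms(1) x] carrier_cell_edge[OF assms(2)] \<open>e \<noteq> e'\<close> by auto
    then show "x \<in> vertices e'" using \<open>x \<in> e'\<close> by (simp add: vertices_def)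
  qed
  moreover obtain p where p: "arc p" "path_image p = e" using edge_obtain_arc[OF assms(1)] by metis
  moreover have "finite (vertices e')" using edge_obtain_arc[OF assms(2)] by (metis finite.emptyI finite_insert)
  ultimately have "finite (p ` {0..1})" using finite_subset by (auto simp: path_image_def)
  then have "finite {0..1::real}" using p(1) finite_imageD by (auto simp: arc_def)
  then show False by (simp add: infinite_Icc)
qed

lemma extendable_edge:
  assumes e: "e \<in> X 1"
  shows "extendable e"
  unfolding extendable_def
proof (intro ballI)
  fix v w assume v: "v \<in> vertices e" and w: "w \<in> colorings v"
  define f where "f u = (if u = v then w else edge_transport n X (e, u) w)" for u
  have "f u \<in> colorings u" "\<And>r. r \<in> R e \<Longrightarrow> f u r = w r" if "u \<in> vertices e" for u
    using edge_transport_coloring[OF e that v w] w by (auto simp: f_def)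
  then have "coherent e f"
    unfolding coherent_def using edge_subset_edge[OF _ e] by metis
  then show "\<exists>f. coherent e f \<and> f v = w" by (intro exI[of _ f]) (simp add: f_def)
qed

lemma coherent_extend:
  assumes "c \<in> X j" "d \<in> X k" "c \<subseteq> d" "extendable d" "coherent c f"
  obtains g where "coherent d g" "\<And>u. u \<in> vertices c \<Longrightarrow> g u = f u"
proof -
  obtain v where v: "v \<in> vertices c" using vertices_nonempty assms by blast
  then have "v \<in> vertices d" "f v \<in> colorings v" using assms vertices_mono by (auto simp: coherent_def)
  then obtain g where g: "coherent d g" "g v = f v" using assms(4) by (auto simp: extendable_def)
  then have "g u = f u" if "u \<in> vertices c" for u
    using coherent_unique[OF assms(1) coherent_mono[OF g(1) assms(3)] assms(5) v g(2) that] by simp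
  then show thesis using that g by blast
qed

end

section \<open>Transport of coherent colorings\<close>

context cpx_complex begin

text \<open>\<open>s y\<close> is a coherent coloring of the carrier of \<open>g y\<close>; only its values at the vertices of that carrier
  matter.  Coherent colorings restrict to faces, and carriers grow near \<open>y\<close>, so local constancy means that
  \<open>s y\<close> is the restriction of all nearby values.\<close>

definition section_over :: "'b::topological_space set \<Rightarrow> ('b \<Rightarrow> 'a) \<Rightarrow> ('b \<Rightarrow> 'a \<Rightarrow> 'a set \<Rightarrow> nat) \<Rightarrow> bool" where
  "section_over Y g s \<longleftrightarrow> (\<forall>y\<in>Y. coherent (carrier_cell (g y)) (s y) \<and>
     (\<exists>W. open W \<and> y \<in> W \<and> (\<forall>z\<in>Y \<inter> W. carrier_cell (g y) \<subseteq> carrier_cell (g z) \<and>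
        (\<forall>u\<in>vertices (carrier_cell (g y)). s z u = s y u))))"

lemma section_over_nbhd:
  assumes "section_over Y g s" "y \<in> Y"
  shows "\<exists>W. open W \<and> y \<in> W \<and> (\<forall>z\<in>Y \<inter> W. carrier_cell (g y) \<subseteq> carrier_cell (g z) \<and>
    (\<forall>u\<in>vertices (carrier_cell (g y)). s z u = s y u))"
  using assms unfolding section_over_def by blast

lemma section_over_coherent:
  "section_over Y g s \<Longrightarrow> y \<in> Y \<Longrightarrow> coherent (carrier_cell (g y)) (s y)"
  unfolding section_over_def by blast

lemma section_over_compose:
  assumes s: "section_over Y g s" and j: "continuous_on Z j" "j ` Z \<subseteq> Y" and g': "\<And>z. z \<in> Z \<Longrightarrow> g' z = g (j z)"
  shows "section_over Z g' (s \<circ> j)"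
  unfolding section_over_def
proof
  fix z assume z: "z \<in> Z"
  then have jz: "j z \<in> Y" using j by blast
  obtain W where W0: "open W \<and> (j z) \<in> W \<and> (\<forall>zz\<in>Y \<inter> W. carrier_cell (g (j z)) \<subseteq> carrier_cell (g zz) \<and>
      (\<forall>u\<in>vertices (carrier_cell (g (j z))). s zz u = s (j z) u))"
    using section_over_nbhd[OF s jz] by (rule exE)
  have W: "open W" "j z \<in> W" "\<And>y. y \<in> Y \<Longrightarrow> y \<in> W \<Longrightarrow> carrier_cell (g (j z)) \<subseteq> carrier_cell (g y)"
    "\<And>y u. y \<in> Y \<Longrightarrow> y \<in> W \<Longrightarrow> u \<in> vertices (carrier_cell (g (j z))) \<Longrightarrow> s y u = s (j z) u"
    using W0 by simp_all
  obtain V where V: "open V" "z \<in> V" "\<forall>y\<in>Z. y \<in> V \<longrightarrow> j y \<in> W"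
    using j(1) z W(1,2) unfolding continuous_on_topological by blast
  have "carrier_cell (g' z) \<subseteq> carrier_cell (g' y) \<and> (\<forall>u\<in>vertices (carrier_cell (g' z)). (s \<circ> j) y u = (s \<circ> j) z u)"
    if "y \<in> Z \<inter> V" for y
    using that V(3) W(3,4)[of "j y"] j(2) g' z by auto
  moreover have "coherent (carrier_cell (g' z)) ((s \<circ> j) z)"
    using section_over_coherent[OF s jz] g' z by simp
  ultimately show "coherent (carrier_cell (g' z)) ((s \<circ> j) z) \<and>
     (\<exists>W. open W \<and> z \<in> W \<and> (\<forall>y\<in>Z \<inter> W. carrier_cell (g' z) \<subseteq> carrier_cell (g' y) \<and>
        (\<forall>u\<in>vertices (carrier_cell (g' z)). (s \<circ> j) y u = (s \<circ> j) z u)))"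
    using V(1,2) by blast
qed

lemma section_over_subset: "section_over Y g s \<Longrightarrow> Z \<subseteq> Y \<Longrightarrow> section_over Z g s"
  using section_over_compose[of Y g s Z "\<lambda>x. x" g] by (simp add: o_def)

text \<open>By \<open>coherent_unique\<close>, agreement at one vertex of a carrier spreads over
  that carrier. Near a point both sections keep their values at a vertex of its carrier, so
  agreement is locally constant on the connected \<open>Y\<close>.\<close>

lemma section_over_unique:
  assumes Y: "connected Y" "g ` Y \<subseteq> M" and s: "section_over Y g s" and s': "section_over Y g s'"
    and y: "y \<in> Y" "u \<in> vertices (carrier_cell (g y))" "s y u = s' y u"
    and z: "z \<in> Y" "w \<in> vertices (carrier_cell (g z))"
  shows "s z w = s' z w"
proof -
  define P where "P y \<longleftrightarrow> (\<forall>u\<in>vertices (carrier_cell (g y)). s y u = s' y u)" for y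
  have P1: "P y" if "y \<in> Y" "u \<in> vertices (carrier_cell (g y))" "s y u = s' y u" for y u
  proof -
    have "g y \<in> M" using Y(2) that(1) by blast
    then obtain k where k: "carrier_cell (g y) \<in> X k" using carrier_cell_obtain by blast
    note coh = section_over_coherent[OF s that(1)] section_over_coherent[OF s' that(1)]
    show ?thesis
      unfolding P_def using coherent_unique[OF k coh that(2,3)] by simp
  qed
  have "P z"
  proof (rule connected_induction_simple[where P = P, OF Y(1) y(1) z(1) P1[OF y]])
    fix a assume a: "a \<in> Y"
    obtain W where W0: "open W \<and> a \<in> W \<and> (\<forall>zz\<in>Y \<inter> W. carrier_cell (g a) \<subseteq> carrier_cell (g zz) \<and>
        (\<forall>u\<in>vertices (carrier_cell (g a)). s zz u = s a u))"
      using section_over_nbhd[OF s a] by blast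
    have W: "open W" "a \<in> W" "\<And>z. z \<in> Y \<Longrightarrow> z \<in> W \<Longrightarrow> carrier_cell (g a) \<subseteq> carrier_cell (g z)"
      "\<And>z u. z \<in> Y \<Longrightarrow> z \<in> W \<Longrightarrow> u \<in> vertices (carrier_cell (g a)) \<Longrightarrow> s z u = s a u"
      using W0 by simp_all
    obtain W' where W'0: "open W' \<and> a \<in> W' \<and> (\<forall>zz\<in>Y \<inter> W'. carrier_cell (g a) \<subseteq> carrier_cell (g zz) \<and>
        (\<forall>u\<in>vertices (carrier_cell (g a)). s' zz u = s' a u))"
      using section_over_nbhd[OF s' a] by blast
    have W': "open W'" "a \<in> W'"
      "\<And>z u. z \<in> Y \<Longrightarrow> z \<in> W' \<Longrightarrow> u \<in> vertices (carrier_cell (g a)) \<Longrightarrow> s' z u = s' a u"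
      using W'0 by simp_all
    obtain k where "carrier_cell (g a) \<in> X k" using carrier_cell_obtain Y(2) a by blast
    then obtain v where v: "v \<in> vertices (carrier_cell (g a))" using vertices_nonempty by blast
    have Pa: "P x \<longleftrightarrow> P a" if x: "x \<in> Y \<inter> (W \<inter> W')" for x
    proof -
      have vx: "v \<in> vertices (carrier_cell (g x))" using W(3)[of x] x v vertices_mono by blast
      have "s x v = s a v" "s' x v = s' a v" using W(4) W'(3) x v by auto
      then show ?thesis using P1[OF _ vx] P1[OF a v] vx v x unfolding P_def by (metis IntD1)
    qed
    have "openin (top_of_set Y) (Y \<inter> (W \<inter> W'))" using W(1) W'(1) by (intro openin_open_Int open_Int)
    moreover have "a \<in> Y \<inter> (W \<inter> W')" using a W(2) W'(2) by simp
    moreover have "\<forall>x\<in>Y \<inter> (W \<inter> W'). \<forall>y\<in>Y \<inter> (W \<inter> W'). P x \<longrightarrow> P y"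
      using Pa by metis
    ultimately show "\<exists>T. openin (top_of_set Y) T \<and> a \<in> T \<and> (\<forall>x\<in>T. \<forall>y\<in>T. P x \<longrightarrow> P y)"
      by (intro exI conjI)
  qed
  then show ?thesis using z by (simp add: P_def)
qed

lemma carrier_cell_preimage_nbhd:
  assumes "continuous_on Y g" "g ` Y \<subseteq> M" "y \<in> Y"
  obtains W where "open W" "y \<in> W" "\<And>z. z \<in> Y \<Longrightarrow> z \<in> W \<Longrightarrow> carrier_cell (g y) \<subseteq> carrier_cell (g z)"
proof -
  have "g y \<in> M" using assms by blast
  obtain U where U: "openin (top_of_set M) U" "g y \<in> U" "\<And>x. x \<in> U \<Longrightarrow> carrier_cell (g y) \<subseteq> carrier_cell x"
    using carrier_cell_nbhd[OF \<open>g y \<in> M\<close>] by metis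
  then obtain G where G: "open G" "U = M \<inter> G" by (auto simp: openin_open)
  then obtain W where W: "open W" "y \<in> W" "\<forall>z\<in>Y. z \<in> W \<longrightarrow> g z \<in> G"
    using assms(1,3) U(2) unfolding continuous_on_topological by blast
  show thesis
    by (rule that[OF W(1,2)]) (use W(3) U(3) G assms(2) in blast)
qed

lemma section_over_const:
  assumes "continuous_on Y g" "c \<in> X k" "g ` Y \<subseteq> c" "coherent c f"
  shows "section_over Y g (\<lambda>_. f)"
  unfolding section_over_def
proof
  fix y assume y: "y \<in> Y"
  have "g ` Y \<subseteq> M" using assms cell_subset by blast
  obtain W where "open W" "y \<in> W" "\<And>z. z \<in> Y \<Longrightarrow> z \<in> W \<Longrightarrow> carrier_cell (g y) \<subseteq> carrier_cell (g z)"
    using carrier_cell_preimage_nbhd[OF assms(1) \<open>g ` Y \<subseteq> M\<close> y] by metis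
  moreover have "coherent (carrier_cell (g y)) f"
    using coherent_mono[OF assms(4)] carrier_cell_least(1)[OF assms(2)] assms(3) y by blast
  ultimately show "coherent (carrier_cell (g y)) f \<and>
     (\<exists>W. open W \<and> y \<in> W \<and> (\<forall>z\<in>Y \<inter> W. carrier_cell (g y) \<subseteq> carrier_cell (g z) \<and>
        (\<forall>u\<in>vertices (carrier_cell (g y)). f u = f u)))" by blast
qed

text \<open>The analogue of a trivial covering: through every value over every point there passes a
  section over all of \<open>Y\<close>. Free choice of the point is what permits gluing.\<close>

definition liftable :: "'b::topological_space set \<Rightarrow> ('b \<Rightarrow> 'a) \<Rightarrow> bool" where
  "liftable Y g \<longleftrightarrow> (\<forall>y\<in>Y. \<forall>f. coherent (carrier_cell (g y)) f \<longrightarrow>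
     (\<exists>s. section_over Y g s \<and> (\<forall>u\<in>vertices (carrier_cell (g y)). s y u = f u)))"

text \<open>Near y all carriers contain the carrier of y. A value over any point restricts to that
  common face and extends from it to the other carriers; a vertex v of the face lies in all of them
  and pins the extensions down, whence local constancy.\<close>

lemma liftable_local:
  assumes g: "continuous_on Y g" "g ` Y \<subseteq> M" and ext: "\<And>y. y \<in> Y \<Longrightarrow> extendable (carrier_cell (g y))"
    and y: "y \<in> Y"
  obtains W where "open W" "y \<in> W" "\<And>Z. Z \<subseteq> Y \<inter> W \<Longrightarrow> liftable Z g"
proof -
  let ?c = "carrier_cell (g y)"
  obtain W where W: "open W" "y \<in> W" "\<And>z. z \<in> Y \<Longrightarrow> z \<in> W \<Longrightarrow> ?c \<subseteq> carrier_cell (g z)"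
    using carrier_cell_preimage_nbhd[OF g y] by metis
  obtain k where k: "?c \<in> X k" using carrier_cell_obtain g(2) y by blast
  obtain v where v: "v \<in> vertices ?c" using vertices_nonempty[OF k] by blast
  have "liftable Z g" if Z: "Z \<subseteq> Y \<inter> W" for Z
    unfolding liftable_def
  proof (intro ballI allI impI)
    fix z f assume z: "z \<in> Z" and f: "coherent (carrier_cell (g z)) f"
    have fc: "coherent ?c f" using coherent_mono[OF f] W(3) z Z by blast
    have "\<exists>h. coherent (carrier_cell (g x)) h \<and> h v = f v" if x: "x \<in> Z" for x
    proof -
      have xY: "x \<in> Y" "x \<in> W" using x Z by auto
      obtain j where j: "carrier_cell (g x) \<in> X j" using carrier_cell_obtain g(2) xY by blast
      show ?thesis
        using coherent_extend[OF k j W(3)[OF xY] ext[OF xY(1)] fc] v by metis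
    qed
    then obtain s where s: "\<And>x. x \<in> Z \<Longrightarrow> coherent (carrier_cell (g x)) (s x)" "\<And>x. x \<in> Z \<Longrightarrow> s x v = f v"
      by metis
    have vx: "v \<in> vertices (carrier_cell (g x))" if "x \<in> Z" for x using W(3) that Z v vertices_mono by blast
    have "section_over Z g s"
      unfolding section_over_def
    proof
      fix x assume x: "x \<in> Z"
      then have xY: "x \<in> Y" using Z by blast
      obtain W' where W': "open W'" "x \<in> W'" "\<And>z. z \<in> Y \<Longrightarrow> z \<in> W' \<Longrightarrow> carrier_cell (g x) \<subseteq> carrier_cell (g z)"
        using carrier_cell_preimage_nbhd[OF g xY] by metis
      obtain j where j: "carrier_cell (g x) \<in> X j" using carrier_cell_obtain g(2) xY by blast
      have "s x' u = s x u" if x': "x' \<in> Z" "x' \<in> W'" and u: "u \<in> vertices (carrier_cell (g x))" for x' u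
      proof -
        have "carrier_cell (g x) \<subseteq> carrier_cell (g x')" using W'(3) x' Z by blast
        then show ?thesis
          using coherent_unique[OF j coherent_mono[OF s(1)[OF x'(1)]] s(1)[OF x] vx[OF x] _ u] s(2) x x' by metis
      qed
      then show "coherent (carrier_cell (g x)) (s x) \<and>
        (\<exists>W. open W \<and> x \<in> W \<and> (\<forall>z\<in>Z \<inter> W. carrier_cell (g x) \<subseteq> carrier_cell (g z) \<and>
          (\<forall>u\<in>vertices (carrier_cell (g x)). s z u = s x u)))"
        using s(1)[OF x] W' Z by blast
    qed
    moreover have "s z u = f u" if u: "u \<in> vertices (carrier_cell (g z))" for u
    proof -
      obtain j where j: "carrier_cell (g z) \<in> X j" using carrier_cell_obtain g(2) z Z by blast
      show ?thesis using coherent_unique[OF j s(1)[OF z] f vx[OF z] s(2)[OF z] u] .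
    qed
    ultimately show "\<exists>s. section_over Z g s \<and> (\<forall>u\<in>vertices (carrier_cell (g z)). s z u = f u)" by blast
  qed
  then show thesis using that W by blast
qed

text \<open>The section over \<open>B\<close> is started from the value of the first section at a
  point of the overlap. Connectedness of the overlap makes the two agree on all of it, and
  closedness of \<open>A\<close> and \<open>B\<close> makes the union locally constant.\<close>

lemma liftable_glue_aux:
  assumes A: "liftable A g" and B: "liftable B g" and clo: "closed A" "closed B"
    and AB: "connected (A \<inter> B)" "A \<inter> B \<noteq> {}" and g: "g ` (A \<union> B) \<subseteq> M"
    and y: "y \<in> A" and f: "coherent (carrier_cell (g y)) f"
  shows "\<exists>s. section_over (A \<union> B) g s \<and> (\<forall>u\<in>vertices (carrier_cell (g y)). s y u = f u)"
proof -
  obtain s1 where s1: "section_over A g s1" "\<forall>u\<in>vertices (carrier_cell (g y)). s1 y u = f u"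
    using A y f unfolding liftable_def by blast
  obtain p where p: "p \<in> A" "p \<in> B" using AB by blast
  obtain s2 where s2: "section_over B g s2" "\<forall>u\<in>vertices (carrier_cell (g p)). s2 p u = s1 p u"
    using B p section_over_coherent[OF s1(1) p(1)] unfolding liftable_def by blast
  obtain k where "carrier_cell (g p) \<in> X k" using carrier_cell_obtain g p by blast
  then obtain v where v: "v \<in> vertices (carrier_cell (g p))" using vertices_nonempty by blast
  have agree: "s1 z u = s2 z u" if "z \<in> A" "z \<in> B" "u \<in> vertices (carrier_cell (g z))" for z u
  proof (rule section_over_unique[OF AB(1)])
    show "section_over (A \<inter> B) g s1" "section_over (A \<inter> B) g s2"
      using section_over_subset s1(1) s2(1) by blast+
    show "s1 p v = s2 p v" using s2(2) v by simp
  qed (use g p v that in auto)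
  define s where "s z = (if z \<in> A then s1 z else s2 z)" for z
  have sB: "s z u = s2 z u" if "z \<in> B" "u \<in> vertices (carrier_cell (g z))" for z u
    using agree that by (auto simp: s_def)
  have "section_over (A \<union> B) g s"
    unfolding section_over_def
  proof
    fix z assume z: "z \<in> A \<union> B"
    let ?V = "vertices (carrier_cell (g z))"
    have "coherent (carrier_cell (g z)) (s z)"
      using z section_over_coherent s1(1) s2(1) by (auto simp: s_def)
    moreover have "\<exists>W. open W \<and> z \<in> W \<and> (\<forall>x\<in>A \<inter> W. carrier_cell (g z) \<subseteq> carrier_cell (g x) \<and> (\<forall>u\<in>?V. s x u = s z u))"
    proof (cases "z \<in> A")
      case True
      then show ?thesis using section_over_nbhd[OF s1(1) True] by (simp add: s_def)
    next
      case False
      then show ?thesis using clo by (intro exI[of _ "- A"]) auto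
    qed
    moreover have "\<exists>W. open W \<and> z \<in> W \<and> (\<forall>x\<in>B \<inter> W. carrier_cell (g z) \<subseteq> carrier_cell (g x) \<and> (\<forall>u\<in>?V. s x u = s z u))"
    proof (cases "z \<in> B")
      case True
      obtain W where W0: "open W \<and> z \<in> W \<and> (\<forall>zz\<in>B \<inter> W. carrier_cell (g z) \<subseteq> carrier_cell (g zz) \<and>
          (\<forall>u\<in>vertices (carrier_cell (g z)). s2 zz u = s2 z u))"
        using section_over_nbhd[OF s2(1) True] by blast
      have W: "open W" "z \<in> W" "\<And>x. x \<in> B \<Longrightarrow> x \<in> W \<Longrightarrow> carrier_cell (g z) \<subseteq> carrier_cell (g x)"
        "\<And>x u. x \<in> B \<Longrightarrow> x \<in> W \<Longrightarrow> u \<in> ?V \<Longrightarrow> s2 x u = s2 z u"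
        using W0 by simp_all
      have "s x u = s z u" if "x \<in> B \<inter> W" "u \<in> ?V" for x u
      proof -
        have "u \<in> vertices (carrier_cell (g x))" using W(3)[of x] that vertices_mono by blast
        then have "s x u = s2 x u" using sB that by blast
        also have "\<dots> = s2 z u" using W(4) that by blast
        also have "\<dots> = s z u" using sB True that by simp
        finally show ?thesis .
      qed
      then show ?thesis using W by (intro exI[of _ W]) auto
    next
      case False
      then show ?thesis using clo by (intro exI[of _ "- B"]) auto
    qed
    ultimately show "coherent (carrier_cell (g z)) (s z) \<and>
      (\<exists>W. open W \<and> z \<in> W \<and> (\<forall>x\<in>(A \<union> B) \<inter> W. carrier_cell (g z) \<subseteq> carrier_cell (g x) \<and> (\<forall>u\<in>?V. s x u = s z u)))"
      apply (elim exE conjE)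
      subgoal for W1 W2 by (intro conjI exI[of _ "W1 \<inter> W2"]) auto
      done
  qed
  moreover have "\<forall>u\<in>vertices (carrier_cell (g y)). s y u = f u" using s1(2) y by (simp add: s_def)
  ultimately show ?thesis by blast
qed

lemma liftable_glue:
  assumes "liftable A g" "liftable B g" "closed A" "closed B" "connected (A \<inter> B)" "A \<inter> B \<noteq> {}"
    and "g ` (A \<union> B) \<subseteq> M"
  shows "liftable (A \<union> B) g"
  unfolding liftable_def
proof (intro ballI allI impI)
  fix y f assume y: "y \<in> A \<union> B" and f: "coherent (carrier_cell (g y)) f"
  show "\<exists>s. section_over (A \<union> B) g s \<and> (\<forall>u\<in>vertices (carrier_cell (g y)). s y u = f u)"
  proof (cases "y \<in> A")
    case True
    then show ?thesis using liftable_glue_aux[OF assms] f by blast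
  next
    case False
    then have "y \<in> B" using y by blast
    then show ?thesis
      using liftable_glue_aux[of B g A y f] assms f by (simp add: Int_commute Un_commute)
  qed
qed

text \<open>Two bisections: in the second coordinate at fixed x, which yields a whole strip of some
  width around x, then in the first coordinate. Adjacent rectangles meet in a segment, which is
  connected as gluing demands.\<close>

lemma liftable_square:
  fixes g :: "real \<times> real \<Rightarrow> 'a"
  assumes g: "continuous_on ({0..1} \<times> {0..1}) g" "g ` ({0..1} \<times> {0..1}) \<subseteq> M"
    and ext: "\<And>y. y \<in> {0..1} \<times> {0..1} \<Longrightarrow> extendable (carrier_cell (g y))"
  shows "liftable ({0..1} \<times> {0..1}) g"
proof -
  let ?Q = "{0..1::real} \<times> {0..1::real}"
  have glue: "liftable (A \<union> B) g"
    if "liftable A g" "liftable B g" "closed A" "closed B" "connected (A \<inter> B)" "A \<inter> B \<noteq> {}" "A \<union> B \<subseteq> ?Q" for A B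
  proof -
    have "g ` (A \<union> B) \<subseteq> M" using that(7) g(2) by blast
    then show ?thesis using liftable_glue that(1-6) by blast
  qed
  have strip: "\<exists>\<delta>>0. \<forall>a b. 0 \<le> a \<and> a \<le> x \<and> x \<le> b \<and> b \<le> 1 \<and> b - a < \<delta> \<longrightarrow> liftable ({a..b} \<times> {0..1}) g"
    if x: "0 \<le> x" "x \<le> 1" for x :: real
  proof -
    define P where "P c d \<longleftrightarrow> (0 \<le> c \<and> d \<le> 1 \<longrightarrow>
      (\<exists>\<delta>>0. \<forall>a b. 0 \<le> a \<and> a \<le> x \<and> x \<le> b \<and> b \<le> 1 \<and> b - a < \<delta> \<longrightarrow> liftable ({a..b} \<times> {c..d}) g))" for c d
    have "P 0 1"
    proof (rule Bolzano)
      fix c d e :: real assume cd: "P c d" and de: "P d e" and le: "c \<le> d" "d \<le> e"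
      show "P c e" unfolding P_def
      proof
        assume ce: "0 \<le> c \<and> e \<le> 1"
        obtain \<delta>1 where \<delta>1: "\<delta>1 > 0" "\<And>a b. 0 \<le> a \<and> a \<le> x \<and> x \<le> b \<and> b \<le> 1 \<and> b - a < \<delta>1 \<Longrightarrow> liftable ({a..b} \<times> {c..d}) g"
          using cd ce le unfolding P_def by (meson order_trans)
        obtain \<delta>2 where \<delta>2: "\<delta>2 > 0" "\<And>a b. 0 \<le> a \<and> a \<le> x \<and> x \<le> b \<and> b \<le> 1 \<and> b - a < \<delta>2 \<Longrightarrow> liftable ({a..b} \<times> {d..e}) g"
          using de ce le unfolding P_def by (meson order_trans)
        have "liftable ({a..b} \<times> {c..e}) g" if ab: "0 \<le> a \<and> a \<le> x \<and> x \<le> b \<and> b \<le> 1 \<and> b - a < min \<delta>1 \<delta>2" for a b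
        proof -
          have eq: "{a..b} \<times> {c..e} = {a..b} \<times> {c..d} \<union> {a..b} \<times> {d..e}" using le by auto
          have int: "{a..b} \<times> {c..d} \<inter> {a..b} \<times> {d..e} = {a..b} \<times> {d}" using le by auto
          show ?thesis unfolding eq
          proof (rule glue)
            show "connected ({a..b} \<times> {c..d} \<inter> {a..b} \<times> {d..e})"
              unfolding int by (intro connected_Times) auto
            show "{a..b} \<times> {c..d} \<inter> {a..b} \<times> {d..e} \<noteq> {}" unfolding int using ab by auto
          qed (use ab \<delta>1(2)[of a b] \<delta>2(2)[of a b] le ce in \<open>auto intro!: closed_Times\<close>)
        qed
        then show "\<exists>\<delta>>0. \<forall>a b. 0 \<le> a \<and> a \<le> x \<and> x \<le> b \<and> b \<le> 1 \<and> b - a < \<delta> \<longrightarrow> liftable ({a..b} \<times> {c..e}) g"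
          using \<delta>1(1) \<delta>2(1) by (intro exI[of _ "min \<delta>1 \<delta>2"]) auto
      qed
    next
      fix y :: real assume y: "0 \<le> y" "y \<le> 1"
      have xy: "(x, y) \<in> ?Q" using x y by auto
      obtain W where W: "open W" "(x, y) \<in> W" "\<And>Z. Z \<subseteq> ?Q \<inter> W \<Longrightarrow> liftable Z g"
        using liftable_local[OF g ext xy] by blast
      then obtain r where r: "r > 0" "ball (x, y) r \<subseteq> W" using open_contains_ball by blast
      \<comment> \<open>Half of the radius for each coordinate, since the distance in the plane is
        at most the sum of the coordinate distances.\<close>
      have "P c d" if cd: "c \<le> y \<and> y \<le> d \<and> d - c < r / 2" for c d
      proof -
        have "liftable ({a..b} \<times> {c..d}) g"
          if cd': "0 \<le> c \<and> d \<le> 1" and ab: "0 \<le> a \<and> a \<le> x \<and> x \<le> b \<and> b \<le> 1 \<and> b - a < r / 2" for a b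
        proof (rule W(3))
          have "(s, t) \<in> ball (x, y) r" if "s \<in> {a..b}" "t \<in> {c..d}" for s t
          proof -
            have "\<bar>x - s\<bar> < r / 2" "\<bar>y - t\<bar> < r / 2" using that ab cd by (simp_all only: atLeastAtMost_iff abs_less_iff) linarith+
            then have "dist (x, y) (s, t) < r"
              using sqrt_sum_squares_le_sum_abs[of "x - s" "y - t"] by (simp add: dist_Pair_Pair dist_real_def)
            then show ?thesis by simp
          qed
          then show "{a..b} \<times> {c..d} \<subseteq> ?Q \<inter> W" using r(2) ab cd' by auto
        qed
        then show ?thesis unfolding P_def using r(1) by (intro impI exI[of _ "r / 2"]) auto
      qed
      then show "\<exists>d>0. \<forall>a b. a \<le> y \<and> y \<le> b \<and> b - a < d \<longrightarrow> P a b"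
        using r(1) by (intro exI[of _ "r / 2"]) auto
    qed simp
    then show ?thesis by (simp add: P_def)
  qed
  define P where "P a b \<longleftrightarrow> (0 \<le> a \<and> b \<le> 1 \<longrightarrow> liftable ({a..b} \<times> {0..1}) g)" for a b
  have "P 0 1"
  proof (rule Bolzano)
    fix a b c :: real assume ab: "P a b" and bc: "P b c" and le: "a \<le> b" "b \<le> c"
    show "P a c" unfolding P_def
    proof
      assume ac: "0 \<le> a \<and> c \<le> 1"
      have eq: "{a..c} \<times> {0..1::real} = {a..b} \<times> {0..1} \<union> {b..c} \<times> {0..1}" using le by auto
      have int: "{a..b} \<times> {0..1::real} \<inter> {b..c} \<times> {0..1} = {b} \<times> {0..1}" using le by auto
      show "liftable ({a..c} \<times> {0..1}) g" unfolding eq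
      proof (rule glue)
        show "connected ({a..b} \<times> {0..1::real} \<inter> {b..c} \<times> {0..1})"
          unfolding int by (intro connected_Times) auto
        show "{a..b} \<times> {0..1::real} \<inter> {b..c} \<times> {0..1} \<noteq> {}" unfolding int by auto
      qed (use ab bc le ac in \<open>auto simp: P_def intro!: closed_Times\<close>)
    qed
  next
    fix x :: real assume "0 \<le> x" "x \<le> 1"
    then obtain \<delta> where "\<delta> > 0" "\<And>a b. 0 \<le> a \<and> a \<le> x \<and> x \<le> b \<and> b \<le> 1 \<and> b - a < \<delta> \<Longrightarrow> liftable ({a..b} \<times> {0..1}) g"
      using strip by blast
    then show "\<exists>d>0. \<forall>a b. a \<le> x \<and> x \<le> b \<and> b - a < d \<longrightarrow> P a b"
      unfolding P_def by (intro exI[of _ \<delta>]) auto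
  qed simp
  then show ?thesis by (simp add: P_def)
qed

text \<open>Over one edge the section is compared with the constant section of a coherent coloring
  of that edge, whose value at the far end is the transport. The substitutions t / 2 and (t + 1) / 2
  read off the two halves of the joined path.\<close>

lemma section_over_realization:
  assumes "edge_path X v es w" "section_over {0..1} (realization v es) s" "s 0 v = f" "f \<in> colorings v"
  shows "s 1 w = transport n X es f"
  using assms
proof (induction es arbitrary: v s f)
  case Nil
  then have v: "{v} \<in> X 0" "v = w" by auto
  have sc: "section_over {0..1} (\<lambda>_. v) (\<lambda>_::real. \<lambda>_. f)"
    by (rule section_over_const[OF _ v(1) _ coherent_vertex[OF v(1)]]) (use Nil in auto)
  have "s 1 v = f"
  proof (rule section_over_unique[OF connected_Icc _ _ sc])
    show "section_over {0..1} (\<lambda>_. v) s" using Nil by simp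
    show "s 0 v = f" by fact
  qed (use v cell_subset in \<open>auto simp: carrier_cell_vertex vertices_vertex\<close>)
  then show ?case using v by (simp add: transport_def)
next
  case (Cons a es)
  obtain e u where a: "a = (e, u)" by (cases a)
  note * = edge_path_Cons_D[OF Cons.prems(1)[unfolded a]]
  note arc = edge_arc[OF *(1-4)]
  let ?p = "edge_arc e v u" and ?q = "realization u es"
  have s: "section_over {0..1} (?p +++ ?q) s" using Cons.prems(2) a by simp
  have vert: "carrier_cell v = {v}" "vertices {v} = {v}" "carrier_cell u = {u}" "vertices {u} = {u}"
    using *(2,3) carrier_cell_vertex vertices_vertex by (auto simp: vertices_def)
  have p: "?p 0 = v" "?p 1 = u" "continuous_on {0..1} ?p" "?p ` {0..1} = e" "?q 0 = u"
    using arc realization_path[OF *(5)] by (auto simp: arc_def path_def path_image_def pathstart_def pathfinish_def)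
  obtain F where F: "coherent e F" "F v = f"
    using extendable_edge[OF *(1)] *(2) Cons.prems(4) unfolding extendable_def by blast
  have s1: "section_over {0..1} ?p (s \<circ> (\<lambda>t. t / 2))"
    by (rule section_over_compose[OF s]) (auto intro!: continuous_intros simp: joinpaths_def)
  have sc: "section_over {0..1} ?p (\<lambda>_. F)"
    using p F by (intro section_over_const[OF _ *(1)]) auto
  have "(s \<circ> (\<lambda>t. t / 2)) 1 u = F u"
    by (rule section_over_unique[OF connected_Icc _ s1 sc, of 0 v])
      (use p Cons.prems(3) F cell_subset[OF *(1)] in \<open>auto simp: vert\<close>)
  moreover have "F u = edge_transport n X (e, u) f"
    using coherent_transport[of v "[(e, u)]" u e F] *(1-4) F by (auto simp: transport_def vertices_def)
  ultimately have half: "s (1/2) u = edge_transport n X (e, u) f" by simp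
  have s2: "section_over {0..1} ?q (s \<circ> (\<lambda>t. (t + 1) / 2))"
  proof (rule section_over_compose[OF s])
    show "?q t = (?p +++ ?q) ((t + 1) / 2)" if "t \<in> {0..1}" for t
      using that p by (auto simp: joinpaths_def add_divide_distrib)
  qed (auto intro!: continuous_intros)
  have "(s \<circ> (\<lambda>t. (t + 1) / 2)) 1 w = transport n X es (edge_transport n X (e, u) f)"
    using half by (intro Cons.IH[OF *(5) s2 _ edge_transport_coloring(1)[OF *(1,3,2) Cons.prems(4)]]) simp
  then show ?case by (simp add: a transport_Cons)
qed

text \<open>Lift the homotopy to a section over the square. On the sides where the homotopy rests at
  v or w the section keeps its value there; the other two sides compute the two transports.\<close>

lemma transport_homotopic:
  assumes S: "S \<subseteq> M" "\<And>x. x \<in> S \<Longrightarrow> extendable (carrier_cell x)"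
    and es: "edge_path X v es w" "edge_path X v es' w"
    and hom: "homotopic_paths S (realization v es) (realization v es')"
    and f: "f \<in> colorings v"
  shows "transport n X es f = transport n X es' f"
proof -
  note r = realization_path[OF es(1)] and r' = realization_path[OF es(2)]
  have pr: "pathstart (realization v es) = v" "pathfinish (realization v es) = w" using r by auto
  obtain h where h: "continuous_on ({0..1::real} \<times> {0..1}) h" "h \<in> {0..1} \<times> {0..1} \<rightarrow> S"
    "\<forall>x\<in>{0..1}. h (0, x) = realization v es x" "\<forall>x\<in>{0..1}. h (1, x) = realization v es' x"
    "\<forall>t\<in>{0..1}. pathstart (h \<circ> Pair t) = v \<and> pathfinish (h \<circ> Pair t) = w"
    using hom unfolding homotopic_paths pr by blast
  let ?Q = "{0..1::real} \<times> {0..1::real}"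
  have v: "{v} \<in> X 0" "{w} \<in> X 0" using edge_path_vertices es by auto
  have ends: "h (t, 0) = v" "h (t, 1) = w" if "t \<in> {0..1}" for t
    using h(5) that by (auto simp: pathstart_def pathfinish_def)
  have vert: "carrier_cell v = {v}" "vertices {v} = {v}" "carrier_cell w = {w}" "vertices {w} = {w}"
    using v carrier_cell_vertex vertices_vertex by auto
  have "liftable ?Q h"
    using h(1,2) S by (intro liftable_square) auto
  moreover have "coherent (carrier_cell (h (0, 0))) (\<lambda>_. f)" using ends coherent_vertex v f vert by simp
  ultimately obtain s where s: "section_over ?Q h s" "s (0, 0) v = f"
    unfolding liftable_def using ends[of 0] vert(1,2) by (metis atLeastAtMost_iff insertI1 mem_Sigma_iff order_refl zero_le_one)
  have side: "section_over {0..1} p (s \<circ> Pair t)" if "t \<in> {0..1}" "\<forall>x\<in>{0..1}. h (t, x) = p x" for t p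
    by (rule section_over_compose[OF s(1)]) (use that in \<open>auto intro!: continuous_intros\<close>)
  have edge: "(s \<circ> (\<lambda>t. (t, x))) 1 a = s (0, x) a"
    if x: "x \<in> {0..1}" "\<And>t. t \<in> {0..1} \<Longrightarrow> h (t, x) = a" "{a} \<in> X 0" for x a
  proof (rule section_over_unique[where Y = "{0..1::real}" and g = "\<lambda>_. a" and s' = "\<lambda>_. s (0, x)" and y = 0 and u = a])
    show "section_over {0..1} (\<lambda>_. a) (s \<circ> (\<lambda>t. (t, x)))"
      by (rule section_over_compose[OF s(1)]) (use x in \<open>auto intro!: continuous_intros\<close>)
    have "coherent {a} (s (0, x))"
      using section_over_coherent[OF s(1), of "(0, x)"] x carrier_cell_vertex[OF x(3)] by simp
    then show "section_over {0..1} (\<lambda>_. a) (\<lambda>_::real. s (0, x))"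
      by (intro section_over_const[OF _ x(3)]) auto
  qed (use x cell_subset in \<open>auto simp: carrier_cell_vertex vertices_vertex\<close>)
  have "s (1, 0) v = f" using edge[of 0 v] ends v s(2) by simp
  then have "s (1, 1) w = transport n X es' f"
    using section_over_realization[OF es(2) side[of 1]] h(4) f by simp
  moreover have "s (0, 1) w = transport n X es f"
    using section_over_realization[OF es(1) side[of 0]] h(3) f s(2) by simp
  moreover have "s (1, 1) w = s (0, 1) w" using edge[of 1 w] ends v by simp
  ultimately show ?thesis by simp
qed

end

section \<open>Extending colorings over cells\<close>

lemma card_2_other:
  assumes "card A = 2" "x \<in> A"
  shows "\<exists>y. A = {x, y} \<and> y \<noteq> x"
  using assms by (metis card_2_iff insertE insert_commute singletonD)

text \<open>Such a multigraph is a single cycle, whose edges can be colored by the parity of their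
  position. The function \<open>ends\<close> keeps parallel edges apart, so a cycle of two edges is
  covered.\<close>

lemma two_regular_even_edge_coloring:
  fixes ends :: "'e \<Rightarrow> 'v set"
  assumes finE: "finite E" and even: "even (card E)"
    and ends: "\<And>e. e \<in> E \<Longrightarrow> ends e \<subseteq> V \<and> card (ends e) = 2"
    and deg: "\<And>v. v \<in> V \<Longrightarrow> card {e \<in> E. v \<in> ends e} = 2"
    and conn: "\<And>u v. u \<in> V \<Longrightarrow> v \<in> V \<Longrightarrow> (u, v) \<in> {(a, b). \<exists>e\<in>E. a \<in> ends e \<and> b \<in> ends e}\<^sup>*"
  shows "\<exists>b :: 'e \<Rightarrow> bool. \<forall>v\<in>V. \<forall>e\<in>E. \<forall>e'\<in>E. v \<in> ends e \<and> v \<in> ends e' \<and> e \<noteq> e' \<longrightarrow> b e \<noteq> b e'"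
proof (cases "V = {}")
  case True
  then show ?thesis by simp
next
  case False
  then obtain v0 where v0: "v0 \<in> V" by blast
  have "{e \<in> E. v0 \<in> ends e} \<noteq> {}" using deg[OF v0] by (metis card.empty zero_neq_numeral)
  then obtain e0 where e0: "e0 \<in> E" "v0 \<in> ends e0" by blast
  \<comment> \<open>A pair (v, e) is the edge e oriented away from v.\<close>
  define D where "D = {(v, e). e \<in> E \<and> v \<in> ends e}"
  have DV: "v \<in> V" if "(v, e) \<in> D" for v e using that ends by (auto simp: D_def)
  have "\<exists>u. ends e = {v, u} \<and> u \<noteq> v" if "(v, e) \<in> D" for v e
    using that ends card_2_other[of "ends e" v] by (auto simp: D_def)
  then obtain op where op: "\<And>v e. (v, e) \<in> D \<Longrightarrow> ends e = {v, op v e} \<and> op v e \<noteq> v" by metis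
  have "\<exists>e'. {e \<in> E. v \<in> ends e} = {e, e'} \<and> e' \<noteq> e" if "(v, e) \<in> D" for v e
    using card_2_other[OF deg[OF DV[OF that]], of e] that by (auto simp: D_def)
  then obtain ne where ne: "\<And>v e. (v, e) \<in> D \<Longrightarrow> {e' \<in> E. v \<in> ends e'} = {e, ne v e} \<and> ne v e \<noteq> e" by metis
  have opD: "(op v e, e) \<in> D" "op (op v e) e = v" if "(v, e) \<in> D" for v e
  proof -
    show *: "(op v e, e) \<in> D" using op[OF that] that by (auto simp: D_def)
    show "op (op v e) e = v" using op[OF that] op[OF *] by auto
  qed
  have neD: "(v, ne v e) \<in> D" "ne v (ne v e) = e" if "(v, e) \<in> D" for v e
  proof -
    have "ne v e \<in> {e' \<in> E. v \<in> ends e'}" using ne[OF that] by blast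
    then show *: "(v, ne v e) \<in> D" by (auto simp: D_def)
    show "ne v (ne v e) = e" using ne[OF that] ne[OF *] by auto
  qed
  \<comment> \<open>\<open>f\<close> walks along the cycle by oriented edges and \<open>\<rho>\<close> reverses orientations; the relation \<open>f \<rho> f = \<rho>\<close>
    shows that the walk never traverses an edge in both directions, so its period is the number of edges.\<close>
  define \<rho> where "\<rho> = (\<lambda>(v, e). (op v e, e))"
  define f where "f = (\<lambda>(v, e). (op v e, ne (op v e) e))"
  have fD: "f a \<in> D" if "a \<in> D" for a using that opD neD by (cases a) (auto simp: f_def)
  have fpowD: "(f ^^ k) a \<in> D" if "a \<in> D" for a k using that fD by (induction k) auto
  have \<rho>D: "\<rho> a \<in> D" if "a \<in> D" for a using that opD by (cases a) (auto simp: \<rho>_def)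
  have f\<rho>f: "f (\<rho> (f a)) = \<rho> a" if "a \<in> D" for a
  proof -
    obtain v e where a: "a = (v, e)" by (cases a)
    then show ?thesis using that opD neD[OF opD(1)[of v e]] opD[OF neD(1)[OF opD(1)[of v e]]] by (simp add: f_def \<rho>_def)
  qed
  have \<rho>\<rho>: "\<rho> (\<rho> a) = a" if "a \<in> D" for a using that opD by (cases a) (auto simp: \<rho>_def)
  have inj: "inj_on f D"
  proof (rule inj_onI)
    fix a b assume ab: "a \<in> D" "b \<in> D" "f a = f b"
    then have "\<rho> a = \<rho> b" using f\<rho>f by metis
    then show "a = b" using ab \<rho>\<rho> by metis
  qed
  \<comment> \<open>Induction in steps of two: by f \<rho> f = \<rho> and injectivity, a flip after
    k + 2 steps from a is a flip after k steps from \<open>f a\<close>. At the base, reversal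
    changes the vertex, and one step changes the edge.\<close>
  have no_flip: "(f ^^ k) a \<noteq> \<rho> a" if "a \<in> D" for k a
    using that
  proof (induction k arbitrary: a rule: induct_nat_012)
    case 0
    obtain v e where a: "a = (v, e)" by (cases a)
    then show ?case using op[of v e] 0 by (auto simp: \<rho>_def)
  next
    case 1
    obtain v e where a: "a = (v, e)" by (cases a)
    then show ?case using ne[OF opD(1), of v e] 1 by (auto simp: \<rho>_def f_def)
  next
    case (ge2 k)
    show ?case
    proof
      assume "(f ^^ Suc (Suc k)) a = \<rho> a"
      then have "f ((f ^^ k) (f a)) = f (\<rho> (f a))" using f\<rho>f[OF ge2.prems] by (simp add: funpow_swap1)
      then have "(f ^^ k) (f a) = \<rho> (f a)"
        using inj_onD[OF inj] fpowD[OF fD[OF ge2.prems]] \<rho>D[OF fD[OF ge2.prems]] by blast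
      then show False using ge2.IH(1)[OF fD[OF ge2.prems]] by simp
    qed
  qed
  define d where "d = (v0, e0)"
  have dD: "d \<in> D" using e0 by (simp add: d_def D_def)
  define w where "w i = (f ^^ i) d" for i
  have wD: "w i \<in> D" for i using fpowD[OF dD] by (simp add: w_def)
  have cancel: "w k = d" if "w (i + k) = w i" for i k
    using that
  proof (induction i)
    case 0
    then show ?case by (simp add: w_def)
  next
    case (Suc i)
    then have "f (w (i + k)) = f (w i)" by (simp add: w_def)
    then show ?case using inj_onD[OF inj _ wD wD] Suc.IH by blast
  qed
  have "finite D"
  proof -
    have "finite (ends e)" if "e \<in> E" for e using ends[OF that] card.infinite by fastforce
    then have "finite (\<Union>(ends ` E) \<times> E)" using finE by blast
    then show ?thesis by (rule rev_finite_subset) (auto simp: D_def)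
  qed
  then have "finite (range w)" using wD finite_subset by (metis image_subsetI)
  then have "\<not> inj w" using finite_imageD infinite_UNIV_nat by blast
  then obtain i j where "w i = w j" "i \<noteq> j" by (auto simp: inj_def)
  then obtain i j where ij: "w i = w j" "i < j" by (metis linorder_neqE_nat)
  then have per: "0 < j - i \<and> w (j - i) = d" using cancel[of i "j - i"] by simp
  \<comment> \<open>The period of the walk. It equals the number of edges, because no edge is met
    twice within a period and every edge is met.\<close>
  define m where "m = (LEAST m. 0 < m \<and> w m = d)"
  have m: "0 < m" "w m = d" using LeastI[of "\<lambda>m. 0 < m \<and> w m = d", OF per] by (auto simp: m_def)
  have min: "m \<le> k" if "0 < k" "w k = d" for k unfolding m_def using that by (intro Least_le) simp
  have mod: "w (k mod m) = w k" for k
    using m(2) funpow_mod_eq[of m f d k] by (simp add: w_def)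
  have w_eq: "i mod m = j mod m" if "w i = w j" for i j
  proof -
    have *: "i mod m = j mod m" if le: "i mod m \<le> j mod m" and eq: "w i = w j" for i j
    proof (rule ccontr)
      assume "i mod m \<noteq> j mod m"
      then have pos: "0 < j mod m - i mod m" using le by simp
      moreover have "w (j mod m - i mod m) = d" using cancel[of "i mod m" "j mod m - i mod m"] eq le mod by simp
      ultimately have "m \<le> j mod m - i mod m" by (rule min)
      then show False using mod_less_divisor[OF m(1), of j] by linarith
    qed
    show ?thesis using *[of i j] *[of j i] that by (metis nat_le_linear)
  qed
  \<comment> \<open>Two visits to an edge have equal or opposite orientations, and
    \<open>no_flip\<close> excludes the opposite ones.\<close>
  have edge_eq: "i mod m = j mod m" if "snd (w i) = snd (w j)" for i j
  proof -
    have *: False if "w j = \<rho> (w i)" "i \<le> j" for i j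
    proof -
      have "w j = (f ^^ (j - i)) (w i)" using that(2) by (simp add: w_def funpow_add[symmetric, THEN fun_cong, unfolded comp_def])
      then show False using no_flip[OF wD] that(1) by metis
    qed
    have "w j = w i \<or> w j = \<rho> (w i)"
    proof -
      obtain v e where wi: "w i = (v, e)" by (cases "w i")
      obtain u e' where wj: "w j = (u, e')" by (cases "w j")
      have "e' = e" using that wi wj by simp
      then have "u \<in> ends e" using wD[of j] wj by (auto simp: D_def)
      then have "u = v \<or> u = op v e" using op[of v e] wD[of i] wi by auto
      then show ?thesis using wi wj \<open>e' = e\<close> by (auto simp: \<rho>_def)
    qed
    then show ?thesis
    proof
      assume "w j = w i"
      then show ?thesis using w_eq by metis
    next
      assume flip: "w j = \<rho> (w i)"
      then have "w i = \<rho> (w j)" using \<rho>\<rho>[OF wD] by metis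
      then show ?thesis using flip * by (metis nat_le_linear)
    qed
  qed
  \<comment> \<open>i + m - 1 is the predecessor of i modulo m, written so that nothing is cut off
    at i = 0.\<close>
  have pred: "\<exists>j. Suc j mod m = i mod m" for i
    using m(1) by (intro exI[of _ "i + m - 1"]) simp
  \<comment> \<open>The two edges at a visited vertex are the one by which the walk leaves and the
    one by which it arrived.\<close>
  have nbrs: "\<exists>i j. v = fst (w i) \<and> Suc j mod m = i mod m \<and> {e \<in> E. v \<in> ends e} = {snd (w i), snd (w j)}" if "v = fst (w i0)" for v i0
  proof -
    obtain j where j: "Suc j mod m = i0 mod m" using pred by blast
    then have "w i0 = f (w j)" using mod[of i0] mod[of "Suc j"] by (simp add: w_def)
    moreover obtain x e where wj: "w j = (x, e)" by (cases "w j")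
    ultimately have wi: "w i0 = (op x e, ne (op x e) e)" by (simp add: f_def)
    have xe: "(x, e) \<in> D" using wD[of j] wj by simp
    have "{e' \<in> E. op x e \<in> ends e'} = {e, ne (op x e) e}" using ne[OF opD(1)[OF xe]] by blast
    then have "{e' \<in> E. v \<in> ends e'} = {snd (w i0), snd (w j)}" using that wi wj by (simp add: insert_commute)
    then show ?thesis using that j by blast
  qed
  have visited: "v \<in> fst ` range w" if "v \<in> V" for v
  proof -
    have "(v0, v) \<in> {(a, b). \<exists>e\<in>E. a \<in> ends e \<and> b \<in> ends e}\<^sup>*" using conn v0 that by blast
    then show ?thesis
    proof (induction rule: rtrancl_induct)
      case base
      have "fst (w 0) = v0" by (simp add: w_def d_def)
      then show ?case by (metis image_eqI rangeI)
    next
      case (step x y)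
      then obtain e where e: "e \<in> E" "x \<in> ends e" "y \<in> ends e" by auto
      obtain i0 where "x = fst (w i0)" using step.IH by auto
      then obtain i j where ij: "x = fst (w i)" "Suc j mod m = i mod m" "{e \<in> E. x \<in> ends e} = {snd (w i), snd (w j)}"
        using nbrs by blast
      then have "e = snd (w i) \<or> e = snd (w j)" using e by blast
      then obtain k where k: "e = snd (w k)" by blast
      obtain z where z: "w k = (z, e)" using k by (metis prod.collapse)
      then have "ends e = {z, op z e}" using op wD[of k] by metis
      moreover have "fst (w (Suc k)) = op z e" using z by (simp add: w_def f_def)
      moreover have "fst (w k) = z" using z by simp
      ultimately show ?case using e(3) by (metis image_eqI insertE rangeI singletonD)
    qed
  qed
  have surj: "(\<lambda>i. snd (w i)) ` {..<m} = E"
  proof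
    show "(\<lambda>i. snd (w i)) ` {..<m} \<subseteq> E" using wD by (auto simp: D_def) (metis case_prodD prod.collapse)
    show "E \<subseteq> (\<lambda>i. snd (w i)) ` {..<m}"
    proof
      fix e assume e: "e \<in> E"
      then obtain v where v: "v \<in> ends e" using ends by fastforce
      then have "v \<in> V" using ends e by blast
      then obtain i0 where "v = fst (w i0)" using visited by blast
      then obtain i j where "{e \<in> E. v \<in> ends e} = {snd (w i), snd (w j)}" using nbrs by blast
      then have "e = snd (w i) \<or> e = snd (w j)" using e v by blast
      then obtain k where "e = snd (w (k mod m))" using mod by metis
      then show "e \<in> (\<lambda>i. snd (w i)) ` {..<m}" using m(1) by auto
    qed
  qed
  moreover have "inj_on (\<lambda>i. snd (w i)) {..<m}"
    using edge_eq by (intro inj_onI) fastforce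
  ultimately have "card E = m" by (metis card_image card_lessThan)
  then have "even m" using even by simp
  \<comment> \<open>The parity of some time at which the edge is traversed; all such times agree
    modulo the even number m.\<close>
  define b where "b e = even (SOME i. snd (w i) = e)" for e
  have b: "b (snd (w i)) = even i" for i
  proof -
    have "snd (w (SOME j. snd (w j) = snd (w i))) = snd (w i)" by (rule someI) simp
    then have "(SOME j. snd (w j) = snd (w i)) mod m = i mod m" by (rule edge_eq)
    then show ?thesis unfolding b_def using \<open>even m\<close> by (metis dvd_mod_iff)
  qed
  have "b e \<noteq> b e'" if "v \<in> V" "e \<in> E" "e' \<in> E" "v \<in> ends e" "v \<in> ends e'" "e \<noteq> e'" for v e e'
  proof -
    obtain i0 where "v = fst (w i0)" using visited \<open>v \<in> V\<close> by blast
    then obtain i j where ij: "Suc j mod m = i mod m" "{e \<in> E. v \<in> ends e} = {snd (w i), snd (w j)}" using nbrs by blast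
    have "even (Suc j) = even i" using ij(1) \<open>even m\<close> by (metis dvd_mod_iff)
    then have "b (snd (w i)) \<noteq> b (snd (w j))" using b by simp
    moreover have "e \<in> {snd (w i), snd (w j)}" "e' \<in> {snd (w i), snd (w j)}" using that ij(2) by blast+
    ultimately show ?thesis using \<open>e \<noteq> e'\<close> by auto
  qed
  then show ?thesis by blast
qed

section \<open>Extendability of cells, by dimension\<close>

context cpx_complex begin

lemma card_vertices_edge: "e \<in> X 1 \<Longrightarrow> card (vertices e) = 2"
  by (metis card_2_iff edge_obtain_arc)

lemma edge_path_rtrancl:
  "edge_path X u es v \<Longrightarrow> fst ` set es \<subseteq> E \<Longrightarrow>
    (u, v) \<in> {(a, b). \<exists>e\<in>E. a \<in> vertices e \<and> b \<in> vertices e}\<^sup>*"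
proof (induction es arbitrary: u)
  case (Cons s es)
  obtain e x where s: "s = (e, x)" by (cases s)
  note * = edge_path_Cons_D[OF Cons.prems(1)[unfolded s]]
  have "(u, x) \<in> {(a, b). \<exists>e\<in>E. a \<in> vertices e \<and> b \<in> vertices e}" using *(2,3) Cons.prems(2) s by auto
  then show ?case using Cons.IH[OF *(5)] Cons.prems(2) by (auto intro: converse_rtrancl_into_rtrancl)
qed simp

lemma edge_path_edges: "edge_path X u es v \<Longrightarrow> fst ` set es \<subseteq> X 1"
  by (induction X u es v rule: edge_path.induct) auto

text \<open>The edges of a 2-cell form a finite connected graph, and duality puts exactly two of
  them at each vertex.\<close>

lemma two_cell_edge_coloring:
  assumes c: "c \<in> X 2" "even_sided X c"
  shows "\<exists>b :: 'a set \<Rightarrow> bool. \<forall>v\<in>vertices c. \<forall>e\<in>{e \<in> X 1. e \<subseteq> c}. \<forall>e'\<in>{e \<in> X 1. e \<subseteq> c}.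
    v \<in> vertices e \<and> v \<in> vertices e' \<and> e \<noteq> e' \<longrightarrow> b e \<noteq> b e'"
proof (rule two_regular_even_edge_coloring)
  let ?E = "{e \<in> X 1. e \<subseteq> c}"
  show "finite ?E" using finite_cells by (rule rev_finite_subset) blast
  show "even (card ?E)" using c(2) by (simp add: even_sided_def)
  show "vertices e \<subseteq> vertices c \<and> card (vertices e) = 2" if "e \<in> ?E" for e
    using that vertices_mono card_vertices_edge by blast
  show "card {e \<in> ?E. v \<in> vertices e} = 2" if v: "v \<in> vertices c" for v
  proof -
    have v': "{v} \<in> X 0" "v \<in> c" using v by (auto simp: vertices_def)
    obtain e1 e2 where "e1 \<noteq> e2" "{e \<in> X 1. e \<subseteq> c \<and> v \<in> e} = {e1, e2}"
      using cpx_two_edges[OF cpx v'(1) c(1) v'(2)] by metis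
    moreover have "{e \<in> ?E. v \<in> vertices e} = {e \<in> X 1. e \<subseteq> c \<and> v \<in> e}" using v' by (auto simp: vertices_def)
    ultimately show ?thesis by simp
  qed
  show "(u, v) \<in> {(a, b). \<exists>e\<in>?E. a \<in> vertices e \<and> b \<in> vertices e}\<^sup>*"
    if uv: "u \<in> vertices c" "v \<in> vertices c" for u v
  proof -
    obtain es where es: "edge_path X u es v" "\<Union>(fst ` set es) \<subseteq> c" using cell_edge_connected[OF c(1) uv] by blast
    then have "fst ` set es \<subseteq> ?E" using edge_path_edges[OF es(1)] by blast
    then show ?thesis by (rule edge_path_rtrancl[OF es(1)])
  qed
qed

text \<open>Regions containing c are present at all its vertices and keep their colors. The one
  further region over each edge of c receives one of the two spare colors, according to the class of
  the edge; at every vertex both classes occur once.\<close>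

lemma extendable_two_cell:
  assumes c: "c \<in> X 2" "even_sided X c"
  shows "extendable c"
  unfolding extendable_def
proof (intro ballI)
  fix v0 w assume v0: "v0 \<in> vertices c" and w: "w \<in> colorings v0"
  obtain b :: "'a set \<Rightarrow> bool" where b0: "\<forall>v\<in>vertices c. \<forall>e\<in>{e \<in> X 1. e \<subseteq> c}. \<forall>e'\<in>{e \<in> X 1. e \<subseteq> c}.
    v \<in> vertices e \<and> v \<in> vertices e' \<and> e \<noteq> e' \<longrightarrow> b e \<noteq> b e'"
    using two_cell_edge_coloring[OF c] by (rule exE)
  have b: "b e \<noteq> b e'" if "v \<in> vertices c" "e \<in> X 1" "e' \<in> X 1" "e \<subseteq> c" "e' \<subseteq> c" "v \<in> e" "v \<in> e'" "e \<noteq> e'" for v e e'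
    using b0[rule_format, of v e e'] that by (simp add: vertices_def)
  have local_structure: "\<exists>e1 e2 r1 r2. {e \<in> X 1. e \<subseteq> c \<and> u \<in> e} = {e1, e2} \<and> b e1 \<and> \<not> b e2 \<and>
      r1 \<notin> R c \<and> r2 \<notin> R c \<and> r1 \<noteq> r2 \<and> R e1 = insert r1 (R c) \<and> R e2 = insert r2 (R c) \<and>
      R {u} = insert r1 (insert r2 (R c))" if u: "u \<in> vertices c" for u
  proof -
    have u': "{u} \<in> X 0" "u \<in> c" using u by (auto simp: vertices_def)
    obtain a1 a2 where a: "a1 \<noteq> a2" "{e \<in> X 1. e \<subseteq> c \<and> u \<in> e} = {a1, a2}" "R a1 \<inter> R a2 = R c"
      by (rule cpx_two_edges[OF cpx u'(1) c(1) u'(2), folded n_eq]) (rule that; assumption)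
    have "a1 \<in> {e \<in> X 1. e \<subseteq> c \<and> u \<in> e}" "a2 \<in> {e \<in> X 1. e \<subseteq> c \<and> u \<in> e}" using a(2) by auto
    then have ba: "b a1 \<noteq> b a2" using b[OF u] a(1) by auto
    have "\<exists>e1 e2. e1 \<noteq> e2 \<and> {e \<in> X 1. e \<subseteq> c \<and> u \<in> e} = {e1, e2} \<and> R e1 \<inter> R e2 = R c \<and> b e1 \<and> \<not> b e2"
    proof (cases "b a1")
      case True
      then show ?thesis using a ba by (intro exI[of _ a1] exI[of _ a2]) simp
    next
      case False
      then show ?thesis using a ba by (intro exI[of _ a2] exI[of _ a1]) (simp add: Int_commute insert_commute)
    qed
    then obtain e1 e2 where e: "e1 \<noteq> e2" "{e \<in> X 1. e \<subseteq> c \<and> u \<in> e} = {e1, e2}" "R e1 \<inter> R e2 = R c" "b e1" "\<not> b e2"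
      by (elim exE conjE)
    have "e1 \<in> {e \<in> X 1. e \<subseteq> c \<and> u \<in> e}" "e2 \<in> {e \<in> X 1. e \<subseteq> c \<and> u \<in> e}" using e(2) by auto
    then have e12: "e1 \<in> X 1" "e2 \<in> X 1" "e1 \<subseteq> c" "e2 \<subseteq> c" "u \<in> vertices e1" "u \<in> vertices e2"
      using u' by (auto simp: vertices_def)
    have card: "card (R e1) + 1 = n + 1" "card (R e2) + 1 = n + 1" "card (R c) + 2 = n + 1" "card (R {u}) + 0 = n + 1"
      using card_regions[OF e12(5,1)] card_regions[OF e12(6,2)] card_regions[OF u c(1)]
        card_regions[of u "{u}" 0] u' vertices_vertex by auto
    have sub: "R c \<subseteq> R e1" "R c \<subseteq> R e2" using e(3) by auto
    have "card (R e1 - R c) = 1" "card (R e2 - R c) = 1"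
      using card sub by (auto simp: card_Diff_subset finite_regions)
    then obtain r1 r2 where r: "R e1 - R c = {r1}" "R e2 - R c = {r2}" by (meson card_1_singletonE)
    then have r': "R e1 = insert r1 (R c)" "R e2 = insert r2 (R c)" "r1 \<notin> R c" "r2 \<notin> R c" using sub by auto
    have ne: "r1 \<noteq> r2" using r' e(3) by auto
    have "R e1 \<subseteq> R {u}" "R e2 \<subseteq> R {u}" using e12 by (auto simp: vertices_def intro!: regions_antimono)
    then have "insert r1 (insert r2 (R c)) \<subseteq> R {u}" using r' by auto
    moreover have "card (insert r1 (insert r2 (R c))) = card (R {u})"
      using card r' ne by (simp add: finite_regions)
    ultimately have "R {u} = insert r1 (insert r2 (R c))"
      using card_subset_eq[OF finite_regions] by metis
    then show ?thesis using e r' ne by blast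
  qed
  obtain e1 e2 r1 r2 where v0s: "{e \<in> X 1. e \<subseteq> c \<and> v0 \<in> e} = {e1, e2}" "b e1" "\<not> b e2"
      "r1 \<notin> R c" "r2 \<notin> R c" "r1 \<noteq> r2" "R e1 = insert r1 (R c)" "R e2 = insert r2 (R c)"
      "R {v0} = insert r1 (insert r2 (R c))"
    using local_structure[OF v0] by (elim exE conjE)
  \<comment> \<open>The spare colors are named through v0: r1 and r2 are the extra regions there
    over the edges with b true and b false. This gives \<open>f v0 = w\<close>.\<close>
  define f where "f u = (\<lambda>r\<in>R {u}. if c \<subseteq> r then w r
      else if \<exists>e\<in>X 1. e \<subseteq> c \<and> u \<in> e \<and> e \<subseteq> r \<and> b e then w r1 else w r2)" for u
  have f_edge: "f u r = (if c \<subseteq> r then w r else if b e then w r1 else w r2)"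
    if u: "u \<in> vertices c" and e: "e \<in> X 1" "e \<subseteq> c" "u \<in> e" and r: "r \<in> R e" for u e r
  proof -
    obtain a1 a2 s1 s2 where us: "{e \<in> X 1. e \<subseteq> c \<and> u \<in> e} = {a1, a2}" "b a1" "\<not> b a2"
      "s1 \<notin> R c" "s2 \<notin> R c" "s1 \<noteq> s2" "R a1 = insert s1 (R c)" "R a2 = insert s2 (R c)"
      "R {u} = insert s1 (insert s2 (R c))"
      using local_structure[OF u] by (elim exE conjE)
    have rX: "r \<in> X n" "e \<subseteq> r" using r by (auto simp: regions_at_def)
    have ru: "r \<in> R {u}" using rX e by (auto simp: regions_at_def)
    show ?thesis
    proof (cases "c \<subseteq> r")
      case True
      then show ?thesis using ru by (simp add: f_def)
    next
      case False
      then have rc: "r \<notin> R c" by (auto simp: regions_at_def)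
      have "(\<exists>e\<in>X 1. e \<subseteq> c \<and> u \<in> e \<and> e \<subseteq> r \<and> b e) \<longleftrightarrow> b e"
      proof
        assume "\<exists>e\<in>X 1. e \<subseteq> c \<and> u \<in> e \<and> e \<subseteq> r \<and> b e"
        then obtain e' where e': "e' \<in> X 1" "e' \<subseteq> c" "u \<in> e'" "e' \<subseteq> r" "b e'" by blast
        have "e' \<in> {a1, a2}" "e \<in> {a1, a2}" using e' e us(1) by blast+
        moreover have "r \<in> R e'" using e' rX by (auto simp: regions_at_def)
        ultimately show "b e" using r rc us(2-) e'(5) by auto
      qed (use e rX in blast)
      then show ?thesis using ru False by (simp add: f_def)
    qed
  qed
  have f_col: "f u \<in> colorings u" if u: "u \<in> vertices c" for u
  proof -
    obtain a1 a2 s1 s2 where us: "{e \<in> X 1. e \<subseteq> c \<and> u \<in> e} = {a1, a2}" "b a1" "\<not> b a2"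
      "s1 \<notin> R c" "s2 \<notin> R c" "s1 \<noteq> s2" "R a1 = insert s1 (R c)" "R a2 = insert s2 (R c)"
      "R {u} = insert s1 (insert s2 (R c))"
      using local_structure[OF u] by (elim exE conjE)
    have "a1 \<in> {e \<in> X 1. e \<subseteq> c \<and> u \<in> e}" "a2 \<in> {e \<in> X 1. e \<subseteq> c \<and> u \<in> e}" using us(1) by auto
    then have a: "a1 \<in> X 1" "a1 \<subseteq> c" "u \<in> a1" "a2 \<in> X 1" "a2 \<subseteq> c" "u \<in> a2" by auto
    have mem: "s1 \<in> R a1" "s2 \<in> R a2" using us by auto
    then have "\<not> c \<subseteq> s1" "\<not> c \<subseteq> s2" using us(4,5) by (auto simp: regions_at_def)
    then have fs: "f u s1 = w r1" "f u s2 = w r2"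
      using f_edge[OF u a(1-3) mem(1)] f_edge[OF u a(4-6) mem(2)] us(2,3) by auto
    have fc: "f u r = w r" if "r \<in> R c" for r
      using that f_edge[OF u a(1-3), of r] us(7) by (auto simp: regions_at_def)
    have "f u ` R {u} = insert (w r1) (insert (w r2) (w ` R c))"
      unfolding us(9) using fs fc by auto
    also have "\<dots> = w ` R {v0}" unfolding v0s(9) by auto
    also have "\<dots> = {1..n+1}" using w by (auto simp: colorings_def bij_betw_def)
    finally have im: "f u ` R {u} = {1..n+1}" .
    \<comment> \<open>A map of n + 1 regions onto n + 1 colors is injective.\<close>
    have "card (R {u}) + 0 = n + 1" using card_regions[of u "{u}" 0] u vertices_vertex by (auto simp: vertices_def)
    then have "inj_on (f u) (R {u})" using im by (intro eq_card_imp_inj_on finite_regions) simp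
    then show ?thesis using im by (simp add: colorings_def bij_betw_def f_def)
  qed
  have "coherent c f"
    unfolding coherent_def
  proof (intro conjI ballI impI)
    fix e u v r assume e: "e \<in> X 1" "e \<subseteq> c" and uv: "u \<in> vertices e" "v \<in> vertices e" and r: "r \<in> R e"
    have "u \<in> vertices c" "v \<in> vertices c" "u \<in> e" "v \<in> e" using uv vertices_mono[OF e(2)] by (auto simp: vertices_def)
    then show "f u r = f v r" using f_edge[OF _ e _ r] by simp
  qed (use f_col in auto)
  moreover have "f v0 = w"
  proof
    fix r
    have "e1 \<in> {e \<in> X 1. e \<subseteq> c \<and> v0 \<in> e}" "e2 \<in> {e \<in> X 1. e \<subseteq> c \<and> v0 \<in> e}" using v0s(1) by auto
    then have e12: "e1 \<in> X 1" "e1 \<subseteq> c" "v0 \<in> e1" "e2 \<in> X 1" "e2 \<subseteq> c" "v0 \<in> e2" by auto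
    show "f v0 r = w r"
    proof (cases "r \<in> R {v0}")
      case False
      then show ?thesis using w by (auto simp: f_def colorings_def extensional_def)
    next
      case True
      then consider "r \<in> R c" | "r = r1" | "r = r2" using v0s(9) by auto
      then show ?thesis
      proof cases
        case 1
        then show ?thesis using f_edge[OF v0 e12(1-3), of r] v0s(7) by (auto simp: regions_at_def)
      next
        case 2
        then show ?thesis using f_edge[OF v0 e12(1-3), of r] v0s(2,7) by auto
      next
        case 3
        then show ?thesis using f_edge[OF v0 e12(4-6), of r] v0s(3,8) by auto
      qed
    qed
  qed
  ultimately show "\<exists>f. coherent c f \<and> f v0 = w" by blast
qed

text \<open>Color each vertex by transport along some edge path in c. Edge paths run in the
  boundary, where carriers are extendable by hypothesis and paths with common ends are homotopic, so
  the choice of path is immaterial; prolonging it by one edge gives coherence.\<close>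

lemma extendable_high_cell:
  assumes c: "c \<in> X k" "3 \<le> k" and IH: "\<And>j d. j < k \<Longrightarrow> d \<in> X j \<Longrightarrow> extendable d"
  shows "extendable c"
  unfolding extendable_def
proof (intro ballI)
  fix v w assume v: "v \<in> vertices c" and w: "w \<in> colorings v"
  let ?B = "cell_boundary X k c"
  have BM: "?B \<subseteq> M" using cell_subset[OF c(1)] cell_boundary_subset by blast
  have ext: "extendable (carrier_cell x)" if "x \<in> ?B" for x
    using carrier_cell_boundary(1)[OF that] IH by blast
  have indep: "transport n X es w = transport n X es' w"
    if es: "edge_path X v es u" "\<Union>(fst ` set es) \<subseteq> c" and es': "edge_path X v es' u" "\<Union>(fst ` set es') \<subseteq> c" for es es' u
  proof -
    have sub: "path_image (realization v es) \<subseteq> ?B" if "edge_path X v es u" "\<Union>(fst ` set es) \<subseteq> c" for es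
    proof -
      have "e \<subseteq> ?B" if "e \<in> fst ` set es" for e
      proof -
        have "e \<in> X 1" "e \<subseteq> c" using edge_path_edges[OF \<open>edge_path X v es u\<close>] that \<open>\<Union>(fst ` set es) \<subseteq> c\<close> by blast+
        then show ?thesis using c(2) unfolding cell_boundary_def by (intro Union_upper) (auto intro!: exI[of _ "1::nat"])
      qed
      moreover have "v \<in> ?B" using v vertices_subset_cell_boundary[of k c] c(2) by auto
      ultimately show ?thesis using realization_path[OF that(1)] by blast
    qed
    note r = realization_path[OF es(1)] and r' = realization_path[OF es'(1)]
    have "homotopic_paths ?B (realization v es) (realization v es')"
      by (rule cell_boundary_homotopic_paths[OF c]) (use r r' sub[OF es] sub[OF es'] in auto)
    then show ?thesis using transport_homotopic[OF BM ext es(1) es'(1) _ w] by blast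
  qed
  have "\<exists>es. edge_path X v es u \<and> \<Union>(fst ` set es) \<subseteq> c" if "u \<in> vertices c" for u
    using cell_edge_connected[OF c(1) v that] .
  then obtain P where P: "\<And>u. u \<in> vertices c \<Longrightarrow> edge_path X v (P u) u \<and> \<Union>(fst ` set (P u)) \<subseteq> c" by metis
  define f where "f u = transport n X (P u) w" for u
  have f_col: "f u \<in> colorings u" if "u \<in> vertices c" for u
    unfolding f_def using P[OF that] transport_coloring w by blast
  have "coherent c f"
    unfolding coherent_def
  proof (intro conjI ballI impI)
    fix e a b r assume e: "e \<in> X 1" "e \<subseteq> c" and ab: "a \<in> vertices e" "b \<in> vertices e" and r: "r \<in> R e"
    show "f a r = f b r"
    proof (cases "a = b")
      case False
      have abc: "a \<in> vertices c" "b \<in> vertices c" using ab vertices_mono[OF e(2)] by auto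
      have "edge_path X a [(e, b)] b" using e ab False by (auto simp: vertices_def)
      then have "edge_path X v (P a @ [(e, b)]) b" using P[OF abc(1)] edge_path_append by blast
      moreover have "\<Union>(fst ` set (P a @ [(e, b)])) \<subseteq> c" using P[OF abc(1)] e by auto
      ultimately have "f b = transport n X (P a @ [(e, b)]) w" unfolding f_def using indep P[OF abc(2)] by blast
      then have "f b = edge_transport n X (e, b) (f a)" by (simp add: transport_def f_def)
      then show ?thesis using edge_transport_coloring(2)[OF e(1) ab(2,1) f_col[OF abc(1)] r] by simp
    qed simp
  qed (use f_col in auto)
  moreover have "f v = w"
  proof -
    have "edge_path X v [] v" using v by (simp add: vertices_def)
    then have "f v = transport n X [] w" unfolding f_def using P[OF v] by (intro indep) auto
    then show ?thesis by (simp add: transport_def)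
  qed
  ultimately show "\<exists>f. coherent c f \<and> f v = w" by blast
qed

lemma extendable_cell:
  assumes "\<forall>c\<in>X 2. even_sided X c" "c \<in> X k"
  shows "extendable c"
  using assms(2)
proof (induction k arbitrary: c rule: less_induct)
  case (less k)
  consider "k = 0" | "k = 1" | "k = 2" | "3 \<le> k" by linarith
  then show ?case
    using less extendable_vertex extendable_edge extendable_two_cell extendable_high_cell assms(1)
    by cases blast+
qed

end

section \<open>Holonomy\<close>

lemma loop_class_eq_iff:
  assumes "path p" "path_image p \<subseteq> S"
  shows "loop_class S p = loop_class S q \<longleftrightarrow> homotopic_paths S p q"
proof
  assume "loop_class S p = loop_class S q"
  moreover have "p \<in> loop_class S p" using assms by (simp add: loop_class_def)
  ultimately have "p \<in> loop_class S q" by simp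
  then show "homotopic_paths S p q" by (simp add: loop_class_def homotopic_paths_sym)
next
  assume "homotopic_paths S p q"
  then show "loop_class S p = loop_class S q"
    unfolding loop_class_def using homotopic_paths_sym homotopic_paths_trans by blast
qed

lemma fundamental_group_carrierE:
  assumes "\<gamma> \<in> carrier (fundamental_group S x)"
  obtains p where "\<gamma> = loop_class S p" "path p" "path_image p \<subseteq> S" "pathstart p = x" "pathfinish p = x"
  using assms by (auto simp: fundamental_group_def)

lemma fundamental_group_carrierI:
  "path p \<Longrightarrow> path_image p \<subseteq> S \<Longrightarrow> pathstart p = x \<Longrightarrow> pathfinish p = x \<Longrightarrow>
    loop_class S p \<in> carrier (fundamental_group S x)"
  by (auto simp: fundamental_group_def)

text \<open>The union over representatives collapses, since every pair of representatives yields the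
  same class.\<close>

lemma fundamental_group_mult:
  assumes "path p" "path_image p \<subseteq> S" "path q" "path_image q \<subseteq> S" "pathfinish p = pathstart q"
  shows "loop_class S p \<otimes>\<^bsub>fundamental_group S x\<^esub> loop_class S q = loop_class S (p +++ q)"
proof -
  have "loop_class S (p' +++ q') = loop_class S (p +++ q)" if "p' \<in> loop_class S p" "q' \<in> loop_class S q" for p' q'
  proof -
    have "homotopic_paths S (p +++ q) (p' +++ q')"
      using that assms(5) by (intro homotopic_paths_join) (auto simp: loop_class_def)
    then show ?thesis using assms loop_class_eq_iff[of "p +++ q" S "p' +++ q'"] by (simp add: path_image_join)
  qed
  moreover have "p \<in> loop_class S p" "q \<in> loop_class S q" using assms by (simp_all add: loop_class_def)
  ultimately have "(\<Union>p'\<in>loop_class S p. \<Union>q'\<in>loop_class S q. loop_class S (p' +++ q')) =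
      (\<Union>p'\<in>loop_class S p. \<Union>q'\<in>loop_class S q. loop_class S (p +++ q))"
    by (intro SUP_cong refl)
  also have "\<dots> = loop_class S (p +++ q)"
    using \<open>p \<in> loop_class S p\<close> \<open>q \<in> loop_class S q\<close> by blast
  finally show ?thesis by (simp add: fundamental_group_def)
qed

lemma inclusion_map_loop_class:
  assumes "path p" "path_image p \<subseteq> S" "S \<subseteq> T"
  shows "inclusion_map T (loop_class S p) = loop_class T p"
proof -
  have "loop_class T q = loop_class T p" if "q \<in> loop_class S p" for q
  proof -
    have "homotopic_paths T p q"
      using that assms(3) homotopic_paths_subset by (auto simp: loop_class_def)
    then show ?thesis using loop_class_eq_iff[of p T q] assms by auto
  qed
  moreover have "p \<in> loop_class S p" using assms by (auto simp: loop_class_def)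
  ultimately have "(\<Union>q\<in>loop_class S p. loop_class T q) = (\<Union>q\<in>loop_class S p. loop_class T p)"
    by (intro SUP_cong refl)
  also have "\<dots> = loop_class T p" using \<open>p \<in> loop_class S p\<close> by blast
  finally show ?thesis by (simp add: inclusion_map_def)
qed

section \<open>Permutations of closed edge paths\<close>

context cpx_complex begin

text \<open>The permutation of one edge path. \<open>Hol1\<close> ranges over all edge paths in a
  class and is meaningful only once their permutations are known to agree.\<close>

definition holonomy :: "'a \<Rightarrow> ('a set \<Rightarrow> nat) \<Rightarrow> ('a set \<times> 'a) list \<Rightarrow> nat \<Rightarrow> nat" where
  "holonomy v w es = (THE \<sigma>. \<sigma> permutes {1..n+1} \<and> (\<forall>r\<in>R {v}. transport n X es w r = \<sigma> (w r)))"

lemma holonomy_unique: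
  assumes "bij_betw w (R {v}) {1..n+1}"
    and "\<sigma> permutes {1..n+1}" "\<tau> permutes {1..n+1}" "\<And>r. r \<in> R {v} \<Longrightarrow> \<sigma> (w r) = \<tau> (w r)"
  shows "\<sigma> = \<tau>"
proof
  fix i
  show "\<sigma> i = \<tau> i"
  proof (cases "i \<in> {1..n+1}")
    case True
    then obtain r where "r \<in> R {v}" "i = w r" using assms(1) unfolding bij_betw_def by (metis imageE)
    then show ?thesis using assms(4) by simp
  next
    case False
    then show ?thesis using assms(2,3) by (metis permutes_not_in)
  qed
qed

lemma holonomy_exists:
  assumes "w \<in> colorings v" "w' \<in> colorings v"
  shows "\<exists>\<sigma>. \<sigma> permutes {1..n+1} \<and> (\<forall>r\<in>R {v}. w' r = \<sigma> (w r))"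
proof -
  have w: "bij_betw w (R {v}) {1..n+1}" "bij_betw w' (R {v}) {1..n+1}" using assms by (auto simp: colorings_def)
  define \<sigma> where "\<sigma> i = (if i \<in> {1..n+1} then w' (inv_into (R {v}) w i) else i)" for i
  have "bij_betw (w' \<circ> inv_into (R {v}) w) {1..n+1} {1..n+1}"
    using bij_betw_trans[OF bij_betw_inv_into[OF w(1)] w(2)] .
  then have "bij_betw \<sigma> {1..n+1} {1..n+1}" by (rule bij_betw_cong[THEN iffD1, rotated]) (simp add: \<sigma>_def)
  then have "\<sigma> permutes {1..n+1}" by (rule bij_imp_permutes) (auto simp: \<sigma>_def)
  moreover have "w' r = \<sigma> (w r)" if "r \<in> R {v}" for r
  proof -
    have "w r \<in> {1..n+1}" using w(1) that by (auto simp: bij_betw_def)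
    then show ?thesis using bij_betw_inv_into_left[OF w(1) that] by (simp add: \<sigma>_def)
  qed
  ultimately show ?thesis by blast
qed

lemma holonomy:
  assumes "w \<in> colorings v" "edge_path X v es v"
  shows "holonomy v w es permutes {1..n+1}" "\<And>r. r \<in> R {v} \<Longrightarrow> transport n X es w r = holonomy v w es (w r)"
proof -
  have w: "bij_betw w (R {v}) {1..n+1}" using assms by (auto simp: colorings_def)
  have "transport n X es w \<in> colorings v" using transport_coloring assms by blast
  from holonomy_exists[OF assms(1) this]
  obtain \<sigma> where \<sigma>: "\<sigma> permutes {1..n+1}" "\<forall>r\<in>R {v}. transport n X es w r = \<sigma> (w r)" by blast
  have "holonomy v w es = \<sigma>"
    unfolding holonomy_def
  proof (rule the_equality)
    fix \<tau> assume "\<tau> permutes {1..n+1} \<and> (\<forall>r\<in>R {v}. transport n X es w r = \<tau> (w r))"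
    then show "\<tau> = \<sigma>" using holonomy_unique[OF w] \<sigma> by auto
  qed (use \<sigma> in auto)
  then show "holonomy v w es permutes {1..n+1}" "\<And>r. r \<in> R {v} \<Longrightarrow> transport n X es w r = holonomy v w es (w r)"
    using \<sigma> by auto
qed

text \<open>The first loop turns w into \<sigma> \<circ> w. The second one starts from this
  recoloring, and \<open>transport_permuted\<close> leaves \<sigma> on the left.\<close>

lemma holonomy_append:
  assumes w: "w \<in> colorings v" and es: "edge_path X v es v" "edge_path X v es' v"
  shows "holonomy v w (es @ es') = holonomy v w es \<circ> holonomy v w es'"
proof (rule holonomy_unique)
  let ?\<sigma> = "holonomy v w es" and ?\<tau> = "holonomy v w es'"
  show "bij_betw w (R {v}) {1..n+1}" using w by (auto simp: colorings_def)
  have app: "edge_path X v (es @ es') v" using edge_path_append es by blast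
  show "holonomy v w (es @ es') permutes {1..n+1}" using holonomy(1)[OF w app] .
  show "?\<sigma> \<circ> ?\<tau> permutes {1..n+1}" using holonomy(1)[OF w] es by (intro permutes_compose)
  fix r assume r: "r \<in> R {v}"
  have "transport n X es w = restrict (?\<sigma> \<circ> w) (R {v})"
  proof
    fix r
    show "transport n X es w r = restrict (?\<sigma> \<circ> w) (R {v}) r"
      using holonomy(2)[OF w es(1)] transport_coloring[OF es(1) w]
      by (auto simp: colorings_def extensional_def)
  qed
  then have "transport n X (es @ es') w = restrict (?\<sigma> \<circ> transport n X es' w) (R {v})"
    using transport_permuted[OF es(2) w holonomy(1)[OF w es(1)]] by (simp only: transport_append)
  then have "transport n X (es @ es') w r = ?\<sigma> (?\<tau> (w r))"
    using r holonomy(2)[OF w es(2) r] by simp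
  then show "holonomy v w (es @ es') (w r) = (?\<sigma> \<circ> ?\<tau>) (w r)"
    using holonomy(2)[OF w app r] by simp
qed

text \<open>The given \<open>col\<close> may have any values away from the regions at the base
  vertex, whereas \<open>colorings\<close> are extensional. The first edge already reads only values
  on \<open>R e\<close>; for the empty path, r is confined to the regions at the vertex.\<close>

lemma transport_restrict:
  assumes "edge_path X v es v'"
    and col: "bij_betw col (R {v}) {1..n+1}" and r: "r \<in> R {v'}"
  shows "transport n X es col r = transport n X es (restrict col (R {v})) r"
proof (cases es)
  case Nil
  then show ?thesis using assms by (simp add: transport_def)
next
  case (Cons s es')
  obtain e u where s: "s = (e, u)" by (cases s)
  note * = edge_path_Cons_D[OF assms(1)[unfolded Cons s]]
  have w: "restrict col (R {v}) \<in> colorings v" using col by (simp add: colorings_def bij_betw_restrict_eq)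
  note g = edge_transport_coloring[OF *(1,3,2) w]
  have "R e \<subseteq> R {v}" using *(2) by (auto simp: vertices_def intro!: regions_antimono)
  then have "edge_transport n X (e, u) col = edge_transport n X (e, u) (restrict col (R {v}))"
    using g by (intro edge_transport_eqI[OF *(1,3)]) auto
  then show ?thesis by (simp add: Cons s transport_Cons)
qed

end

theorem proposition6:
  fixes M :: "'a::topological_space set"
    and A :: "('a set \<times> ('a \<Rightarrow> real ^ 'n::finite)) set"
    and X :: "nat \<Rightarrow> 'a set set"
    and v0 :: 'a
    and col :: "'a set \<Rightarrow> nat"
  assumes "closed_smooth_manifold M A" and "connected M"
    and "cpx TYPE('n) M X"
    and "\<forall>c \<in> X 2. even_sided X c"
    and "{v0} \<in> X 0"
    and "bij_betw col (regions_at CARD('n) X {v0}) {1..CARD('n) + 1}"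
  shows "\<exists>!H. H \<in> hom (fundamental_group M v0) (sym_group (CARD('n) + 1)) \<and>
              H \<in> extensional (carrier (fundamental_group M v0)) \<and>
              (\<forall>\<gamma> \<in> carrier (fundamental_group (skeleton X 1) v0).
                 H (inclusion_map M \<gamma>) = Hol1 CARD('n) X v0 col \<gamma>)"
proof -
  let ?n = "CARD('n)" and ?S = "skeleton X 1"
  interpret cpx_complex "TYPE('n)" M X ?n
    using assms(1,3) by unfold_locales (auto simp: closed_smooth_manifold_def)
  let ?G = "fundamental_group M v0" and ?GS = "fundamental_group ?S v0"
  define w where "w = restrict col (R {v0})"
  have w: "w \<in> colorings v0"
    using assms(6) by (simp add: w_def colorings_def bij_betw_restrict_eq)
  have wbij: "bij_betw w (R {v0}) {1..?n+1}" using w by (simp add: colorings_def)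
  have ext: "extendable (carrier_cell x)" if "x \<in> M" for x
    using carrier_cell_obtain[OF that] extendable_cell[OF assms(4)] by metis
  have carM: "carrier_cell x \<subseteq> M" if "x \<in> M" for x
    using carrier_cell_obtain[OF that] cell_subset by metis
  have SM: "?S \<subseteq> M" by (rule skeleton_subset)
  have locM: "locally_cellular M"
    using assms(1) locally_cellular_manifold by (auto simp: closed_smooth_manifold_def)
  \<comment> \<open>The fundamental group of the 1-skeleton maps onto that of \<open>M\<close>; both
    the definition of \<open>H\<close> and its uniqueness depend on this.\<close>
  have loop_M: "\<exists>es. edge_path X v0 es v0 \<and> realization v0 es \<in> \<gamma>" if \<gamma>: "\<gamma> \<in> carrier ?G" for \<gamma>
  proof -
    obtain p where p: "\<gamma> = loop_class M p" "path p" "path_image p \<subseteq> M" "pathstart p = v0" "pathfinish p = v0"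
      using fundamental_group_carrierE[OF \<gamma>] by metis
    then show ?thesis
      using path_homotopic_realization[OF order_refl carM locM p(2,3)] assms(5) by (simp add: loop_class_def)
  qed
  \<comment> \<open>\<open>Hol1\<close> asks for an edge path in the class formed within the
    skeleton, which is finer than the class in \<open>M\<close>.\<close>
  have loop_S: "\<exists>es. edge_path X v0 es v0 \<and> realization v0 es \<in> \<gamma>" if \<gamma>: "\<gamma> \<in> carrier ?GS" for \<gamma>
  proof -
    obtain p where p: "\<gamma> = loop_class ?S p" "path p" "path_image p \<subseteq> ?S" "pathstart p = v0" "pathfinish p = v0"
      using fundamental_group_carrierE[OF \<gamma>] by metis
    then show ?thesis
      using path_homotopic_realization[OF SM carrier_cell_skeleton(1) locally_cellular_skeleton_1 p(2,3)] assms(5)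
      by (simp add: loop_class_def)
  qed
  have real_S: "path (realization v0 es)" "path_image (realization v0 es) \<subseteq> ?S"
      "pathstart (realization v0 es) = v0" "pathfinish (realization v0 es) = v0" if es: "edge_path X v0 es v0" for es
  proof -
    note r = realization_path[OF es]
    show "path (realization v0 es)" "pathstart (realization v0 es) = v0" "pathfinish (realization v0 es) = v0"
      using r by auto
    have "insert v0 (\<Union>(fst ` set es)) \<subseteq> ?S"
      using edge_path_edges[OF es] assms(5) unfolding skeleton_1 by auto
    then show "path_image (realization v0 es) \<subseteq> ?S" using r by blast
  qed
  \<comment> \<open>This also shows that \<open>Hol1\<close> is well defined, since loops homotopic
    in the skeleton are homotopic in \<open>M\<close>.\<close>
  have same: "holonomy v0 w es = holonomy v0 w es'"
    if \<gamma>: "\<gamma> \<in> carrier ?G" and es: "edge_path X v0 es v0" "realization v0 es \<in> \<gamma>"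
      and es': "edge_path X v0 es' v0" "realization v0 es' \<in> \<gamma>" for \<gamma> es es'
  proof -
    obtain p where "\<gamma> = loop_class M p" using fundamental_group_carrierE[OF \<gamma>] by metis
    then have "homotopic_paths M p (realization v0 es)" "homotopic_paths M p (realization v0 es')"
      using es(2) es'(2) by (auto simp: loop_class_def)
    then have "homotopic_paths M (realization v0 es) (realization v0 es')"
      using homotopic_paths_sym homotopic_paths_trans by blast
    then have "transport ?n X es w = transport ?n X es' w"
      using transport_homotopic[OF order_refl ext es(1) es'(1) _ w] by blast
    then show ?thesis by (simp add: holonomy_def)
  qed
  \<comment> \<open>The restriction fixes \<open>H\<close> off the carrier, where the homomorphism
    condition says nothing.\<close>
  define H where "H = (\<lambda>\<gamma>\<in>carrier ?G. holonomy v0 w (SOME es. edge_path X v0 es v0 \<and> realization v0 es \<in> \<gamma>))"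
  have H_eq: "H \<gamma> = holonomy v0 w es"
    if \<gamma>: "\<gamma> \<in> carrier ?G" and es: "edge_path X v0 es v0" "realization v0 es \<in> \<gamma>" for \<gamma> es
  proof -
    have "edge_path X v0 (SOME es. edge_path X v0 es v0 \<and> realization v0 es \<in> \<gamma>) v0 \<and>
        realization v0 (SOME es. edge_path X v0 es v0 \<and> realization v0 es \<in> \<gamma>) \<in> \<gamma>"
      by (rule someI_ex[OF loop_M[OF \<gamma>]])
    then show ?thesis using same[OF \<gamma> _ _ es] \<gamma> by (simp add: H_def)
  qed
  have class_eq: "\<gamma> = loop_class M (realization v0 es)"
    if \<gamma>: "\<gamma> \<in> carrier ?G" and es: "realization v0 es \<in> \<gamma>" for \<gamma> es
  proof -
    obtain p where p: "\<gamma> = loop_class M p" "path p" "path_image p \<subseteq> M"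
      using fundamental_group_carrierE[OF \<gamma>] by metis
    then show ?thesis using es loop_class_eq_iff[OF p(2,3)] by (simp add: loop_class_def)
  qed
  have H_hom: "H \<in> hom ?G (sym_group (?n + 1))"
  proof (rule homI)
    show "H \<gamma> \<in> carrier (sym_group (?n + 1))" if \<gamma>: "\<gamma> \<in> carrier ?G" for \<gamma>
      using loop_M[OF \<gamma>] H_eq[OF \<gamma>] holonomy(1)[OF w] by (auto simp: sym_group_def)
    fix \<gamma> \<delta> assume \<gamma>: "\<gamma> \<in> carrier ?G" and \<delta>: "\<delta> \<in> carrier ?G"
    obtain es where es: "edge_path X v0 es v0" "realization v0 es \<in> \<gamma>" using loop_M[OF \<gamma>] by blast
    obtain es' where es': "edge_path X v0 es' v0" "realization v0 es' \<in> \<delta>" using loop_M[OF \<delta>] by blast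
    have app: "edge_path X v0 (es @ es') v0" using edge_path_append es(1) es'(1) by blast
    note r = real_S[OF es(1)] and r' = real_S[OF es'(1)]
    have "\<gamma> \<otimes>\<^bsub>?G\<^esub> \<delta> = loop_class M (realization v0 es +++ realization v0 es')"
      using class_eq[OF \<gamma> es(2)] class_eq[OF \<delta> es'(2)] r r' SM
        fundamental_group_mult[of "realization v0 es" M "realization v0 es'"] by auto
    moreover have "homotopic_paths M (realization v0 es +++ realization v0 es') (realization v0 (es @ es'))"
    proof (rule realization_append[OF es(1) es'(1)])
      show "insert v0 (\<Union>(fst ` set es)) \<subseteq> M" "insert v0 (\<Union>(fst ` set es')) \<subseteq> M"
        using edge_path_edges[OF es(1)] edge_path_edges[OF es'(1)] assms(5) cell_subset by blast+
    qed
    moreover have "loop_class M (realization v0 es +++ realization v0 es') \<in> carrier ?G"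
      using r r' SM by (intro fundamental_group_carrierI) (auto simp: path_image_join)
    ultimately have "\<gamma> \<otimes>\<^bsub>?G\<^esub> \<delta> \<in> carrier ?G" "realization v0 (es @ es') \<in> \<gamma> \<otimes>\<^bsub>?G\<^esub> \<delta>"
      by (simp_all add: loop_class_def)
    then have "H (\<gamma> \<otimes>\<^bsub>?G\<^esub> \<delta>) = holonomy v0 w es \<circ> holonomy v0 w es'"
      using H_eq[OF _ app] holonomy_append[OF w es(1) es'(1)] by simp
    then show "H (\<gamma> \<otimes>\<^bsub>?G\<^esub> \<delta>) = H \<gamma> \<otimes>\<^bsub>sym_group (?n + 1)\<^esub> H \<delta>"
      using H_eq[OF \<gamma> es] H_eq[OF \<delta> es'] by (simp add: sym_group_def)
  qed
  have H_ext: "H (inclusion_map M \<gamma>) = Hol1 ?n X v0 col \<gamma>" if \<gamma>: "\<gamma> \<in> carrier ?GS" for \<gamma>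
  proof -
    obtain p where p: "\<gamma> = loop_class ?S p" "path p" "path_image p \<subseteq> ?S" "pathstart p = v0" "pathfinish p = v0"
      using fundamental_group_carrierE[OF \<gamma>] by metis
    have inc: "inclusion_map M \<gamma> = loop_class M p" using inclusion_map_loop_class[OF p(2,3) SM] p(1) by simp
    have inG: "loop_class M p \<in> carrier ?G" using p SM by (intro fundamental_group_carrierI) auto
    have inM: "realization v0 es \<in> loop_class M p" if "realization v0 es \<in> \<gamma>" for es
      using that p(1) homotopic_paths_subset SM by (auto simp: loop_class_def)
    have hol_col: "transport ?n X es col r = holonomy v0 w es (col r)" if "edge_path X v0 es v0" "r \<in> R {v0}" for es r
      using transport_restrict[OF that(1) assms(6) that(2)] holonomy(2)[OF w that] that(2) by (simp add: w_def)
    have "Hol1 ?n X v0 col \<gamma> = H (loop_class M p)"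
      unfolding Hol1_def
    proof (rule the_equality)
      obtain es where es: "edge_path X v0 es v0" "realization v0 es \<in> \<gamma>" using loop_S[OF \<gamma>] by blast
      have "H (loop_class M p) = holonomy v0 w es" using H_eq[OF inG es(1) inM[OF es(2)]] .
      then show "H (loop_class M p) permutes {1..?n+1} \<and> (\<exists>es. edge_path X v0 es v0 \<and> realization v0 es \<in> \<gamma> \<and>
          (\<forall>r\<in>R {v0}. transport ?n X es col r = H (loop_class M p) (col r)))"
        using holonomy(1)[OF w es(1)] es hol_col[OF es(1)] by auto
      fix \<sigma> assume "\<sigma> permutes {1..?n+1} \<and> (\<exists>es. edge_path X v0 es v0 \<and> realization v0 es \<in> \<gamma> \<and>
          (\<forall>r\<in>R {v0}. transport ?n X es col r = \<sigma> (col r)))"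
      then obtain es' where es': "edge_path X v0 es' v0" "realization v0 es' \<in> \<gamma>" and \<sigma>: "\<sigma> permutes {1..?n+1}"
          "\<forall>r\<in>R {v0}. transport ?n X es' col r = \<sigma> (col r)" by blast
      have "\<sigma> = holonomy v0 w es'"
        using holonomy_unique[OF assms(6) \<sigma>(1) holonomy(1)[OF w es'(1)]] \<sigma>(2) hol_col[OF es'(1)] by simp
      then show "\<sigma> = H (loop_class M p)" using H_eq[OF inG es'(1) inM[OF es'(2)]] by simp
    qed
    then show ?thesis using inc by simp
  qed
  show ?thesis
  proof (rule ex1I[of _ H])
    show "H \<in> hom ?G (sym_group (?n + 1)) \<and> H \<in> extensional (carrier ?G) \<and>
        (\<forall>\<gamma>\<in>carrier ?GS. H (inclusion_map M \<gamma>) = Hol1 ?n X v0 col \<gamma>)"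
      using H_hom H_ext by (simp add: H_def)
    fix H' assume H': "H' \<in> hom ?G (sym_group (?n + 1)) \<and> H' \<in> extensional (carrier ?G) \<and>
        (\<forall>\<gamma>\<in>carrier ?GS. H' (inclusion_map M \<gamma>) = Hol1 ?n X v0 col \<gamma>)"
    show "H' = H"
    proof (rule extensionalityI[of _ "carrier ?G"])
      show "H' \<in> extensional (carrier ?G)" "H \<in> extensional (carrier ?G)" using H' by (auto simp: H_def)
      fix \<gamma> assume \<gamma>: "\<gamma> \<in> carrier ?G"
      obtain es where es: "edge_path X v0 es v0" "realization v0 es \<in> \<gamma>" using loop_M[OF \<gamma>] by blast
      \<comment> \<open>The class of this edge path in the skeleton is sent to \<gamma>, so
        \<open>Hol1\<close> prescribes the value of \<open>H'\<close> and of \<open>H\<close>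
        there.\<close>
      let ?\<delta> = "loop_class ?S (realization v0 es)"
      have "?\<delta> \<in> carrier ?GS" using real_S[OF es(1)] by (intro fundamental_group_carrierI)
      moreover have "inclusion_map M ?\<delta> = \<gamma>"
        using inclusion_map_loop_class[OF real_S(1,2)[OF es(1)] SM] class_eq[OF \<gamma> es(2)] by simp
      ultimately show "H' \<gamma> = H \<gamma>" using H' H_ext by metis
    qed
  qed
qed

end
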